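(* Let $r\ge3$ and $m\ge1$ be integers, let $K\subseteq\mathbb{R}$ be a compact set, and let $F_i=(F_i^k)_{0\le k\le m}$ ($1\le i\le r$) and $F_{ij}=(F_{ij}^k)_{0\le k\le m}$ ($1\le j<i\le r$) be jets of order $m$ on $K$. Then there exists a $C^m$ horizontal curve $\gamma:\mathbb{R}\to\mathbb{G}_r$ such that $D^k\gamma_i|_K=F_i^k$ for every $0\le k\le m$ and $1\le i\le r$, and $D^k\gamma_{ij}|_K=F_{ij}^k$ for every $0\le k\le m$ and $1\le j<i\le r$, if and only if the following three conditions hold: (1) all the jets $(F_i)_{1\le i\le r}$ and $(F_{ij})_{1\le j<i\le r}$ are Whitney fields of class $C^m$ on $K$; (2) for every $1\le k\le m$, every $t\in K$ and all $1\le j<i\le r$, $$F_{ij}^k(t)=\mathcal{P}^k\big(F_i^0(t),F_j^0(t),F_i^1(t),F_j^1(t),\dots,F_i^k(t),F_j^k(t)\big);$$ (3) the jets $(F_i)_{1\le i\le r}$ and $(F_{ij})_{1\le j<i\le r}$ satisfy the generalized $A/V$ condition (for $\mathbb{G}_r$).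
   Context: **Jets and Whitney fields.** A jet of order $m$ on $K$ is a collection $F=(F^k)_{0\le k\le m}$ of $m+1$ continuous functions $F^k:K\to\mathbb{R}$. Write $F(a):=F^0(a)$. Its formal Taylor polynomial at $a\in K$ is $T_aF(x)=T_a^mF(x):=\sum_{k=0}^m\frac{F^k(a)}{k!}(x-a)^k$; $T_aF'$ denotes the derivative $(T_a^mF)'$ in $x$. A jet $F$ is a Whitney field of class $C^m$ on $K$ if for every $0\le k\le m$, $$\frac{\big|F^k(b)-\sum_{l=0}^{m-k}\frac{F^{k+l}(a)}{l!}(b-a)^l\big|}{|b-a|^{m-k}}\to 0\quad\text{uniformly as } |a-b|\to0,\ a,b\in K,\ a\neq b.$$ $D^k f$ denotes the $k$-th derivative, with $D^0f=f$. **The group $\mathbb{G}_r$.** Let $n=r+r(r-1)/2$ and write coordinates of $\mathbb{R}^n$ as $x_i$ ($1\le i\le r$) and $x_{ij}$ ($1\le j<i\le r$). The free step 2 Carnot group $\mathbb{G}_r$ with $r$ generators is $\mathbb{R}^n$ with product $(x\cdot y)_k=x_k+y_k$ and $(x\cdot y)_{ij}=x_{ij}+y_{ij}+\frac12(x_iy_j-y_ix_j)$. Set, for $1\le k\le r$, $$X_k=\frac{\partial}{\partial x_k}+\sum_{j>k}\frac{x_j}{2}\frac{\partial}{\partial x_{jk}}-\sum_{j<k}\frac{x_j}{2}\frac{\partial}{\partial x_{kj}}.$$ A (locally) absolutely continuous curve $\gamma$ in $\mathbb{G}_r$ is horizontal if $\gamma'(t)\in\mathrm{Span}\{X_k(\gamma(t)):1\le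 k\le r\}$ for almost every $t$; it is a $C^m$ horizontal curve if in addition it is of class $C^m$ as a map into $\mathbb{R}^n$. Its components are denoted $\gamma_i$, $\gamma_{ij}$. **The polynomials $\mathcal{P}^k$.** For $k\ge1$, $$\mathcal{P}^k(x_0,y_0,\dots,x_k,y_k):=\frac12\sum_{l=0}^{k-1}\binom{k-1}{l}(x_ly_{k-l}-y_lx_{k-l}).$$ **The quantities $A_{ij}$.** For $a,b\in K$ and $1\le j<i\le r$, $$A_{ij}(a,b):=F_{ij}(b)-F_{ij}(a)-\frac12\int_a^b\big((T_aF_i)(T_aF_j)'-(T_aF_i)'(T_aF_j)\big)+\frac12F_j(a)\big(F_i(b)-T_aF_i(b)\big)-\frac12F_i(a)\big(F_j(b)-T_aF_j(b)\big).$$ **The quantities $E_{ij},\Delta_i,\Delta_j$.** Fix $1\le j<i\le r$ and let $S=\{1,\dots,r\}\setminus\{i,j\}$. For collections of real numbers $c=(c_k)_{k\in S}$, $\tilde c=(\tilde c_k)_{k\in S}$ and $a,b\in K$, set $$\begin{aligned}E_{ij}(a,b,c,\tilde c):=A_{ij}(a,b)&+\sum_{k=1}^{j-1}\tilde c_kA_{jk}(a,b)-\sum_{k>j,\,k\ne i}^{r}\tilde c_kA_{kj}(a,b)\\&-\sum_{k=1,\,k\neq j}^{i-1}c_kA_{ik}(a,b)+\sum_{k>i}^{r}c_kA_{ki}(a,b)+\sum_{k>n;\ k,n\in S}(c_n\tilde c_k-\tilde c_nc_k)A_{kn}(a,b),\end{aligned}$$ $$\Delta_i(a,b,\tilde c):=\int_a^b\Big|T_aF_i'-\sum_{k\in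 S}\tilde c_kT_aF_k'\Big|,\qquad \Delta_j(a,b,c):=\int_a^b\Big|T_aF_j'-\sum_{k\in S}c_kT_aF_k'\Big|.$$ **Generalized $A/V$ condition for $\mathbb{G}_r$.** For every compact set $A\subseteq\mathbb{R}$ and all $1\le j<i\le r$, $$\sup_{c_k,\tilde c_k\in A\ (k\in S)}\frac{|E_{ij}(a,b,c,\tilde c)|}{(b-a)^{2m}+(b-a)^m\big(\Delta_i(a,b,\tilde c)+\Delta_j(a,b,c)\big)}\to0$$ as $b-a\searrow0$ with $a,b\in K$, $a<b$ (that is, for every $\epsilon>0$ there is $\delta>0$ such that the supremum is at most $\epsilon$ for all $a,b\in K$ with $0<b-a<\delta$). *)

theory Defs
  imports "HOL-Analysis.Analysis" "HOL-Algebra.Group"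
begin

section \<open>Jets and Whitney fields\<close>

text \<open>A jet is a function \<^term>\<open>F :: nat \<Rightarrow> real \<Rightarrow> real\<close>; only the values \<^term>\<open>F k t\<close> with
  \<^term>\<open>k \<le> m\<close> and \<^term>\<open>t \<in> K\<close> are relevant.\<close>

definition jet :: "nat \<Rightarrow> real set \<Rightarrow> (nat \<Rightarrow> real \<Rightarrow> real) \<Rightarrow> bool" where
  "jet m K F \<longleftrightarrow> (\<forall>k\<le>m. continuous_on K (F k))"

definition taylor :: "nat \<Rightarrow> (nat \<Rightarrow> real \<Rightarrow> real) \<Rightarrow> real \<Rightarrow> real \<Rightarrow> real" where
  "taylor m F a x = (\<Sum>k\<le>m. F k a / fact k * (x - a) ^ k)"

definition whitney_field :: "nat \<Rightarrow> real set \<Rightarrow> (nat \<Rightarrow> real \<Rightarrow> real) \<Rightarrow> bool" where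
  "whitney_field m K F \<longleftrightarrow> jet m K F \<and>
     (\<forall>k\<le>m. \<forall>\<epsilon>>0. \<exists>\<delta>>0. \<forall>a\<in>K. \<forall>b\<in>K. a \<noteq> b \<and> \<bar>a - b\<bar> < \<delta> \<longrightarrow>
        \<bar>F k b - (\<Sum>l\<le>m - k. F (k + l) a / fact l * (b - a) ^ l)\<bar> / \<bar>b - a\<bar> ^ (m - k) < \<epsilon>)"

definition C_class :: "nat \<Rightarrow> (real \<Rightarrow> real) \<Rightarrow> bool" where
  "C_class m f \<longleftrightarrow> (\<forall>k<m. \<forall>t. (deriv ^^ k) f differentiable (at t)) \<and>
     continuous_on UNIV ((deriv ^^ m) f)"

section \<open>The free step 2 Carnot group with \<open>r\<close> generators\<close>

text \<open>\<^term>\<open>Hor i\<close> indexes the coordinate \<open>x\<^sub>i\<close> and \<^term>\<open>Ver i j\<close> the coordinate \<open>x\<^sub>i\<^sub>j\<close>. A point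
  is a function on the index set \<open>coords r\<close>, which has \<open>r + r (r - 1) / 2\<close> elements.\<close>

datatype coord = Hor nat | Ver nat nat

definition coords :: "nat \<Rightarrow> coord set" where
  "coords r = {Hor i | i. 1 \<le> i \<and> i \<le> r} \<union> {Ver i j | i j. 1 \<le> j \<and> j < i \<and> i \<le> r}"

fun carnot_prod :: "(coord \<Rightarrow> real) \<Rightarrow> (coord \<Rightarrow> real) \<Rightarrow> coord \<Rightarrow> real" where
  "carnot_prod x y (Hor k) = x (Hor k) + y (Hor k)"
| "carnot_prod x y (Ver i j) =
     x (Ver i j) + y (Ver i j) + (x (Hor i) * y (Hor j) - y (Hor i) * x (Hor j)) / 2"

definition free_carnot :: "nat \<Rightarrow> (coord \<Rightarrow> real) monoid" where
  "free_carnot r =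
     \<lparr>carrier = coords r \<rightarrow>\<^sub>E UNIV,
      mult = (\<lambda>x y. restrict (carnot_prod x y) (coords r)),
      one = restrict (\<lambda>_. 0) (coords r)\<rparr>"

text \<open>\<^term>\<open>horizontal_field k x c\<close> is the coefficient of the partial derivative in direction \<open>c\<close>
  of the vector field \<open>X\<^sub>k\<close> at the point \<open>x\<close>.\<close>

fun horizontal_field :: "nat \<Rightarrow> (coord \<Rightarrow> real) \<Rightarrow> coord \<Rightarrow> real" where
  "horizontal_field k x (Hor l) = (if l = k then 1 else 0)"
| "horizontal_field k x (Ver i j) =
     (if j = k then x (Hor i) / 2 else if i = k then - (x (Hor j) / 2) else 0)"

text \<open>The span of \<open>X\<^sub>1(x), \<dots>, X\<^sub>r(x)\<close>, as explicit linear combinations: functions on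
  \<open>coords r\<close> are not an instance of \<^class>\<open>real_vector\<close>.\<close>

definition horizontal_space :: "nat \<Rightarrow> (coord \<Rightarrow> real) \<Rightarrow> (coord \<Rightarrow> real) set" where
  "horizontal_space r x =
     {restrict (\<lambda>c. \<Sum>k=1..r. u k * horizontal_field k x c) (coords r) | u. True}"

definition abs_continuous_on :: "real \<Rightarrow> real \<Rightarrow> (real \<Rightarrow> real) \<Rightarrow> bool" where
  "abs_continuous_on a b f \<longleftrightarrow>
     (\<forall>\<epsilon>>0. \<exists>\<delta>>0. \<forall>d S. d division_of S \<and> S \<subseteq> {a..b} \<and> (\<Sum>I\<in>d. Sup I - Inf I) < \<delta> \<longrightarrow>
        (\<Sum>I\<in>d. \<bar>f (Sup I) - f (Inf I)\<bar>) < \<epsilon>)"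

definition horizontal_curve :: "nat \<Rightarrow> (real \<Rightarrow> coord \<Rightarrow> real) \<Rightarrow> bool" where
  "horizontal_curve r \<gamma> \<longleftrightarrow>
     \<gamma> \<in> UNIV \<rightarrow> carrier (free_carnot r) \<and>
     (\<forall>c\<in>coords r. \<forall>a b. abs_continuous_on a b (\<lambda>t. \<gamma> t c)) \<and>
     (AE t in lebesgue. \<exists>v\<in>horizontal_space r (\<gamma> t).
        \<forall>c\<in>coords r. ((\<lambda>s. \<gamma> s c) has_real_derivative v c) (at t))"

definition C_horizontal_curve :: "nat \<Rightarrow> nat \<Rightarrow> (real \<Rightarrow> coord \<Rightarrow> real) \<Rightarrow> bool" where
  "C_horizontal_curve m r \<gamma> \<longleftrightarrow>
     horizontal_curve r \<gamma> \<and> (\<forall>c\<in>coords r. C_class m (\<lambda>t. \<gamma> t c))"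

section \<open>The polynomials and the generalized \<open>A/V\<close> condition\<close>

text \<open>\<open>vert_poly k x y\<close> is \<open>\<P>\<^sup>k(x\<^sub>0, y\<^sub>0, \<dots>, x\<^sub>k, y\<^sub>k)\<close>, for \<open>k \<ge> 1\<close>.\<close>

definition vert_poly :: "nat \<Rightarrow> (nat \<Rightarrow> real) \<Rightarrow> (nat \<Rightarrow> real) \<Rightarrow> real" where
  "vert_poly k x y =
     1/2 * (\<Sum>l=0..k - 1. of_nat ((k - 1) choose l) * (x l * y (k - l) - y l * x (k - l)))"

text \<open>Below, \<open>F i\<close> is the jet \<open>F\<^sub>i\<close> and \<open>G i j\<close> is the jet \<open>F\<^sub>i\<^sub>j\<close>.\<close>

definition area_term ::
  "nat \<Rightarrow> (nat \<Rightarrow> nat \<Rightarrow> real \<Rightarrow> real) \<Rightarrow> (nat \<Rightarrow> nat \<Rightarrow> nat \<Rightarrow> real \<Rightarrow> real) \<Rightarrow>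
   nat \<Rightarrow> nat \<Rightarrow> real \<Rightarrow> real \<Rightarrow> real" where
  "area_term m F G i j a b =
     G i j 0 b - G i j 0 a
     - 1/2 * (LBINT x=a..b. taylor m (F i) a x * deriv (taylor m (F j) a) x
                          - deriv (taylor m (F i) a) x * taylor m (F j) a x)
     + 1/2 * F j 0 a * (F i 0 b - taylor m (F i) a b)
     - 1/2 * F i 0 a * (F j 0 b - taylor m (F j) a b)"

definition rest_idx :: "nat \<Rightarrow> nat \<Rightarrow> nat \<Rightarrow> nat set" where
  "rest_idx r i j = {1..r} - {i, j}"

definition gen_area ::
  "nat \<Rightarrow> nat \<Rightarrow> (nat \<Rightarrow> nat \<Rightarrow> real \<Rightarrow> real) \<Rightarrow> (nat \<Rightarrow> nat \<Rightarrow> nat \<Rightarrow> real \<Rightarrow> real) \<Rightarrow>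
   nat \<Rightarrow> nat \<Rightarrow> real \<Rightarrow> real \<Rightarrow> (nat \<Rightarrow> real) \<Rightarrow> (nat \<Rightarrow> real) \<Rightarrow> real" where
  "gen_area m r F G i j a b c c' =
     area_term m F G i j a b
     + (\<Sum>k\<in>{1..<j}. c' k * area_term m F G j k a b)
     - (\<Sum>k\<in>{j<..r} - {i}. c' k * area_term m F G k j a b)
     - (\<Sum>k\<in>{1..<i} - {j}. c k * area_term m F G i k a b)
     + (\<Sum>k\<in>{i<..r}. c k * area_term m F G k i a b)
     + (\<Sum>(k, n)\<in>{(k, n). k \<in> rest_idx r i j \<and> n \<in> rest_idx r i j \<and> k > n}.
          (c n * c' k - c' n * c k) * area_term m F G k n a b)"

text \<open>Both \<open>\<Delta>\<^sub>i(a, b, d)\<close> and \<open>\<Delta>\<^sub>j(a, b, d)\<close> have this form: \<open>S = rest_idx r i j\<close>, and \<open>p\<close> is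
  \<open>i\<close> or \<open>j\<close>.\<close>

definition velocity_term ::
  "nat \<Rightarrow> (nat \<Rightarrow> nat \<Rightarrow> real \<Rightarrow> real) \<Rightarrow> nat set \<Rightarrow> nat \<Rightarrow> real \<Rightarrow> real \<Rightarrow> (nat \<Rightarrow> real) \<Rightarrow> real" where
  "velocity_term m F S p a b d =
     (LBINT x=a..b. \<bar>deriv (taylor m (F p) a) x - (\<Sum>k\<in>S. d k * deriv (taylor m (F k) a) x)\<bar>)"

text \<open>The supremum is taken in \<^typ>\<open>ereal\<close>, so that it is the least upper bound without any
  boundedness side condition.\<close>

definition gen_AV_condition ::
  "nat \<Rightarrow> nat \<Rightarrow> real set \<Rightarrow> (nat \<Rightarrow> nat \<Rightarrow> real \<Rightarrow> real) \<Rightarrow>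
   (nat \<Rightarrow> nat \<Rightarrow> nat \<Rightarrow> real \<Rightarrow> real) \<Rightarrow> bool" where
  "gen_AV_condition m r K F G \<longleftrightarrow>
     (\<forall>A. compact A \<longrightarrow> (\<forall>i j. 1 \<le> j \<and> j < i \<and> i \<le> r \<longrightarrow>
       (\<forall>\<epsilon>>0. \<exists>\<delta>>0. \<forall>a\<in>K. \<forall>b\<in>K. 0 < b - a \<and> b - a < \<delta> \<longrightarrow>
         (SUP (c, c') \<in> (rest_idx r i j \<rightarrow>\<^sub>E A) \<times> (rest_idx r i j \<rightarrow>\<^sub>E A).
            ereal (\<bar>gen_area m r F G i j a b c c'\<bar> /
              ((b - a) ^ (2 * m) + (b - a) ^ m *
                (velocity_term m F (rest_idx r i j) i a b c' +
                 velocity_term m F (rest_idx r i j) j a b c))))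
         \<le> ereal \<epsilon>)))"

end

(* A horizontal curve is determined by its horizontal components f_i, since the vertical ones are
   the areas (1/2) int (f_i f_j' - f_j f_i').  For f_i = T_a F_i + h_i on [a,b], with h_i small, the
   quantities A_ij are, up to small terms, int (h_i T_j' - T_i' h_j).  Reading A as an alternating
   bilinear form on R^r, E_ij is its value A(u, v) at u = e_i - sum c~_k e_k, v = e_j - sum c_k e_k,
   while Delta_i and Delta_j are the lengths of the corresponding combinations of Taylor polynomials.
   Necessity is then an integration by parts, applied to those combinations.

   For sufficiency, extend the jets separately over each gap (a,b) of K and glue.  On a gap, f_i is
   T_a F_i plus an explicit correction in the last half, which matches the jet at b, plus a perturbation
   in the first half, which has to produce the prescribed areas for all pairs at once.  Complete
   pivoting on the matrix of rescaled velocity coefficients of the T_a F_i splits the area form as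
   <l_i, T_j'> - <l_j, T_i'> + s_ij with l and s small: this is where the condition is needed
   for linear combinations, not just for pairs of coordinates.  The first part is
   realised by perturbations with prescribed moments, the second by pairs of perturbations that are
   orthogonal to all polynomials occurring, all of them on disjoint intervals so that they do not
   interact. *)
theory Submission
  imports Defs
begin

section \<open>Families of derivatives and gluing across the gaps of a compact set\<close>

text \<open>The obstacle is uniformity over the gaps. Rescaling a gap of length L to the unit
  interval and dividing by L^m puts factors L^(d+1-m), d < m, on the velocity coefficients, so these
  are unbounded on short gaps, and solving a linear system in them could cost unbounded constants.
  Every constant must therefore depend on r and m alone. Pivoting on the largest coefficient
  achieves this: the elimination multipliers are at most 1 in absolute value, so the vectors that
  are tested stay in a box [-B, B], which is one of the compact sets allowed for c and c~. If
  \<epsilon> is the constant in the Whitney and A/V estimates on a gap, the perturbations have size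
  \<epsilon> + sqrt \<epsilon>. The root appears because the area of a pair of perturbations is
  quadratic in their size. No rate is involved: \<epsilon> tending to 0 with the length of the gap
  is enough to glue in class C^m. The areas are prescribed on the gaps only. That the vertical
  components then also fit on K, which may be a Cantor set of positive measure, comes from condition
  (2) for k = 1 and the Whitney condition for F_ij.\<close>

definition Cm_fam :: "nat \<Rightarrow> (nat \<Rightarrow> real \<Rightarrow> real) \<Rightarrow> bool" where
  "Cm_fam m D \<longleftrightarrow>
     (\<forall>k<m. \<forall>t. (D k has_real_derivative D (Suc k) t) (at t)) \<and> continuous_on UNIV (D m)"

lemma Cm_famD: "Cm_fam m D \<Longrightarrow> k < m \<Longrightarrow> (D k has_real_derivative D (Suc k) t) (at t)"
  by (simp add: Cm_fam_def)

lemma Cm_fam_cont: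
  assumes "Cm_fam m D" "k \<le> m"
  shows "continuous_on S (D k)"
proof (cases "k = m")
  case True
  then show ?thesis using assms by (auto simp: Cm_fam_def intro: continuous_on_subset)
next
  case False
  then have "k < m" using assms by auto
  then have "isCont (D k) t" for t using Cm_famD[OF assms(1)] DERIV_isCont by blast
  then show ?thesis by (simp add: continuous_at_imp_continuous_on)
qed

text \<open>A family is determined by its member of order zero; this is the passage to the iterated
  \<open>deriv\<close> of the theorem.\<close>

lemma Cm_fam_funpow_deriv: "Cm_fam m D \<Longrightarrow> k \<le> m \<Longrightarrow> (deriv ^^ k) (D 0) = D k"
proof (induction k)
  case (Suc k)
  then have "(D k has_real_derivative D (Suc k) t) (at t)" for t by (simp add: Cm_famD)
  then have "deriv (D k) = D (Suc k)" by (auto intro: DERIV_imp_deriv)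
  then show ?case using Suc by simp
qed simp

lemma Cm_fam_C_class: assumes "Cm_fam m D" shows "C_class m (D 0)"
  unfolding C_class_def
proof (intro conjI allI impI)
  fix k t assume k: "k < m"
  then have "(deriv ^^ k) (D 0) = D k" using Cm_fam_funpow_deriv[OF assms] by simp
  then show "(deriv ^^ k) (D 0) differentiable at t"
    using Cm_famD[OF assms k] real_differentiable_def by auto
next
  show "continuous_on UNIV ((deriv ^^ m) (D 0))"
    using Cm_fam_funpow_deriv[OF assms, of m] Cm_fam_cont[OF assms, of m] by simp
qed

lemma C_class_Cm_fam: "C_class m f \<Longrightarrow> Cm_fam m (\<lambda>k. (deriv ^^ k) f)"
  unfolding C_class_def Cm_fam_def by (simp add: DERIV_deriv_iff_real_differentiable)

lemma Cm_fam_add: "Cm_fam m D \<Longrightarrow> Cm_fam m E \<Longrightarrow> Cm_fam m (\<lambda>k x. D k x + E k x)"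
  unfolding Cm_fam_def by (auto intro!: DERIV_add continuous_on_add)

lemma Cm_fam_cmult: "Cm_fam m D \<Longrightarrow> Cm_fam m (\<lambda>k x. c * D k x)"
  unfolding Cm_fam_def by (auto intro!: DERIV_cmult continuous_intros)

lemma Cm_fam_zero: "Cm_fam m (\<lambda>k x. 0)"
  unfolding Cm_fam_def by auto

lemma Cm_fam_sum: "(\<And>s. s \<in> S \<Longrightarrow> Cm_fam m (D s)) \<Longrightarrow> Cm_fam m (\<lambda>k x. \<Sum>s\<in>S. D s k x)"
  by (induction S rule: infinite_finite_induct) (auto intro: Cm_fam_add Cm_fam_zero)

text \<open>When \<open>c\<close> is the length of a gap, the factors \<open>c ^ (m - k)\<close> are
  those of the Whitney remainders, so bounds on the unit interval that are the same for all k become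
  bounds of Whitney type on the gap.\<close>

lemma Cm_fam_rescale:
  assumes "Cm_fam m D" and c: "c \<noteq> 0"
  shows "Cm_fam m (\<lambda>k x. c ^ (m - k) * D k ((x - a) / c))"
  unfolding Cm_fam_def
proof (intro conjI allI impI)
  fix k t assume k: "k < m"
  have 1: "((\<lambda>x. D k ((x - a) / c)) has_real_derivative D (Suc k) ((t - a) / c) * (1 / c)) (at t)"
    by (rule DERIV_chain2[OF Cm_famD[OF assms(1) k]]) (use c in \<open>auto intro!: derivative_eq_intros\<close>)
  have "c ^ (m - k) = c * c ^ (m - Suc k)" using k by (metis Suc_diff_Suc power_Suc)
  then have e: "c ^ (m - k) * (D (Suc k) ((t - a) / c) * (1 / c)) = c ^ (m - Suc k) * D (Suc k) ((t - a) / c)"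
    using c by simp
  show "((\<lambda>x. c ^ (m - k) * D k ((x - a) / c)) has_real_derivative
          c ^ (m - Suc k) * D (Suc k) ((t - a) / c)) (at t)"
    using DERIV_cmult[OF 1, of "c ^ (m - k)"] unfolding e .
next
  have "continuous_on UNIV (\<lambda>x. D m ((x - a) / c))"
    by (rule continuous_on_compose2[OF Cm_fam_cont[OF assms(1) order_refl, of UNIV]])
      (use c in \<open>auto intro!: continuous_intros\<close>)
  then show "continuous_on UNIV (\<lambda>x. c ^ (m - m) * D m ((x - a) / c))" by simp
qed

text \<open>The k-th derivative of the Taylor polynomial at \<open>a\<close>. It is also the sum
  subtracted from \<open>F k b\<close> in \<open>whitney_field\<close>, so that Whitney remainders
  and derivatives of \<open>taylor\<close> become one object.\<close>

definition tay :: "nat \<Rightarrow> (nat \<Rightarrow> real \<Rightarrow> real) \<Rightarrow> real \<Rightarrow> nat \<Rightarrow> real \<Rightarrow> real" where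
  "tay m F a k x = (\<Sum>l\<le>m - k. F (k + l) a / fact l * (x - a) ^ l)"

lemma tay_self [simp]: "tay m F a k a = F k a"
proof -
  have "tay m F a k a = (\<Sum>l\<le>m - k. if l = 0 then F k a else 0)"
    unfolding tay_def by (rule sum.cong) auto
  then show ?thesis by simp
qed

lemma Cm_fam_tay: "Cm_fam m (tay m F a)"
  unfolding Cm_fam_def
proof (intro conjI allI impI)
  fix k t assume k: "k < m"
  then have e: "m - k = Suc (m - Suc k)" by simp
  have 1: "tay m F a k = (\<lambda>x. F k a + (\<Sum>l\<le>m - Suc k. F (k + Suc l) a / fact (Suc l) * (x - a) ^ Suc l))"
    unfolding tay_def e sum.atMost_Suc_shift by simp
  have 2: "((\<lambda>x. F (k + Suc l) a / fact (Suc l) * (x - a) ^ Suc l) has_real_derivative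
        F (Suc k + l) a / fact l * (t - a) ^ l) (at t)" for l
    by (rule derivative_eq_intros refl)+ (simp add: field_simps del: of_nat_Suc)
  show "(tay m F a k has_real_derivative tay m F a (Suc k) t) (at t)"
    unfolding 1 unfolding tay_def
    using DERIV_add[OF DERIV_const DERIV_sum[OF 2], of "F k a"] by simp
next
  show "continuous_on UNIV (tay m F a m)"
    unfolding tay_def by (intro continuous_intros) auto
qed

lemma taylor_tay: "taylor m F a = tay m F a 0"
  by (rule ext) (simp add: taylor_def tay_def)

lemma deriv_taylor: "1 \<le> m \<Longrightarrow> deriv (taylor m F a) = tay m F a 1"
  unfolding taylor_tay using Cm_fam_funpow_deriv[OF Cm_fam_tay, of 1 m F a] by simp

section \<open>Gaps of a closed set and gluing across them\<close>

definition gap :: "real set \<Rightarrow> real \<Rightarrow> real \<Rightarrow> bool" where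
  "gap K a b \<longleftrightarrow> a \<in> K \<and> b \<in> K \<and> a < b \<and> {a<..<b} \<inter> K = {}"

text \<open>The end points are the last point of \<open>K\<close> before \<open>x\<close> and the
  first one after it; both exist by compactness.\<close>

lemma gap_around:
  assumes "closed K" "t \<in> K" "s \<in> K" "t < x" "x < s" "x \<notin> K"
  obtains a b where "gap K a b" "a < x" "x < b" "t \<le> a" "b \<le> s"
proof -
  let ?S = "K \<inter> {t..x}" and ?T = "K \<inter> {x..s}"
  have cS: "compact ?S" and cT: "compact ?T" using assms by (auto intro: closed_Int_compact)
  obtain a where a: "a \<in> ?S" "\<And>y. y \<in> ?S \<Longrightarrow> y \<le> a"
    using compact_attains_sup[OF cS] assms by force
  obtain b where b: "b \<in> ?T" "\<And>y. y \<in> ?T \<Longrightarrow> b \<le> y"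
    using compact_attains_inf[OF cT] assms by force
  have "a \<noteq> x" "b \<noteq> x" using a b assms by auto
  then have ax: "a < x" "x < b" using a b by auto
  have "{a<..<b} \<inter> K = {}"
  proof (rule ccontr)
    assume "{a<..<b} \<inter> K \<noteq> {}"
    then obtain y where y: "a < y" "y < b" "y \<in> K" by auto
    show False
    proof (cases "y \<le> x")
      case True then show False using a(2)[of y] y a(1) by auto
    next
      case False then show False using b(2)[of y] y b(1) by auto
    qed
  qed
  then show ?thesis using that[of a b] ax a b by (auto simp: gap_def)
qed

lemma gapD: "gap K a b \<Longrightarrow> z \<in> K \<Longrightarrow> z \<le> a \<or> b \<le> z"
  unfolding gap_def by (meson disjoint_iff greaterThanLessThan_iff not_le)

lemma gap_unique:
  assumes "gap K a b" "gap K a' b'" "a < x" "x < b" "a' < x" "x < b'"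
  shows "a' = a \<and> b' = b"
proof -
  have "a \<in> K" "b \<in> K" "a' \<in> K" "b' \<in> K" using assms by (auto simp: gap_def)
  then show ?thesis
    using gapD[OF assms(1), of a'] gapD[OF assms(1), of b'] gapD[OF assms(2), of a] gapD[OF assms(2), of b] assms(3-6)
    by linarith
qed

text \<open>The mean value theorem is applied between \<open>x\<close> and the last point \<open>a \<le> x\<close> of \<open>K\<close>, so \<open>t\<close> may be an
  isolated point, an end point of a gap or a limit point of \<open>K\<close>.\<close>

lemma glue_deriv_right:
  fixes f v :: "real \<Rightarrow> real"
  assumes "closed K" "continuous_on UNIV f" "continuous_on UNIV v"
    and off: "\<And>x. x \<notin> K \<Longrightarrow> (f has_real_derivative v x) (at x)"
    and on: "\<And>\<epsilon>. \<epsilon> > 0 \<Longrightarrow> \<exists>\<delta>>0. \<forall>a\<in>K. \<bar>a - t\<bar> < \<delta> \<longrightarrow> \<bar>f a - f t - v t * (a - t)\<bar> \<le> \<epsilon> * \<bar>a - t\<bar>"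
    and t: "t \<in> K" and e: "\<epsilon> > 0"
  shows "\<exists>\<eta>>0. \<forall>x. t < x \<and> x < t + \<eta> \<longrightarrow> \<bar>f x - f t - v t * (x - t)\<bar> \<le> \<epsilon> * \<bar>x - t\<bar>"
proof -
  obtain d1 where d1: "d1 > 0" "\<And>a. a \<in> K \<Longrightarrow> \<bar>a - t\<bar> < d1 \<Longrightarrow> \<bar>f a - f t - v t * (a - t)\<bar> \<le> \<epsilon> * \<bar>a - t\<bar>"
    using on[OF e] by blast
  have "isCont v t" using assms(3) by (simp add: continuous_on_eq_continuous_at)
  then obtain d2 where d2: "d2 > 0" "\<And>y. \<bar>y - t\<bar> < d2 \<Longrightarrow> \<bar>v y - v t\<bar> < \<epsilon>"
    using e unfolding continuous_at_eps_delta dist_real_def by blast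
  show ?thesis
  proof (intro exI[of _ "min d1 d2"] conjI allI impI)
    show "0 < min d1 d2" using d1 d2 by auto
    fix x assume x: "t < x \<and> x < t + min d1 d2"
    have cS: "compact (K \<inter> {t..x})" using assms(1) by (auto intro: closed_Int_compact)
    obtain a where a: "a \<in> K \<inter> {t..x}" "\<And>y. y \<in> K \<inter> {t..x} \<Longrightarrow> y \<le> a"
      using compact_attains_sup[OF cS] t x by force
    have A: "\<bar>f a - f t - v t * (a - t)\<bar> \<le> \<epsilon> * \<bar>a - t\<bar>" using d1(2)[of a] a x by auto
    show "\<bar>f x - f t - v t * (x - t)\<bar> \<le> \<epsilon> * \<bar>x - t\<bar>"
    proof (cases "a = x")
      case True then show ?thesis using A by simp
    next
      case False
      then have ax: "a < x" using a by auto
      have offK: "z \<notin> K" if "a < z" "z < x" for z using a(2)[of z] that a(1) by auto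
      have "\<exists>l z. a < z \<and> z < x \<and> (f has_real_derivative l) (at z) \<and> f x - f a = (x - a) * l"
      proof (rule MVT[OF ax])
        show "continuous_on {a..x} f" using assms(2) continuous_on_subset by blast
      next
        fix z assume "a < z" "z < x"
        then show "f differentiable at z" using off[OF offK] real_differentiable_def by blast
      qed
      then obtain l z where z: "a < z" "z < x" "(f has_real_derivative l) (at z)" "f x - f a = (x - a) * l" by blast
      have l: "l = v z" using DERIV_unique[OF z(3) off[OF offK[OF z(1,2)]]] .
      have "\<bar>v z - v t\<bar> < \<epsilon>" using d2(2)[of z] z a x by auto
      then have B: "\<bar>(x - a) * (v z - v t)\<bar> \<le> (x - a) * \<epsilon>"
        using ax by (simp add: abs_mult)
      have C: "f x - f t - v t * (x - t) = (f a - f t - v t * (a - t)) + (x - a) * (v z - v t)"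
        using z(4) l by (simp add: algebra_simps)
      have D: "\<epsilon> * \<bar>x - t\<bar> = \<epsilon> * \<bar>a - t\<bar> + (x - a) * \<epsilon>" using a ax by (simp add: algebra_simps)
      show ?thesis unfolding C D using A B by linarith
    qed
  qed
qed

text \<open>Increments to the left are reduced to \<open>glue_deriv_right\<close> by reflection: the
  function f(-x) has derivative -v(-x) off the closed set -K.\<close>

lemma glue_deriv:
  fixes f v :: "real \<Rightarrow> real"
  assumes K: "closed K" and cf: "continuous_on UNIV f" and cv: "continuous_on UNIV v"
    and off: "\<And>x. x \<notin> K \<Longrightarrow> (f has_real_derivative v x) (at x)"
    and on: "\<And>\<epsilon> t. t \<in> K \<Longrightarrow> \<epsilon> > 0 \<Longrightarrow> \<exists>\<delta>>0. \<forall>a\<in>K. \<bar>a - t\<bar> < \<delta> \<longrightarrow> \<bar>f a - f t - v t * (a - t)\<bar> \<le> \<epsilon> * \<bar>a - t\<bar>"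
  shows "(f has_real_derivative v t) (at t)"
proof (cases "t \<in> K")
  case t: True
  have R: "\<exists>\<eta>>0. \<forall>x. t < x \<and> x < t + \<eta> \<longrightarrow> \<bar>f x - f t - v t * (x - t)\<bar> \<le> \<epsilon> * \<bar>x - t\<bar>" if "\<epsilon> > 0" for \<epsilon>
    by (rule glue_deriv_right[OF K cf cv off on[OF t] t that])
  have L: "\<exists>\<eta>>0. \<forall>x. - t < x \<and> x < - t + \<eta> \<longrightarrow> \<bar>f (- x) - f (- (- t)) - (- v (- (- t))) * (x - (- t))\<bar> \<le> \<epsilon> * \<bar>x - (- t)\<bar>"
    if e: "\<epsilon> > 0" for \<epsilon>
  proof (rule glue_deriv_right[of "uminus ` K" "\<lambda>x. f (- x)" "\<lambda>x. - v (- x)"])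
    show "closed (uminus ` K)" by (rule closed_negations[OF K])
    show "continuous_on UNIV (\<lambda>x. f (- x))" "continuous_on UNIV (\<lambda>x. - v (- x))"
      by (intro continuous_intros continuous_on_compose2[OF cf] continuous_on_compose2[OF cv]; auto)+
    show "((\<lambda>x. f (- x)) has_real_derivative - v (- x)) (at x)" if "x \<notin> uminus ` K" for x
    proof -
      have "- x \<notin> K" using that by force
      then show ?thesis using off[of "- x"] by (simp add: DERIV_mirror)
    qed
    show "- t \<in> uminus ` K" using t by auto
    show "\<epsilon> > 0" by fact
    fix \<epsilon>' :: real assume "\<epsilon>' > 0"
    then obtain d where d: "d > 0" "\<And>a. a\<in>K \<Longrightarrow> \<bar>a - t\<bar> < d \<Longrightarrow> \<bar>f a - f t - v t * (a - t)\<bar> \<le> \<epsilon>' * \<bar>a - t\<bar>"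
      using on[OF t] by blast
    show "\<exists>\<delta>>0. \<forall>a\<in>uminus ` K. \<bar>a - - t\<bar> < \<delta> \<longrightarrow>
        \<bar>f (- a) - f (- (- t)) - - v (- (- t)) * (a - - t)\<bar> \<le> \<epsilon>' * \<bar>a - - t\<bar>"
    proof (intro exI[of _ d] conjI ballI impI)
      fix a assume a: "a \<in> uminus ` K" "\<bar>a - - t\<bar> < d"
      then obtain c where c: "a = - c" "c \<in> K" by auto
      have "\<bar>c - t\<bar> < d" using a c by auto
      from d(2)[OF c(2) this] have "\<bar>f c - f t - v t * (c - t)\<bar> \<le> \<epsilon>' * \<bar>c - t\<bar>" .
      moreover have "f (- a) - f (- (- t)) - - v (- (- t)) * (a - - t) = f c - f t - v t * (c - t)"
        using c by (simp add: algebra_simps)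
      moreover have "\<bar>a - - t\<bar> = \<bar>c - t\<bar>" using c by auto
      ultimately show "\<bar>f (- a) - f (- (- t)) - - v (- (- t)) * (a - - t)\<bar> \<le> \<epsilon>' * \<bar>a - - t\<bar>" by simp
    qed (use d in auto)
  qed
  have "(f has_derivative (\<lambda>x. v t * x)) (at t)"
    unfolding has_derivative_at_alt
  proof (intro conjI allI impI)
    show "bounded_linear (\<lambda>x. v t * x)" by (rule bounded_linear_mult_right)
    fix e :: real assume e: "0 < e"
    obtain d1 where d1: "d1 > 0" "\<And>x. t < x \<Longrightarrow> x < t + d1 \<Longrightarrow> \<bar>f x - f t - v t * (x - t)\<bar> \<le> e * \<bar>x - t\<bar>"
      using R[OF e] by blast
    obtain d2 where d2: "d2 > 0" "\<And>x. - t < x \<Longrightarrow> x < - t + d2 \<Longrightarrow> \<bar>f (- x) - f (- (- t)) - (- v (- (- t))) * (x - (- t))\<bar> \<le> e * \<bar>x - (- t)\<bar>"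
      using L[OF e] by blast
    show "\<exists>d>0. \<forall>y. norm (y - t) < d \<longrightarrow> norm (f y - f t - v t * (y - t)) \<le> e * norm (y - t)"
    proof (intro exI[of _ "min d1 d2"] conjI allI impI)
      fix y assume y: "norm (y - t) < min d1 d2"
      consider "y = t" | "y > t" | "y < t" by linarith
      then show "norm (f y - f t - v t * (y - t)) \<le> e * norm (y - t)"
      proof cases
        case 2 then show ?thesis using d1(2)[of y] y by auto
      next
        case 3
        have "\<bar>f y - f t + v t * (- y + t)\<bar> \<le> e * \<bar>- y + t\<bar>" using d2(2)[of "- y"] y 3 by auto
        moreover have "f y - f t + v t * (- y + t) = f y - f t - v t * (y - t)" by (simp add: algebra_simps)
        moreover have "\<bar>- y + t\<bar> = \<bar>y - t\<bar>" by simp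
        ultimately show ?thesis by simp
      qed simp
    qed (use d1 d2 in auto)
  qed
  then show ?thesis by (simp add: has_field_derivative_def)
qed (use off in auto)

text \<open>Either \<open>t\<close> is isolated in \<open>K\<close> from the right, and then
  \<open>v\<close> equals one continuous function just after \<open>t\<close>; or points of
  \<open>K\<close> accumulate there, so that the gaps near \<open>t\<close> are short and
  \<open>osc\<close> controls \<open>v\<close> on them.\<close>

lemma gap_cont_right:
  fixes v :: "real \<Rightarrow> real"
  assumes K: "closed K" and t: "t \<in> K"
    and contK: "\<And>\<epsilon>. \<epsilon> > 0 \<Longrightarrow> \<exists>\<delta>>0. \<forall>a\<in>K. \<bar>a - t\<bar> < \<delta> \<longrightarrow> \<bar>v a - v t\<bar> < \<epsilon>"
    and osc: "\<And>\<epsilon>. \<epsilon> > 0 \<Longrightarrow> \<exists>\<delta>>0. \<forall>a b x. gap K a b \<and> b - a < \<delta> \<and> a \<le> x \<and> x \<le> b \<longrightarrow> \<bar>v x - v a\<bar> < \<epsilon> \<and> \<bar>v x - v b\<bar> < \<epsilon>"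
    and iso: "\<And>s. s > t \<Longrightarrow> {t<..<s} \<inter> K = {} \<Longrightarrow> \<exists>c>0. \<exists>h. continuous_on UNIV h \<and> (\<forall>x\<in>{t..t+c}. v x = h x)"
    and e: "\<epsilon> > 0"
  shows "\<exists>\<eta>>0. \<forall>x. t \<le> x \<and> x < t + \<eta> \<longrightarrow> \<bar>v x - v t\<bar> < \<epsilon>"
proof (cases "\<exists>s>t. {t<..<s} \<inter> K = {}")
  case True
  then obtain c h where c: "c > 0" "continuous_on UNIV h" "\<And>x. x\<in>{t..t+c} \<Longrightarrow> v x = h x" using iso by blast
  have "isCont h t" using c(2) by (simp add: continuous_on_eq_continuous_at)
  then obtain d2 where d2: "d2 > 0" "\<And>y. \<bar>y - t\<bar> < d2 \<Longrightarrow> \<bar>h y - h t\<bar> < \<epsilon>"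
    using e unfolding continuous_at_eps_delta dist_real_def by blast
  show ?thesis
    by (intro exI[of _ "min c d2"]) (use c d2 in auto)
next
  case False
  have e2: "\<epsilon> / 2 > 0" using e by simp
  obtain d1 where d1: "d1 > 0" "\<And>a. a \<in> K \<Longrightarrow> \<bar>a - t\<bar> < d1 \<Longrightarrow> \<bar>v a - v t\<bar> < \<epsilon> / 2"
    using contK[OF e2] by blast
  obtain d2 where d2: "d2 > 0" "\<And>a b x. gap K a b \<Longrightarrow> b - a < d2 \<Longrightarrow> a \<le> x \<Longrightarrow> x \<le> b \<Longrightarrow> \<bar>v x - v a\<bar> < \<epsilon> / 2"
    using osc[OF e2] by blast
  have "{t<..<t + min d1 d2} \<inter> K \<noteq> {}" using False d1(1) d2(1) by force
  \<comment> \<open>Every point of [t, s) lies in \<open>K\<close> or in a gap contained in [t, s],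
    which is shorter than \<open>d2\<close>.\<close>
  then obtain s where s: "s \<in> K" "t < s" "s < t + min d1 d2" by auto
  show ?thesis
  proof (intro exI[of _ "s - t"] conjI allI impI)
    fix x assume x: "t \<le> x \<and> x < t + (s - t)"
    show "\<bar>v x - v t\<bar> < \<epsilon>"
    proof (cases "x \<in> K")
      case True
      then have "\<bar>v x - v t\<bar> < \<epsilon> / 2" using x s by (intro d1(2)) auto
      then show ?thesis using e by linarith
    next
      case False
      then have "t < x" using x t by (cases "t = x") auto
      obtain a b where ab: "gap K a b" "a < x" "x < b" "t \<le> a" "b \<le> s"
        using gap_around[OF K t s(1) \<open>t < x\<close> _ False] x by auto
      have "\<bar>v x - v a\<bar> < \<epsilon> / 2" using d2(2)[OF ab(1)] ab s by auto
      moreover have "\<bar>v a - v t\<bar> < \<epsilon> / 2" using d1(2)[of a] ab s by (auto simp: gap_def)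
      ultimately show ?thesis by linarith
    qed
  qed (use s in auto)
qed

lemma gap_uminus: "gap (uminus ` K) a b \<longleftrightarrow> gap K (- b) (- a)"
proof -
  have 1: "x \<in> uminus ` K \<longleftrightarrow> - x \<in> K" for x :: real
  proof
    show "- x \<in> K \<Longrightarrow> x \<in> uminus ` K" by (rule image_eqI[of _ _ "- x"]) simp_all
  qed (erule imageE, simp)
  have "(\<forall>x. x \<in> {a<..<b} \<longrightarrow> - x \<notin> K) \<longleftrightarrow> (\<forall>x. x \<in> {- b<..<- a} \<longrightarrow> x \<notin> K)"
  proof (intro iffI allI impI)
    fix x assume h: "\<forall>x. x \<in> {a<..<b} \<longrightarrow> - x \<notin> K" and x: "x \<in> {- b<..<- a}"
    have "- x \<in> {a<..<b}" using x by auto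
    then show "x \<notin> K" using spec[OF h, of "- x"] by simp
  next
    fix x assume h: "\<forall>x. x \<in> {- b<..<- a} \<longrightarrow> x \<notin> K" and x: "x \<in> {a<..<b}"
    then show "- x \<notin> K" using spec[OF h, of "- x"] by simp
  qed
  then show ?thesis unfolding gap_def disjoint_iff 1 by simp argo
qed

text \<open>The left side follows from the right one by reflection. Since reflection exchanges the
  end points of a gap, \<open>osc\<close> compares \<open>v\<close> with its values at both of
  them.\<close>

lemma gap_cont:
  fixes v :: "real \<Rightarrow> real"
  assumes K: "closed K" and t: "t \<in> K"
    and contK: "\<And>\<epsilon>. \<epsilon> > 0 \<Longrightarrow> \<exists>\<delta>>0. \<forall>a\<in>K. \<bar>a - t\<bar> < \<delta> \<longrightarrow> \<bar>v a - v t\<bar> < \<epsilon>"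
    and osc: "\<And>\<epsilon>. \<epsilon> > 0 \<Longrightarrow> \<exists>\<delta>>0. \<forall>a b x. gap K a b \<and> b - a < \<delta> \<and> a \<le> x \<and> x \<le> b \<longrightarrow> \<bar>v x - v a\<bar> < \<epsilon> \<and> \<bar>v x - v b\<bar> < \<epsilon>"
    and isoR: "\<And>s. s > t \<Longrightarrow> {t<..<s} \<inter> K = {} \<Longrightarrow> \<exists>c>0. \<exists>h. continuous_on UNIV h \<and> (\<forall>x\<in>{t..t+c}. v x = h x)"
    and isoL: "\<And>s. s < t \<Longrightarrow> {s<..<t} \<inter> K = {} \<Longrightarrow> \<exists>c>0. \<exists>h. continuous_on UNIV h \<and> (\<forall>x\<in>{t-c..t}. v x = h x)"
  shows "isCont v t"
  unfolding continuous_at_eps_delta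
proof (intro allI impI)
  fix \<epsilon> :: real assume e: "\<epsilon> > 0"
  have R: "\<exists>\<eta>>0. \<forall>x. t \<le> x \<and> x < t + \<eta> \<longrightarrow> \<bar>v x - v t\<bar> < \<epsilon>"
    by (rule gap_cont_right[OF K t]) (fact contK osc isoR e)+
  obtain d1 where d1: "d1 > 0" "\<And>x. t \<le> x \<Longrightarrow> x < t + d1 \<Longrightarrow> \<bar>v x - v t\<bar> < \<epsilon>"
    using R by blast
  have "\<exists>\<eta>>0. \<forall>x. - t \<le> x \<and> x < - t + \<eta> \<longrightarrow> \<bar>v (- x) - v (- (- t))\<bar> < \<epsilon>"
  proof (rule gap_cont_right[of "uminus ` K" "- t" "\<lambda>x. v (- x)"])
    show "closed (uminus ` K)" by (rule closed_negations[OF K])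
    show "- t \<in> uminus ` K" using t by auto
    show "\<epsilon> > 0" by fact
    show "\<exists>\<delta>>0. \<forall>a\<in>uminus ` K. \<bar>a - - t\<bar> < \<delta> \<longrightarrow> \<bar>v (- a) - v (- (- t))\<bar> < \<epsilon>'" if e': "\<epsilon>' > 0" for \<epsilon>'
    proof -
      obtain d where d: "d > 0" "\<And>a. a \<in> K \<Longrightarrow> \<bar>a - t\<bar> < d \<Longrightarrow> \<bar>v a - v t\<bar> < \<epsilon>'" using contK[OF e'] by blast
      show ?thesis
      proof (intro exI[of _ d] conjI ballI impI)
        fix a assume a: "a \<in> uminus ` K" "\<bar>a - - t\<bar> < d"
        then have "- a \<in> K" "\<bar>- a - t\<bar> < d" by auto
        then show "\<bar>v (- a) - v (- (- t))\<bar> < \<epsilon>'" using d(2)[of "- a"] by simp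
      qed (use d in auto)
    qed
    show "\<exists>\<delta>>0. \<forall>a b x. gap (uminus ` K) a b \<and> b - a < \<delta> \<and> a \<le> x \<and> x \<le> b \<longrightarrow>
        \<bar>v (- x) - v (- a)\<bar> < \<epsilon>' \<and> \<bar>v (- x) - v (- b)\<bar> < \<epsilon>'" if e': "\<epsilon>' > 0" for \<epsilon>'
    proof -
      obtain d where d: "d > 0" "\<And>a b x. gap K a b \<and> b - a < d \<and> a \<le> x \<and> x \<le> b \<longrightarrow> \<bar>v x - v a\<bar> < \<epsilon>' \<and> \<bar>v x - v b\<bar> < \<epsilon>'"
        using osc[OF e'] by blast
      show ?thesis
      proof (intro exI[of _ d] conjI allI impI)
        fix a b x assume "gap (uminus ` K) a b \<and> b - a < d \<and> a \<le> x \<and> x \<le> b"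
        then have "gap K (- b) (- a) \<and> - a - (- b) < d \<and> - b \<le> - x \<and> - x \<le> - a" by (simp add: gap_uminus)
        then show "\<bar>v (- x) - v (- a)\<bar> < \<epsilon>'" "\<bar>v (- x) - v (- b)\<bar> < \<epsilon>'" using d(2)[of "- b" "- a" "- x"] by auto
      qed (use d in auto)
    qed
    fix s :: real assume s: "- t < s" "{- t<..<s} \<inter> uminus ` K = {}"
    have "{- s<..<t} \<inter> K = {}"
    proof (rule ccontr)
      assume "{- s<..<t} \<inter> K \<noteq> {}"
      then obtain y where "- s < y" "y < t" "y \<in> K" by auto
      then have "- y \<in> {- t<..<s} \<inter> uminus ` K" by auto
      then show False using s by auto
    qed
    then obtain c h where c: "c > 0" "continuous_on UNIV h" "\<And>x. x\<in>{t-c..t} \<Longrightarrow> v x = h x"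
      using isoL[of "- s"] s by auto
    have "continuous_on UNIV (\<lambda>x. h (- x))" by (intro continuous_on_compose2[OF c(2)] continuous_intros) auto
    then show "\<exists>c>0. \<exists>h. continuous_on UNIV h \<and> (\<forall>x\<in>{- t..- t + c}. v (- x) = h x)"
      using c by (intro exI[of _ c] conjI exI[of _ "\<lambda>x. h (- x)"]) auto
  qed
  then obtain d2 where d2: "d2 > 0" "\<And>x. - t \<le> x \<Longrightarrow> x < - t + d2 \<Longrightarrow> \<bar>v (- x) - v t\<bar> < \<epsilon>" by auto
  show "\<exists>d>0. \<forall>x'. dist x' t < d \<longrightarrow> dist (v x') (v t) < \<epsilon>"
  proof (intro exI[of _ "min d1 d2"] conjI allI impI)
    fix x assume x: "dist x t < min d1 d2"
    show "dist (v x) (v t) < \<epsilon>"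
      using d1(2)[of x] d2(2)[of "- x"] x by (cases "t \<le> x") (auto simp: dist_real_def)
  qed (use d1 d2 in auto)
qed

text \<open>Any pieces on the gaps that match the jet at both ends and stay close to it on short
  gaps can be glued. \<open>Fc\<close> and \<open>Fd\<close> say that the jet is continuous and
  differentiable order by order along \<open>K\<close>. Continuity of all orders is proved first,
  because \<open>glue_deriv\<close> uses it for a function and its candidate derivative.\<close>

lemma glue_gaps:
  fixes F :: "nat \<Rightarrow> real \<Rightarrow> real"
  assumes K: "compact K" "K \<noteq> {}"
    and Fc: "\<And>k t \<epsilon>. k \<le> m \<Longrightarrow> t \<in> K \<Longrightarrow> \<epsilon> > 0 \<Longrightarrow> \<exists>\<delta>>0. \<forall>a\<in>K. \<bar>a - t\<bar> < \<delta> \<longrightarrow> \<bar>F k a - F k t\<bar> < \<epsilon>"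
    and Fd: "\<And>k t \<epsilon>. k < m \<Longrightarrow> t \<in> K \<Longrightarrow> \<epsilon> > 0 \<Longrightarrow>
      \<exists>\<delta>>0. \<forall>a\<in>K. \<bar>a - t\<bar> < \<delta> \<longrightarrow> \<bar>F k a - F k t - F (Suc k) t * (a - t)\<bar> \<le> \<epsilon> * \<bar>a - t\<bar>"
    and g: "\<And>a b. gap K a b \<Longrightarrow> Cm_fam m (g a b)"
    and ga: "\<And>a b k. gap K a b \<Longrightarrow> k \<le> m \<Longrightarrow> g a b k a = F k a"
    and gb: "\<And>a b k. gap K a b \<Longrightarrow> k \<le> m \<Longrightarrow> g a b k b = F k b"
    and osc: "\<And>\<epsilon>. \<epsilon> > 0 \<Longrightarrow> \<exists>\<delta>>0. \<forall>a b x k. gap K a b \<and> b - a < \<delta> \<and> a \<le> x \<and> x \<le> b \<and> k \<le> m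
      \<longrightarrow> \<bar>g a b k x - F k a\<bar> < \<epsilon>"
  obtains f where "Cm_fam m f" "\<And>k t. t \<in> K \<Longrightarrow> f k t = F k t"
    "\<And>a b k x. gap K a b \<Longrightarrow> a \<le> x \<Longrightarrow> x \<le> b \<Longrightarrow> k \<le> m \<Longrightarrow> f k x = g a b k x"
proof -
  have cl: "closed K" using K compact_imp_closed by blast
  obtain A where A: "A \<in> K" "\<And>y. y \<in> K \<Longrightarrow> A \<le> y" using compact_attains_inf[OF K] by blast
  obtain B where B: "B \<in> K" "\<And>y. y \<in> K \<Longrightarrow> y \<le> B" using compact_attains_sup[OF K] by blast
  \<comment> \<open>Beyond the extreme points \<open>A\<close> and \<open>B\<close> of
    \<open>K\<close> the Taylor polynomials there continue the jet. Between them the gap around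
    \<open>x\<close> is unique by \<open>gap_unique\<close>, so the choice is determined.\<close>
  define f where "f k x = (if x \<in> K then F k x else if x < A then tay m F A k x
     else if B < x then tay m F B k x
     else (let p = (SOME p. gap K (fst p) (snd p) \<and> fst p < x \<and> x < snd p) in g (fst p) (snd p) k x))" for k x
  have fK: "f k t = F k t" if "t \<in> K" for k t using that by (simp add: f_def)
  have fg: "f k x = g a b k x" if ab: "gap K a b" and x: "a \<le> x" "x \<le> b" and k: "k \<le> m" for a b k x
  proof -
    have abK: "a \<in> K" "b \<in> K" using ab by (auto simp: gap_def)
    consider "x = a" | "x = b" | "a < x" "x < b" using x by linarith
    then show ?thesis
    proof cases
      case 1 then show ?thesis using ga[OF ab k] abK fK by simp
    next
      case 2 then show ?thesis using gb[OF ab k] abK fK by simp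
    next
      case 3
      have "x \<notin> K" using gapD[OF ab] 3 by force
      moreover have "\<not> x < A" "\<not> B < x" using A(2)[OF abK(1)] B(2)[OF abK(2)] 3 by auto
      moreover have "(SOME p. gap K (fst p) (snd p) \<and> fst p < x \<and> x < snd p) = (a, b)"
      proof (rule some_equality)
        fix p assume p: "gap K (fst p) (snd p) \<and> fst p < x \<and> x < snd p"
        then show "p = (a, b)" using gap_unique[OF ab, of "fst p" "snd p" x] 3 by (simp add: prod_eq_iff)
      qed (use ab 3 in auto)
      ultimately show ?thesis by (simp add: f_def)
    qed
  qed
  have fA: "f k x = tay m F A k x" if "x \<le> A" for k x
  proof (cases "x = A")
    case False
    then have "x < A" "x \<notin> K" using that A(2) by force+
    then show ?thesis by (simp add: f_def)
  qed (simp add: fK A)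
  have fB: "f k x = tay m F B k x" if "B \<le> x" for k x
  proof (cases "x = B")
    case False
    then have "B < x" "x \<notin> K" "\<not> x < A" using that B(2) A(2)[OF B(1)] by force+
    then show ?thesis by (simp add: f_def)
  qed (simp add: fK B)
  \<comment> \<open>Off \<open>K\<close> the glued family agrees with a single piece near each
    point, which settles continuity and derivatives there.\<close>
  have loc: "\<exists>h e. Cm_fam m h \<and> e > 0 \<and> (\<forall>y. dist y x < e \<longrightarrow> (\<forall>k\<le>m. h k y = f k y))" if x: "x \<notin> K" for x
  proof -
    consider "x < A" | "x > B" | "A < x" "x < B" using A(1) B(1) x by (metis linorder_neqE_linordered_idom)
    then show ?thesis
    proof cases
      case 1 then show ?thesis
        by (intro exI[of _ "tay m F A"] exI[of _ "A - x"] conjI Cm_fam_tay) (auto simp: dist_real_def fA)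
    next
      case 2 then show ?thesis
        by (intro exI[of _ "tay m F B"] exI[of _ "x - B"] conjI Cm_fam_tay) (auto simp: dist_real_def fB)
    next
      case 3
      obtain a b where ab: "gap K a b" "a < x" "x < b" using gap_around[OF cl A(1) B(1) 3 x] by blast
      then show ?thesis
        by (intro exI[of _ "g a b"] exI[of _ "min (x - a) (b - x)"] conjI g) (auto simp: dist_real_def fg)
    qed
  qed
  have cont: "isCont (f k) t" if k: "k \<le> m" for k t
  proof (cases "t \<in> K")
    case False
    obtain h e where h: "Cm_fam m h" "e > 0" "\<And>y k. dist y t < e \<Longrightarrow> k \<le> m \<Longrightarrow> h k y = f k y"
      using loc[OF False] by blast
    have "isCont (h k) t" using Cm_fam_cont[OF h(1) k, of UNIV] by (simp add: continuous_on_eq_continuous_at)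
    from continuous_transform_within[OF this h(2) UNIV_I h(3)[OF _ k]] show ?thesis by simp
  next
    case True
    show ?thesis
    proof (rule gap_cont[OF cl True])
      fix \<epsilon> :: real assume e: "\<epsilon> > 0"
      show "\<exists>\<delta>>0. \<forall>a\<in>K. \<bar>a - t\<bar> < \<delta> \<longrightarrow> \<bar>f k a - f k t\<bar> < \<epsilon>"
        using Fc[OF k True e] True by (simp add: fK)
      obtain d where d: "d > 0" "\<And>a b x k. gap K a b \<Longrightarrow> b - a < d \<Longrightarrow> a \<le> x \<Longrightarrow> x \<le> b \<Longrightarrow> k \<le> m
      \<Longrightarrow> \<bar>g a b k x - F k a\<bar> < \<epsilon> / 2" using osc[of "\<epsilon> / 2"] e by (metis half_gt_zero)
      show "\<exists>\<delta>>0. \<forall>a b x. gap K a b \<and> b - a < \<delta> \<and> a \<le> x \<and> x \<le> b \<longrightarrow>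
                 \<bar>f k x - f k a\<bar> < \<epsilon> \<and> \<bar>f k x - f k b\<bar> < \<epsilon>"
      proof (intro exI[of _ d] conjI allI impI)
        fix a b x assume h: "gap K a b \<and> b - a < d \<and> a \<le> x \<and> x \<le> b"
        then have ab: "gap K a b" "a \<le> b" by auto
        have 1: "\<bar>g a b k x - F k a\<bar> < \<epsilon> / 2" "\<bar>g a b k b - F k a\<bar> < \<epsilon> / 2" using d(2)[OF ab(1) _ _ _ k] h by auto
        show "\<bar>f k x - f k a\<bar> < \<epsilon>" "\<bar>f k x - f k b\<bar> < \<epsilon>"
          using fg[OF ab(1) _ _ k, of x] fg[OF ab(1) _ _ k, of b] fg[OF ab(1) _ _ k, of a] ga[OF ab(1) k] 1 h ab
          by linarith+
      qed (use d in auto)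
    next
      fix s assume s: "s > t" "{t<..<s} \<inter> K = {}"
      show "\<exists>c>0. \<exists>h. continuous_on UNIV h \<and> (\<forall>x\<in>{t..t + c}. f k x = h x)"
      proof (cases "t = B")
        case True
        then show ?thesis
          by (intro exI[of _ 1] conjI exI[of _ "tay m F B k"] Cm_fam_cont[OF Cm_fam_tay k]) (auto simp: fB)
      next
        case False
        then have "t < B" using B(2)[OF True] by auto
        then have sB: "s \<le> B" using s(2) B(1) by force
        obtain c where c: "t < c" "c < s" using dense s(1) by blast
        then have cK: "c \<notin> K" "c < B" using s(2) sB by auto
        obtain a b where ab: "gap K a b" "a < c" "c < b" "t \<le> a"
          using gap_around[OF cl True B(1) c(1) cK(2,1)] by blast
        have "a \<in> K" using ab by (auto simp: gap_def)
        then have "a \<notin> {t<..<s}" using s(2) by blast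
        then have "a = t" using ab(2,4) c by auto
        then show ?thesis using ab s
          by (intro exI[of _ "b - t"] conjI exI[of _ "g a b k"] Cm_fam_cont[OF g k]) (auto simp: fg k)
      qed
    next
      fix s assume s: "s < t" "{s<..<t} \<inter> K = {}"
      show "\<exists>c>0. \<exists>h. continuous_on UNIV h \<and> (\<forall>x\<in>{t - c..t}. f k x = h x)"
      proof (cases "t = A")
        case True
        then show ?thesis
          by (intro exI[of _ 1] conjI exI[of _ "tay m F A k"] Cm_fam_cont[OF Cm_fam_tay k]) (auto simp: fA)
      next
        case False
        then have "A < t" using A(2)[OF True] by auto
        then have sA: "A \<le> s" using s(2) A(1) by force
        obtain c where c: "s < c" "c < t" using dense s(1) by blast
        then have cK: "c \<notin> K" "A < c" using s(2) sA by auto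
        obtain a b where ab: "gap K a b" "a < c" "c < b" "b \<le> t"
          using gap_around[OF cl A(1) True cK(2) c(2) cK(1)] by blast
        have "b \<in> K" using ab by (auto simp: gap_def)
        then have "b \<notin> {s<..<t}" using s(2) by blast
        then have "b = t" using ab(3,4) c by auto
        then show ?thesis using ab s
          by (intro exI[of _ "t - a"] conjI exI[of _ "g a b k"] Cm_fam_cont[OF g k]) (auto simp: fg k)
      qed
    qed
  qed
  then have contU: "continuous_on UNIV (f k)" if "k \<le> m" for k
    using that by (simp add: continuous_on_eq_continuous_at)
  have "Cm_fam m f"
    unfolding Cm_fam_def
  proof (intro conjI allI impI)
    fix k t assume k: "k < m"
    show "(f k has_real_derivative f (Suc k) t) (at t)"
    proof (rule glue_deriv[OF cl contU contU])
      show "k \<le> m" "Suc k \<le> m" using k by auto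
      fix x assume x: "x \<notin> K"
      obtain h e where h: "Cm_fam m h" "e > 0" "\<And>y k. dist y x < e \<Longrightarrow> k \<le> m \<Longrightarrow> h k y = f k y"
        using loc[OF x] by blast
      have "h (Suc k) x = f (Suc k) x" using h(2) h(3)[of x "Suc k"] k by simp
      then have "(h k has_real_derivative f (Suc k) x) (at x)" using Cm_famD[OF h(1) k, of x] by simp
      from has_field_derivative_transform_within[OF this h(2) UNIV_I h(3)[of _ k]] k
      show "(f k has_real_derivative f (Suc k) x) (at x)" by simp
    next
      fix \<epsilon> t :: real assume t: "t \<in> K" "\<epsilon> > 0"
      show "\<exists>\<delta>>0. \<forall>a\<in>K. \<bar>a - t\<bar> < \<delta> \<longrightarrow> \<bar>f k a - f k t - f (Suc k) t * (a - t)\<bar> \<le> \<epsilon> * \<bar>a - t\<bar>"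
        using Fd[OF k t] t by (simp add: fK)
    qed
  qed (use contU in auto)
  then show ?thesis using that fK fg by blast
qed

text \<open>Extending \<open>N\<close> by constants over the gaps gives, by \<open>glue_gaps\<close>
  for the jet (N, 0) of order 1, a C^1 function whose derivative vanishes between points of
  \<open>K\<close>. Equality across the gaps alone would not suffice: the Cantor function has it on
  the Cantor set.\<close>

lemma constant_across_gaps:
  fixes N :: "real \<Rightarrow> real"
  assumes K: "compact K"
    and Nd: "\<And>t \<epsilon>. t \<in> K \<Longrightarrow> \<epsilon> > 0 \<Longrightarrow> \<exists>\<delta>>0. \<forall>a\<in>K. \<bar>a - t\<bar> < \<delta> \<longrightarrow> \<bar>N a - N t\<bar> \<le> \<epsilon> * \<bar>a - t\<bar>"
    and gaps: "\<And>a b. gap K a b \<Longrightarrow> N b = N a"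
    and s: "s \<in> K" and t: "t \<in> K"
  shows "N s = N t"
proof -
  have cl: "closed K" using K compact_imp_closed by blast
  define F where "F = (\<lambda>k x. if k = (0::nat) then N x else 0)"
  define g where "g = (\<lambda>a b::real. \<lambda>k x::real. if k = (0::nat) then N a else 0)"
  obtain f where f: "Cm_fam 1 f" "\<And>k t. t \<in> K \<Longrightarrow> f k t = F k t"
    "\<And>a b k x. gap K a b \<Longrightarrow> a \<le> x \<Longrightarrow> x \<le> b \<Longrightarrow> k \<le> 1 \<Longrightarrow> f k x = g a b k x"
  proof (rule glue_gaps[of K 1 F g])
    fix k :: nat and t \<epsilon> :: real assume h: "k \<le> 1" "t \<in> K" "\<epsilon> > 0"
    obtain d where d: "d > 0" "\<And>a. a \<in> K \<Longrightarrow> \<bar>a - t\<bar> < d \<Longrightarrow> \<bar>N a - N t\<bar> \<le> 1 * \<bar>a - t\<bar>"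
      using Nd[OF h(2), of 1] by auto
    show "\<exists>\<delta>>0. \<forall>a\<in>K. \<bar>a - t\<bar> < \<delta> \<longrightarrow> \<bar>F k a - F k t\<bar> < \<epsilon>"
    proof (intro exI[of _ "min d \<epsilon>"] conjI ballI impI)
      fix a assume "a \<in> K" "\<bar>a - t\<bar> < min d \<epsilon>"
      then show "\<bar>F k a - F k t\<bar> < \<epsilon>" using d(2)[of a] h by (auto simp: F_def)
    qed (use d h in auto)
  next
    show "\<exists>\<delta>>0. \<forall>a\<in>K. \<bar>a - t\<bar> < \<delta> \<longrightarrow> \<bar>F k a - F k t - F (Suc k) t * (a - t)\<bar> \<le> \<epsilon> * \<bar>a - t\<bar>"
      if "k < 1" "t \<in> K" "\<epsilon> > 0" for k :: nat and t \<epsilon>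
      using Nd[OF that(2,3)] that by (simp add: F_def)
    show "\<exists>\<delta>>0. \<forall>a b x k. gap K a b \<and> b - a < \<delta> \<and> a \<le> x \<and> x \<le> b \<and> k \<le> 1 \<longrightarrow> \<bar>g a b k x - F k a\<bar> < \<epsilon>"
      if "\<epsilon> > 0" for \<epsilon> :: real
      using that by (intro exI[of _ 1]) (auto simp: g_def F_def)
  qed (use K s gaps in \<open>auto simp: Cm_fam_def g_def F_def\<close>)
  have wl: "N x = N y" if xy: "x \<in> K" "y \<in> K" "x < y" for x y
  proof -
    have z: "f 1 z = 0" if "x \<le> z" "z \<le> y" for z
    proof (cases "z \<in> K")
      case True then show ?thesis using f(2) by (simp add: F_def)
    next
      case False
      then have "x < z" "z < y" using that xy by (metis order_le_less)+
      then obtain a b where ab: "gap K a b" "a < z" "z < b" using gap_around[OF cl xy(1,2) _ _ False] by blast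
      then show ?thesis using f(3)[of a b z 1] by (simp add: g_def)
    qed
    have "f 0 y = f 0 x"
    proof (rule DERIV_isconst2[of x y "f 0" y])
      show "continuous_on {x..y} (f 0)" by (rule Cm_fam_cont[OF f(1)]) simp
      show "(f 0 has_real_derivative 0) (at z)" if "x < z" "z < y" for z
        using Cm_famD[OF f(1), of 0 z] z[of z] that by simp
    qed (use xy in auto)
    then show ?thesis using f(2) xy by (simp add: F_def)
  qed
  show ?thesis using wl[of s t] wl[of t s] s t by (metis linorder_neqE_linordered_idom)
qed

section \<open>Splitting an alternating form by complete pivoting\<close>

text \<open>The A/V bound on a gap rescaled to unit length. \<rho> is the area form,
  \<open>\<kappa> p d\<close> the coefficient of degree d in the rescaled velocity of the p-th
  Taylor polynomial; the two sums over d stand in for \<Delta>_i and \<Delta>_j, and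
  \<open>B\<close> for the compact set of coefficients.\<close>

definition tame :: "nat \<Rightarrow> real \<Rightarrow> nat set \<Rightarrow> (nat \<Rightarrow> nat \<Rightarrow> real) \<Rightarrow> (nat \<Rightarrow> nat \<Rightarrow> real) \<Rightarrow> real \<Rightarrow> bool" where
  "tame m B I \<kappa> \<rho> \<epsilon> \<longleftrightarrow> (\<forall>i\<in>I. \<forall>j\<in>I. i \<noteq> j \<longrightarrow> (\<forall>u v. u i = 1 \<and> u j = 0 \<and> v i = 0 \<and> v j = 1 \<and>
     (\<forall>k\<in>I. \<bar>u k\<bar> \<le> B \<and> \<bar>v k\<bar> \<le> B) \<longrightarrow>
     \<bar>\<Sum>p\<in>I. \<Sum>q\<in>I. u p * v q * \<rho> p q\<bar> \<le>
       \<epsilon> * (1 + (\<Sum>d<m. \<bar>\<Sum>p\<in>I. u p * \<kappa> p d\<bar>) + (\<Sum>d<m. \<bar>\<Sum>p\<in>I. v p * \<kappa> p d\<bar>))))"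

lemma tameD:
  assumes "tame m B I \<kappa> \<rho> \<epsilon>" "i \<in> I" "j \<in> I" "i \<noteq> j" "u i = 1" "u j = 0" "v i = 0" "v j = 1"
    "\<And>k. k \<in> I \<Longrightarrow> \<bar>u k\<bar> \<le> B" "\<And>k. k \<in> I \<Longrightarrow> \<bar>v k\<bar> \<le> B"
  shows "\<bar>\<Sum>p\<in>I. \<Sum>q\<in>I. u p * v q * \<rho> p q\<bar> \<le>
       \<epsilon> * (1 + (\<Sum>d<m. \<bar>\<Sum>p\<in>I. u p * \<kappa> p d\<bar>) + (\<Sum>d<m. \<bar>\<Sum>p\<in>I. v p * \<kappa> p d\<bar>))"
  using assms unfolding tame_def by blast

text \<open>The case of two unit vectors, that is, of c and c~ equal to zero.\<close>

lemma tame_unit: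
  assumes "tame m B I \<kappa> \<rho> \<epsilon>" "finite I" "1 \<le> B" "i \<in> I" "j \<in> I" "i \<noteq> j"
  shows "\<bar>\<rho> i j\<bar> \<le> \<epsilon> * (1 + (\<Sum>d<m. \<bar>\<kappa> i d\<bar>) + (\<Sum>d<m. \<bar>\<kappa> j d\<bar>))"
proof -
  define u where "u = (\<lambda>p. if p = i then 1 else 0 :: real)"
  define v where "v = (\<lambda>p. if p = j then 1 else 0 :: real)"
  have 1: "(\<Sum>p\<in>I. u p * \<kappa> p d) = \<kappa> i d" "(\<Sum>p\<in>I. v p * \<kappa> p d) = \<kappa> j d" for d
    using assms by (simp_all add: u_def v_def if_distrib[where f = "\<lambda>x. x * _"] cong: if_cong)
  have "(\<Sum>q\<in>I. u p * v q * \<rho> p q) = u p * \<rho> p j" for p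
    using assms by (simp add: v_def if_distrib[where f = "\<lambda>x. _ * x"] if_distrib[where f = "\<lambda>x. x * _"] cong: if_cong)
  then have 2: "(\<Sum>p\<in>I. \<Sum>q\<in>I. u p * v q * \<rho> p q) = \<rho> i j"
    using assms by (simp add: u_def if_distrib[where f = "\<lambda>x. x * _"] cong: if_cong)
  have 3: "u i = 1" "u j = 0" "v i = 0" "v j = 1" using assms(6) by (auto simp: u_def v_def)
  have 4: "\<bar>u k\<bar> \<le> B" "\<bar>v k\<bar> \<le> B" for k using assms(3) by (auto simp: u_def v_def)
  have 5: "\<bar>\<Sum>p\<in>I. \<Sum>q\<in>I. u p * v q * \<rho> p q\<bar> \<le>
       \<epsilon> * (1 + (\<Sum>d<m. \<bar>\<Sum>p\<in>I. u p * \<kappa> p d\<bar>) + (\<Sum>d<m. \<bar>\<Sum>p\<in>I. v p * \<kappa> p d\<bar>))"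
    by (rule tameD[where u = u and v = v and i = i and j = j]) (fact assms 3 | rule 4)+
  show ?thesis using 5 by (simp only: 1 2)
qed

text \<open>The row \<open>i0\<close> of the largest entry \<open>\<kappa> i0 d0\<close> is eliminated; the elimination coefficients are at most
  \<open>1\<close>, which keeps the coefficients in \<^const>\<open>tame\<close> bounded. Column \<open>d0\<close> of the remaining rows
  vanishes, so \<open>l k d0\<close> is free and is used to match \<open>\<rho> i0 k\<close>.\<close>

lemma pivot:
  "\<exists>B C. 1 \<le> B \<and> 0 \<le> C \<and> (\<forall>(I::nat set) \<kappa> \<rho> \<epsilon>. finite I \<and> card I = n \<and> 0 \<le> \<epsilon> \<and>
     (\<forall>i\<in>I. \<forall>j\<in>I. \<rho> i j + \<rho> j i = 0) \<and> tame m B I \<kappa> \<rho> \<epsilon> \<longrightarrow>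
     (\<exists>l s. (\<forall>i\<in>I. \<forall>d<m. \<bar>l i d\<bar> \<le> C * \<epsilon>) \<and> (\<forall>i\<in>I. \<forall>j\<in>I. \<bar>s i j\<bar> \<le> C * \<epsilon>) \<and>
        (\<forall>i\<in>I. \<forall>j\<in>I. \<rho> i j = (\<Sum>d<m. l i d * \<kappa> j d) - (\<Sum>d<m. l j d * \<kappa> i d) + s i j)))"
proof (induction n)
  case 0
  show ?case by (rule exI[of _ 1], rule exI[of _ 0]) auto
next
  case (Suc n)
  obtain B C where BC: "1 \<le> B" "0 \<le> C" and
    IH: "\<And>(I::nat set) \<kappa> \<rho> \<epsilon>. \<lbrakk>finite I; card I = n; 0 \<le> \<epsilon>; \<And>i j. i \<in> I \<Longrightarrow> j \<in> I \<Longrightarrow> \<rho> i j + \<rho> j i = 0; tame m B I \<kappa> \<rho> \<epsilon>\<rbrakk> \<Longrightarrow>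
     (\<exists>l s. (\<forall>i\<in>I. \<forall>d<m. \<bar>l i d\<bar> \<le> C * \<epsilon>) \<and> (\<forall>i\<in>I. \<forall>j\<in>I. \<bar>s i j\<bar> \<le> C * \<epsilon>) \<and>
        (\<forall>i\<in>I. \<forall>j\<in>I. \<rho> i j = (\<Sum>d<m. l i d * \<kappa> j d) - (\<Sum>d<m. l j d * \<kappa> i d) + s i j))"
  proof -
    from Suc show ?thesis by (elim exE conjE) (rule that, assumption+, blast)
  qed
  \<comment> \<open>Undoing the elimination creates an entry of size up to n B at the pivot index,
    see \<open>extB\<close>. In \<open>C'\<close> the first three summands bound the new entry of l
    in the pivot column, the last one the entries kept from the induction.\<close>
  define B' where "B' = 1 + real (Suc n) * B"
  define C' where "C' = 1 + 2 * real m + real m * C + C"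
  have "real n * B \<ge> 0" using BC by simp
  then have B': "1 \<le> B'" "B \<le> B'" "real n * B \<le> B'" using BC unfolding B'_def of_nat_Suc distrib_right by linarith+
  have "real m * C \<ge> 0" using BC by simp
  then have C': "0 \<le> C'" "C \<le> C'" "1 + 2 * real m \<le> C'" "1 + 2 * real m + real m * C \<le> C'"
    using BC unfolding C'_def by linarith+
  show ?case
  proof (rule exI[of _ B'], rule exI[of _ C'], intro conjI allI impI)
    fix I :: "nat set" and \<kappa> \<rho> :: "nat \<Rightarrow> nat \<Rightarrow> real" and \<epsilon> :: real
    assume h: "finite I \<and> card I = Suc n \<and> 0 \<le> \<epsilon> \<and> (\<forall>i\<in>I. \<forall>j\<in>I. \<rho> i j + \<rho> j i = 0) \<and> tame m B' I \<kappa> \<rho> \<epsilon>"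
    then have fI: "finite I" and cI: "card I = Suc n" and e: "0 \<le> \<epsilon>" and alt1: "\<And>i j. i \<in> I \<Longrightarrow> j \<in> I \<Longrightarrow> \<rho> i j + \<rho> j i = 0"
      and T: "tame m B' I \<kappa> \<rho> \<epsilon>" by auto
    have alt: "\<rho> i j = - \<rho> j i" if "i \<in> I" "j \<in> I" for i j using alt1[OF that] by linarith
    have alt0: "\<rho> i i = 0" if "i \<in> I" for i using alt[OF that that] by simp
    note unit = tame_unit[OF T fI B'(1)]
    show "\<exists>l s. (\<forall>i\<in>I. \<forall>d<m. \<bar>l i d\<bar> \<le> C' * \<epsilon>) \<and> (\<forall>i\<in>I. \<forall>j\<in>I. \<bar>s i j\<bar> \<le> C' * \<epsilon>) \<and>
        (\<forall>i\<in>I. \<forall>j\<in>I. \<rho> i j = (\<Sum>d<m. l i d * \<kappa> j d) - (\<Sum>d<m. l j d * \<kappa> i d) + s i j)"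
    proof (cases "\<forall>i\<in>I. \<forall>d<m. \<bar>\<kappa> i d\<bar> \<le> 1")
      \<comment> \<open>All coefficients are at most 1, so \<open>unit\<close> makes \<rho> itself
        of size \<epsilon>, and it goes into s as a whole.\<close>
      case True
      have "\<bar>\<rho> i j\<bar> \<le> C' * \<epsilon>" if ij: "i \<in> I" "j \<in> I" for i j
      proof (cases "i = j")
        case False
        have "(\<Sum>d<m. \<bar>\<kappa> i d\<bar>) \<le> real m" "(\<Sum>d<m. \<bar>\<kappa> j d\<bar>) \<le> real m"
          using sum_bounded_above[of "{..<m}" "\<lambda>d. \<bar>\<kappa> i d\<bar>" 1] sum_bounded_above[of "{..<m}" "\<lambda>d. \<bar>\<kappa> j d\<bar>" 1] True ij
          by auto
        then have "\<epsilon> * (1 + (\<Sum>d<m. \<bar>\<kappa> i d\<bar>) + (\<Sum>d<m. \<bar>\<kappa> j d\<bar>)) \<le> \<epsilon> * C'"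
          using C' e by (intro mult_left_mono) auto
        then show ?thesis using unit[OF ij False] by (simp add: mult.commute)
      qed (use alt0 ij C' e in simp)
      then show ?thesis using C' e by - (rule exI[of _ "\<lambda>_ _. 0"], rule exI[of _ \<rho>], auto)
    next
      case False
      then obtain i1 d1 where id1: "i1 \<in> I" "d1 < m" "\<bar>\<kappa> i1 d1\<bar> > 1" by force
      define S where "S = (\<lambda>(i, d). \<bar>\<kappa> i d\<bar>) ` (I \<times> {..<m})"
      have fS: "finite S" "S \<noteq> {}" using fI id1 by (auto simp: S_def)
      obtain i0 d0 where id0: "i0 \<in> I" "d0 < m" "\<bar>\<kappa> i0 d0\<bar> = Max S"
        using Max_in[OF fS] by (auto simp: S_def)
      have mx: "\<bar>\<kappa> i d\<bar> \<le> \<bar>\<kappa> i0 d0\<bar>" if "i \<in> I" "d < m" for i d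
        unfolding id0(3) using that by (intro Max_ge fS) (auto simp: S_def)
      have big: "\<bar>\<kappa> i0 d0\<bar> > 1" using mx[OF id1(1,2)] id1(3) by simp
      then have nz: "\<kappa> i0 d0 \<noteq> 0" by auto
      define J where "J = I - {i0}"
      have J: "finite J" "card J = n" "I = insert i0 J" "i0 \<notin> J" "J \<subseteq> I"
        using fI cI id0 by (auto simp: J_def)
      define c where "c k = \<kappa> k d0 / \<kappa> i0 d0" for k
      have c1: "\<bar>c k\<bar> \<le> 1" if "k \<in> I" for k
        using mx[OF that id0(2)] big by (simp add: c_def abs_divide divide_le_eq_1)
      \<comment> \<open>These are \<kappa> and \<rho> in the vectors e_k - c_k e_i0. The term c_k
        c_q \<rho>(i0, i0) of the expansion vanishes because \<rho> is alternating.\<close>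
      define \<kappa>' where "\<kappa>' k d = \<kappa> k d - c k * \<kappa> i0 d" for k d
      define \<rho>' where "\<rho>' k q = \<rho> k q - c k * \<rho> i0 q - c q * \<rho> k i0" for k q
      have k0: "\<kappa>' k d0 = 0" for k using nz by (simp add: \<kappa>'_def c_def)
      have T': "tame m B J \<kappa>' \<rho>' \<epsilon>"
        unfolding tame_def
      proof (intro ballI impI allI)
        fix i j u v
        assume ij: "i \<in> J" "j \<in> J" "i \<noteq> j"
          and uv: "u i = 1 \<and> u j = 0 \<and> v i = 0 \<and> v j = 1 \<and> (\<forall>k\<in>J. \<bar>u k\<bar> \<le> B \<and> \<bar>v k\<bar> \<le> B)"
        \<comment> \<open>\<open>ext w\<close> is the combination of the vectors e_p - c_p e_i0 with
          weights w_p, so \<kappa> and \<rho> on it are \<kappa>' and \<rho>' on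
          \<open>w\<close>.\<close>
        define ext where "ext w p = (if p = i0 then - (\<Sum>p\<in>J. w p * c p) else w p)" for w p
        have ext0: "ext w i0 = - (\<Sum>p\<in>J. w p * c p)" for w by (simp add: ext_def)
        have extJ: "ext w p = w p" if "p \<in> J" for w p using that J(4) by (auto simp: ext_def)
        have extB: "\<bar>ext w k\<bar> \<le> B'" if w: "\<forall>k\<in>J. \<bar>w k\<bar> \<le> B" and k: "k \<in> I" for w k
        proof (cases "k = i0")
          case True
          have "\<bar>\<Sum>p\<in>J. w p * c p\<bar> \<le> (\<Sum>p\<in>J. \<bar>w p * c p\<bar>)" by (rule sum_abs)
          also have "\<dots> \<le> (\<Sum>p\<in>J. B)"
          proof (rule sum_mono)
            fix p assume "p \<in> J"
            then have "\<bar>w p\<bar> * \<bar>c p\<bar> \<le> B * 1" using w c1 J(5) BC by (intro mult_mono) auto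
            then show "\<bar>w p * c p\<bar> \<le> B" by (simp add: abs_mult)
          qed
          also have "\<dots> = real n * B" using J by simp
          finally show ?thesis using True B' by (simp add: ext0)
        next
          case False
          then have "k \<in> J" using k J(3) by auto
          then show ?thesis using extJ[of k w] w B' by force
        qed
        have lin: "(\<Sum>p\<in>I. ext w p * \<kappa> p d) = (\<Sum>p\<in>J. w p * \<kappa>' p d)" for w d
        proof -
          have "(\<Sum>p\<in>I. ext w p * \<kappa> p d) = ext w i0 * \<kappa> i0 d + (\<Sum>p\<in>J. ext w p * \<kappa> p d)"
            using J by simp
          also have "(\<Sum>p\<in>J. ext w p * \<kappa> p d) = (\<Sum>p\<in>J. w p * \<kappa> p d)" by (intro sum.cong) (auto simp: extJ)
          finally show ?thesis unfolding ext0 \<kappa>'_def right_diff_distrib sum_subtractf sum_distrib_right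
            by (simp add: sum_distrib_right mult.assoc)
        qed
        have bil: "(\<Sum>p\<in>I. \<Sum>q\<in>I. ext u p * ext v q * \<rho> p q) = (\<Sum>p\<in>J. \<Sum>q\<in>J. u p * v q * \<rho>' p q)"
        proof -
          have in1: "(\<Sum>q\<in>I. ext v q * \<rho> p q) = (\<Sum>q\<in>J. v q * (\<rho> p q - c q * \<rho> p i0))" for p
          proof -
            have "(\<Sum>q\<in>I. ext v q * \<rho> p q) = ext v i0 * \<rho> p i0 + (\<Sum>q\<in>J. ext v q * \<rho> p q)"
              using J by simp
            also have "(\<Sum>q\<in>J. ext v q * \<rho> p q) = (\<Sum>q\<in>J. v q * \<rho> p q)" by (intro sum.cong) (auto simp: extJ)
            finally show ?thesis unfolding ext0 right_diff_distrib sum_subtractf sum_distrib_right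
              by (simp add: sum_distrib_right mult.assoc)
          qed
          define R where "R p = (\<Sum>q\<in>J. v q * (\<rho> p q - c q * \<rho> p i0))" for p
          have "(\<Sum>p\<in>I. \<Sum>q\<in>I. ext u p * ext v q * \<rho> p q) = (\<Sum>p\<in>I. ext u p * R p)"
            unfolding R_def in1[symmetric] by (simp add: sum_distrib_left mult.assoc)
          also have "\<dots> = ext u i0 * R i0 + (\<Sum>p\<in>J. ext u p * R p)" using J by simp
          also have "(\<Sum>p\<in>J. ext u p * R p) = (\<Sum>p\<in>J. u p * R p)" by (intro sum.cong) (auto simp: extJ)
          also have "ext u i0 * R i0 + (\<Sum>p\<in>J. u p * R p) = (\<Sum>p\<in>J. u p * (R p - c p * R i0))"
            unfolding ext0 right_diff_distrib sum_subtractf by (simp add: sum_distrib_right mult.assoc)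
          also have "\<dots> = (\<Sum>p\<in>J. \<Sum>q\<in>J. u p * v q * \<rho>' p q)"
          proof (rule sum.cong[OF refl])
            fix p assume "p \<in> J"
            have "R p - c p * R i0 = (\<Sum>q\<in>J. v q * \<rho>' p q)"
              unfolding R_def \<rho>'_def sum_distrib_left sum_subtractf[symmetric]
              by (rule sum.cong) (simp_all add: alt0[OF id0(1)] algebra_simps)
            then show "u p * (R p - c p * R i0) = (\<Sum>q\<in>J. u p * v q * \<rho>' p q)"
              by (simp add: sum_distrib_left mult.assoc)
          qed
          finally show ?thesis .
        qed
        have "ext u i = 1" "ext u j = 0" "ext v i = 0" "ext v j = 1" using uv ij extJ by auto
        from tameD[where u = "ext u" and v = "ext v", OF T _ _ ij(3) this extB extB] uv ij J(5)
        show "\<bar>\<Sum>p\<in>J. \<Sum>q\<in>J. u p * v q * \<rho>' p q\<bar>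
            \<le> \<epsilon> * (1 + (\<Sum>d<m. \<bar>\<Sum>p\<in>J. u p * \<kappa>' p d\<bar>) + (\<Sum>d<m. \<bar>\<Sum>p\<in>J. v p * \<kappa>' p d\<bar>))"
          unfolding lin bil by blast
      qed
      have alt': "\<rho>' i j + \<rho>' j i = 0" if "i \<in> J" "j \<in> J" for i j
        using alt[of i j] alt[of i i0] alt[of i0 j] that J(5) id0 by (auto simp: \<rho>'_def algebra_simps subset_iff)
      obtain l' s' where l': "\<And>i d. i \<in> J \<Longrightarrow> d < m \<Longrightarrow> \<bar>l' i d\<bar> \<le> C * \<epsilon>"
        and s': "\<And>i j. i \<in> J \<Longrightarrow> j \<in> J \<Longrightarrow> \<bar>s' i j\<bar> \<le> C * \<epsilon>"
        and eq': "\<And>i j. i \<in> J \<Longrightarrow> j \<in> J \<Longrightarrow> \<rho>' i j = (\<Sum>d<m. l' i d * \<kappa>' j d) - (\<Sum>d<m. l' j d * \<kappa>' i d) + s' i j"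
        using IH[OF J(1,2) e alt' T'] by blast
      define D where "D = {..<m} - {d0}"
      have D: "finite D" "{..<m} = insert d0 D" "d0 \<notin> D" using id0 by (auto simp: D_def)
      have cardD: "real (card D) \<le> real m" using card_mono[of "{..<m}" D] by (simp add: D_def)
      \<comment> \<open>As row \<open>i0\<close> of \<open>l\<close> is zero, the decomposition at
        (i0, k) reduces to \<open>A1\<close>, one linear equation for the entry in column
        \<open>d0\<close>.\<close>
      define l where "l k d = (if k = i0 then 0 else if d = d0 then
          (- \<rho> i0 k - (\<Sum>d\<in>D. l' k d * \<kappa> i0 d)) / \<kappa> i0 d0 else l' k d)" for k d
      define s where "s k q = (if k = i0 \<or> q = i0 then 0 else s' k q)" for k q
      have l0: "l i0 d = 0" for d by (simp add: l_def)
      have ne: "k \<noteq> i0" if "k \<in> J" for k using that J by auto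
      have lD: "(\<Sum>d\<in>D. l k d * x d) = (\<Sum>d\<in>D. l' k d * x d)" if "k \<in> J" for k x
        using D ne[OF that] by (intro sum.cong) (auto simp: l_def)
      have A1: "(\<Sum>d<m. l k d * \<kappa> i0 d) = - \<rho> i0 k" if "k \<in> J" for k
        unfolding D(2) sum.insert[OF D(1,3)] lD[OF that] using ne[OF that] nz by (simp add: l_def)
      have A2: "(\<Sum>d<m. l k d * \<kappa>' q d) = (\<Sum>d<m. l' k d * \<kappa>' q d)" if "k \<in> J" for k q
        unfolding D(2) sum.insert[OF D(1,3)] lD[OF that] by (simp add: k0)
      have A3: "(\<Sum>d<m. l k d * \<kappa> q d) = (\<Sum>d<m. l' k d * \<kappa>' q d) - c q * \<rho> i0 k" if "k \<in> J" for k q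
      proof -
        have "(\<Sum>d<m. l k d * \<kappa> q d) = (\<Sum>d<m. l k d * \<kappa>' q d) + c q * (\<Sum>d<m. l k d * \<kappa> i0 d)"
          unfolding \<kappa>'_def sum_distrib_left sum.distrib[symmetric] by (rule sum.cong) (simp_all add: algebra_simps)
        then show ?thesis unfolding A1[OF that] A2[OF that] by simp
      qed
      show ?thesis
      proof (rule exI[of _ l], rule exI[of _ s], intro conjI ballI allI impI)
        fix k d assume kd: "k \<in> I" "d < m"
        show "\<bar>l k d\<bar> \<le> C' * \<epsilon>"
        proof (cases "k = i0")
          case True then show ?thesis using C' e by (simp add: l0)
        next
          case kne: False
          then have kJ: "k \<in> J" using kd J by auto
          show ?thesis
          proof (cases "d = d0")
            case False
            then have "\<bar>l k d\<bar> \<le> C * \<epsilon>" using l'[OF kJ kd(2)] kne by (simp add: l_def)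
            also have "\<dots> \<le> C' * \<epsilon>" using C' e by (intro mult_right_mono) auto
            finally show ?thesis .
          next
            case True
            let ?M = "\<bar>\<kappa> i0 d0\<bar>"
            have s1: "(\<Sum>d<m. \<bar>\<kappa> i d\<bar>) \<le> real m * ?M" if "i \<in> I" for i
              using sum_bounded_above[of "{..<m}" "\<lambda>d. \<bar>\<kappa> i d\<bar>" ?M] mx that by auto
            \<comment> \<open>The pivot exceeds 1 and dominates all coefficients. The bound on
              \<open>\<rho> i0 k\<close> is therefore proportional to the pivot and survives the
              division by it.\<close>
            have "\<bar>\<rho> i0 k\<bar> \<le> \<epsilon> * (1 + (\<Sum>d<m. \<bar>\<kappa> i0 d\<bar>) + (\<Sum>d<m. \<bar>\<kappa> k d\<bar>))"
              by (rule unit) (use id0 kd kne in auto)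
            also have "\<dots> \<le> \<epsilon> * (?M + real m * ?M + real m * ?M)"
              using s1[OF id0(1)] s1[OF kd(1)] big e by (intro mult_left_mono add_mono) auto
            finally have r: "\<bar>\<rho> i0 k\<bar> \<le> (1 + 2 * real m) * \<epsilon> * ?M" by (simp add: algebra_simps)
            have "\<bar>\<Sum>d\<in>D. l' k d * \<kappa> i0 d\<bar> \<le> (\<Sum>d\<in>D. \<bar>l' k d * \<kappa> i0 d\<bar>)" by (rule sum_abs)
            also have "\<dots> \<le> (\<Sum>d\<in>D. C * \<epsilon> * ?M)"
              unfolding abs_mult using l'[OF kJ] mx[OF id0(1)] BC e by (intro sum_mono mult_mono) (auto simp: D_def)
            also have "\<dots> \<le> real m * (C * \<epsilon> * ?M)" using cardD BC e by (simp add: mult_right_mono)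
            finally have r2: "\<bar>\<Sum>d\<in>D. l' k d * \<kappa> i0 d\<bar> \<le> real m * C * \<epsilon> * ?M" by (simp add: mult.assoc)
            have "\<bar>- \<rho> i0 k - (\<Sum>d\<in>D. l' k d * \<kappa> i0 d)\<bar> \<le> (1 + 2 * real m + real m * C) * \<epsilon> * ?M"
              using r r2 by (simp add: distrib_right)
            also have "\<dots> \<le> C' * \<epsilon> * ?M" using C' e by (intro mult_right_mono) auto
            finally show ?thesis using True kne big by (simp add: l_def divide_le_eq)
          qed
        qed
      next
        fix k q assume kq: "k \<in> I" "q \<in> I"
        show "\<bar>s k q\<bar> \<le> C' * \<epsilon>"
        proof (cases "k = i0 \<or> q = i0")
          case True
          then have "s k q = 0" by (auto simp: s_def)
          then show ?thesis using C' e by simp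
        next
          case False
          then have "\<bar>s k q\<bar> \<le> C * \<epsilon>" using s'[of k q] kq J(3) by (auto simp: s_def)
          also have "\<dots> \<le> C' * \<epsilon>" by (rule mult_right_mono[OF C'(2) e])
          finally show ?thesis .
        qed
      next
        fix k q assume kq: "k \<in> I" "q \<in> I"
        show "\<rho> k q = (\<Sum>d<m. l k d * \<kappa> q d) - (\<Sum>d<m. l q d * \<kappa> k d) + s k q"
        proof (cases "k = i0")
          case k: True
          show ?thesis
          proof (cases "q = i0")
            case True then show ?thesis using k alt0[OF id0(1)] by (simp add: s_def)
          next
            case False
            then have "q \<in> J" using kq J by auto
            then show ?thesis using k A1[of q] by (simp add: l0 s_def)
          qed
        next
          case False
          then have kJ: "k \<in> J" using kq J by auto
          show ?thesis
          proof (cases "q = i0")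
            case True
            then show ?thesis using A1[OF kJ] alt[OF id0(1) kq(1)] by (simp add: l0 s_def)
          next
            case q: False
            then have qJ: "q \<in> J" using kq J by auto
            have "\<rho>' k q = (\<Sum>d<m. l' k d * \<kappa>' q d) - (\<Sum>d<m. l' q d * \<kappa>' k d) + s k q"
              using eq'[OF kJ qJ] False q by (simp add: s_def)
            then show ?thesis unfolding A3[OF kJ] A3[OF qJ] using alt[OF id0(1) kq(1)]
              by (simp add: \<rho>'_def algebra_simps)
          qed
        qed
      qed
    qed
  qed (use B' C' in auto)
qed

section \<open>Profiles on the unit interval\<close>

text \<open>At a frontier point all orders of \<open>D\<close> vanish, so for k < m the cut function
  is bounded by |D k| = o(|y - t|) there, on whichever side y lies. Elsewhere it is locally
  \<open>D\<close> or locally 0.\<close>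

lemma Cm_fam_cut:
  assumes D: "Cm_fam m D"
    and fr: "\<And>k x. k \<le> m \<Longrightarrow> x \<in> frontier S \<Longrightarrow> D k x = 0"
  shows "Cm_fam m (\<lambda>k x. if x \<in> S then D k x else 0)"
proof -
  have cases: "x \<in> interior S \<or> x \<in> interior (- S) \<or> x \<in> frontier S" for x
    by (auto simp: frontier_def interior_complement)
  have loc1: "\<exists>e>0. \<forall>y. dist y x < e \<longrightarrow> y \<in> S" if "x \<in> interior S" for x
    using that by (metis dist_commute mem_ball mem_interior subsetD)
  have loc2: "\<exists>e>0. \<forall>y. dist y x < e \<longrightarrow> y \<notin> S" if "x \<in> interior (- S)" for x
    using that by (metis ComplD dist_commute mem_ball mem_interior subsetD)
  have fr': "(if x \<in> S then D k x else 0) = 0" if "k \<le> m" "x \<in> frontier S" for k x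
    using fr[OF that] by simp
  show ?thesis
    unfolding Cm_fam_def
  proof (intro conjI allI impI)
    fix k t assume k: "k < m"
    note Dt = Cm_famD[OF D k, of t]
    consider "t \<in> interior S" | "t \<in> interior (- S)" | "t \<in> frontier S" using cases by blast
    then show "((\<lambda>x. if x \<in> S then D k x else 0) has_real_derivative (if t \<in> S then D (Suc k) t else 0)) (at t)"
    proof cases
      case 1
      obtain e where e: "e > 0" "\<And>y. dist y t < e \<Longrightarrow> y \<in> S" using loc1[OF 1] by blast
      have "t \<in> S" using e by simp
      then show ?thesis using has_field_derivative_transform_within[OF Dt e(1)] e by simp
    next
      case 2
      obtain e where e: "e > 0" "\<And>y. dist y t < e \<Longrightarrow> y \<notin> S" using loc2[OF 2] by blast
      have tn: "t \<notin> S" using e by simp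
      have "((\<lambda>x. 0) has_real_derivative 0) (at t)" by simp
      from has_field_derivative_transform_within[OF this e(1), where g = "\<lambda>x. if x \<in> S then D k x else 0"]
      show ?thesis using e tn by simp
    next
      case 3
      have z: "D k t = 0" "D (Suc k) t = 0" using fr[OF _ 3] k by auto
      have d: "(D k has_derivative (\<lambda>h. h * 0)) (at t)" using Dt z by (simp add: has_field_derivative_def lambda_zero)
      have al: "\<forall>e>0. \<exists>d>0. \<forall>y. norm (y - t) < d \<longrightarrow> norm (D k y - D k t - (y - t) * 0) \<le> e * norm (y - t)"
        using d unfolding has_derivative_at_alt by (rule conjunct2)
      have "((\<lambda>x. if x \<in> S then D k x else 0) has_derivative (\<lambda>h. h * 0)) (at t)"
        unfolding has_derivative_at_alt
      proof (intro conjI allI impI)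
        show "bounded_linear (\<lambda>h::real. h * 0 :: real)" by simp
        fix e :: real assume "e > 0"
        then obtain d where d: "d > 0" "\<And>y. norm (y - t) < d \<Longrightarrow> norm (D k y - D k t - (y - t) * 0) \<le> e * norm (y - t)"
          using al by meson
        show "\<exists>d>0. \<forall>y. norm (y - t) < d \<longrightarrow> norm ((if y \<in> S then D k y else 0) - (if t \<in> S then D k t else 0) - (y - t) * 0) \<le> e * norm (y - t)"
          using d \<open>e > 0\<close> z by (intro exI[of _ d]) auto
      qed
      moreover have "(\<lambda>h::real. h * 0) = (*) (if t \<in> S then D (Suc k) t else 0)" using z by auto
      ultimately show ?thesis by (simp add: has_field_derivative_def)
    qed
  next
    have "isCont (\<lambda>x. if x \<in> S then D m x else 0) t" for t
    proof -
      have Dt: "isCont (D m) t" using Cm_fam_cont[OF D order_refl, of UNIV] by (simp add: continuous_on_eq_continuous_at)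
      consider "t \<in> interior S" | "t \<in> interior (- S)" | "t \<in> frontier S" using cases by blast
      then show ?thesis
      proof cases
        case 1
        obtain e where e: "e > 0" "\<And>y. dist y t < e \<Longrightarrow> y \<in> S" using loc1[OF 1] by blast
        then show ?thesis using continuous_transform_within[OF Dt e(1), where g = "\<lambda>x. if x \<in> S then D m x else 0"] by simp
      next
        case 2
        obtain e where e: "e > 0" "\<And>y. dist y t < e \<Longrightarrow> y \<notin> S" using loc2[OF 2] by blast
        have "isCont (\<lambda>x. 0::real) t" by simp
        from continuous_transform_within[OF this e(1), where g = "\<lambda>x. if x \<in> S then D m x else 0"] e
        show ?thesis by simp
      next
        case 3
        have z: "D m t = 0" using fr[OF _ 3] by auto
        show ?thesis
          unfolding continuous_at_eps_delta
        proof (intro allI impI)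
          fix e :: real assume e: "e > 0"
          then obtain d where d: "d > 0" "\<And>y. dist y t < d \<Longrightarrow> dist (D m y) (D m t) < e"
            using Dt unfolding continuous_at_eps_delta by blast
          show "\<exists>d>0. \<forall>y. dist y t < d \<longrightarrow> dist (if y \<in> S then D m y else 0) (if t \<in> S then D m t else 0) < e"
            using d e z by (intro exI[of _ d]) auto
        qed
      qed
    qed
    then show "continuous_on UNIV (\<lambda>x. if x \<in> S then D m x else 0)"
      by (simp add: continuous_at_imp_continuous_on)
  qed
qed

section \<open>Polynomials with a zero of high order, and triangular systems\<close>

lemma Cm_fam_poly: "Cm_fam m (\<lambda>k x. poly ((pderiv ^^ k) p) x)"
  unfolding Cm_fam_def by (auto intro: poly_DERIV continuous_intros)

lemma power_Suc_dvd_pderiv: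
  fixes p l :: "real poly"
  assumes "l ^ Suc n dvd p" shows "l ^ n dvd pderiv p"
proof -
  obtain q where q: "p = l ^ Suc n * q" using assms by (elim dvdE)
  have "pderiv p = l ^ n * (l * pderiv q + smult (of_nat (Suc n)) (q * pderiv l))"
    unfolding q pderiv_mult pderiv_power_Suc by (simp add: algebra_simps smult_add_right)
  then show ?thesis by simp
qed

lemma power_add_dvd_pderiv_iter:
  fixes p l :: "real poly"
  shows "l ^ (n + k) dvd p \<Longrightarrow> l ^ n dvd (pderiv ^^ k) p"
proof (induction k arbitrary: n)
  case (Suc k)
  have "l ^ Suc n dvd (pderiv ^^ k) p" by (rule Suc.IH) (use Suc.prems in simp)
  then show ?case using power_Suc_dvd_pderiv by simp
qed simp

lemma poly_pderiv_iter_zero: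
  fixes p l :: "real poly"
  assumes "l ^ n dvd p" "k < n" "poly l c = 0" shows "poly ((pderiv ^^ k) p) c = 0"
proof -
  have "l ^ (1 + k) dvd p" using assms(1) by (rule power_le_dvd) (use assms(2) in simp)
  then have "l ^ 1 dvd (pderiv ^^ k) p" by (rule power_add_dvd_pderiv_iter)
  then show ?thesis using assms(3) by (auto elim!: dvdE)
qed

text \<open>At the root \<open>c\<close> of \<open>l\<close>, only the term of the Leibniz expansion
  with all \<open>e\<close> derivatives on \<open>l ^ e\<close> survives.\<close>

lemma poly_pderiv_iter_root:
  fixes q l :: "real poly"
  assumes "pderiv l = 1" "poly l c = 0"
  shows "poly ((pderiv ^^ e) (l ^ e * q)) c = fact e * poly q c"
proof (induction e arbitrary: q)
  case (Suc e)
  have "pderiv (l ^ Suc e * q) = l ^ e * (smult (of_nat (Suc e)) q + l * pderiv q)"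
    unfolding pderiv_mult pderiv_power_Suc assms(1) by (simp add: algebra_simps smult_add_right)
  then have "(pderiv ^^ Suc e) (l ^ Suc e * q) = (pderiv ^^ e) (l ^ e * (smult (of_nat (Suc e)) q + l * pderiv q))"
    unfolding funpow_Suc_right o_def by (rule arg_cong)
  then show ?case using Suc.IH[of "smult (of_nat (Suc e)) q + l * pderiv q"] assms(2) by simp
qed simp

text \<open>Forward substitution: equation \<open>j\<close> involves only the unknowns
  \<open>x e\<close> with e \<le> j. \<open>C\<close> depends on \<open>M\<close> alone and is
  chosen before the right-hand side, which gives solutions of proportional size.\<close>

lemma tri_solve:
  fixes M :: "nat \<Rightarrow> nat \<Rightarrow> real"
  assumes "\<And>j. j < n \<Longrightarrow> M j j \<noteq> 0" "\<And>e j. j < e \<Longrightarrow> e < n \<Longrightarrow> M e j = 0"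
  shows "\<exists>C\<ge>0. \<forall>\<mu> t. 0 \<le> t \<and> (\<forall>j<n. \<bar>\<mu> j\<bar> \<le> t) \<longrightarrow>
     (\<exists>x. (\<forall>j<n. \<bar>x j\<bar> \<le> C * t) \<and> (\<forall>j<n. (\<Sum>e<n. x e * M e j) = \<mu> j))"
  using assms
proof (induction n)
  case (Suc n)
  have "\<exists>C\<ge>0. \<forall>\<mu> t. 0 \<le> t \<and> (\<forall>j<n. \<bar>\<mu> j\<bar> \<le> t) \<longrightarrow>
     (\<exists>x. (\<forall>j<n. \<bar>x j\<bar> \<le> C * t) \<and> (\<forall>j<n. (\<Sum>e<n. x e * M e j) = \<mu> j))"
    by (rule Suc.IH) (use Suc.prems in auto)
  then obtain C where C: "C \<ge> 0" and IH: "\<And>\<mu> t. 0 \<le> t \<Longrightarrow> \<forall>j<n. \<bar>\<mu> j\<bar> \<le> t \<Longrightarrow>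
     \<exists>x. (\<forall>j<n. \<bar>x j\<bar> \<le> C * t) \<and> (\<forall>j<n. (\<Sum>e<n. x e * M e j) = \<mu> j)" by blast
  define C' where "C' = C + (1 + (\<Sum>e<n. C * \<bar>M e n\<bar>)) / \<bar>M n n\<bar>"
  have Mn: "M n n \<noteq> 0" using Suc.prems by simp
  have nn: "(\<Sum>e<n. C * \<bar>M e n\<bar>) \<ge> 0" using C by (intro sum_nonneg) auto
  have p: "(1 + (\<Sum>e<n. C * \<bar>M e n\<bar>)) / \<bar>M n n\<bar> \<ge> 0" using nn by simp
  show ?case
  proof (rule exI[of _ C'], intro conjI allI impI)
    show "0 \<le> C'" using C p by (simp add: C'_def)
    fix \<mu> :: "nat \<Rightarrow> real" and t assume h: "0 \<le> t \<and> (\<forall>j<Suc n. \<bar>\<mu> j\<bar> \<le> t)"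
    then obtain x where x: "\<And>j. j < n \<Longrightarrow> \<bar>x j\<bar> \<le> C * t" "\<And>j. j < n \<Longrightarrow> (\<Sum>e<n. x e * M e j) = \<mu> j"
      using IH[of t \<mu>] by auto
    define y where "y = (\<lambda>j. if j = n then (\<mu> n - (\<Sum>e<n. x e * M e n)) / M n n else x j)"
    have yx: "(\<Sum>e<n. y e * M e j) = (\<Sum>e<n. x e * M e j)" for j by (intro sum.cong) (auto simp: y_def)
    have "\<bar>\<Sum>e<n. x e * M e n\<bar> \<le> (\<Sum>e<n. \<bar>x e * M e n\<bar>)" by (rule sum_abs)
    also have "\<dots> \<le> (\<Sum>e<n. C * t * \<bar>M e n\<bar>)"
      unfolding abs_mult using x(1) by (intro sum_mono mult_right_mono) auto
    also have "\<dots> = (\<Sum>e<n. C * \<bar>M e n\<bar>) * t" by (simp add: sum_distrib_left sum_distrib_right mult_ac)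
    finally have "\<bar>\<Sum>e<n. x e * M e n\<bar> \<le> (\<Sum>e<n. C * \<bar>M e n\<bar>) * t" .
    moreover have "\<bar>\<mu> n\<bar> \<le> t" using h by simp
    ultimately have "\<bar>\<mu> n - (\<Sum>e<n. x e * M e n)\<bar> \<le> (1 + (\<Sum>e<n. C * \<bar>M e n\<bar>)) * t"
      unfolding distrib_right by linarith
    then have yn: "\<bar>y n\<bar> \<le> (1 + (\<Sum>e<n. C * \<bar>M e n\<bar>)) / \<bar>M n n\<bar> * t"
      using Mn by (simp add: y_def abs_divide divide_right_mono)
    show "\<exists>x. (\<forall>j<Suc n. \<bar>x j\<bar> \<le> C' * t) \<and> (\<forall>j<Suc n. (\<Sum>e<Suc n. x e * M e j) = \<mu> j)"
    proof (rule exI[of _ y], intro conjI allI impI)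
      fix j assume j: "j < Suc n"
      have a: "C * t \<le> C' * t" "(1 + (\<Sum>e<n. C * \<bar>M e n\<bar>)) / \<bar>M n n\<bar> * t \<le> C' * t"
        by (rule mult_right_mono; use h C p in \<open>simp add: C'_def\<close>)+
      show "\<bar>y j\<bar> \<le> C' * t"
      proof (cases "j = n")
        case True then show ?thesis using yn a(2) by simp
      next
        case False
        then have "\<bar>y j\<bar> \<le> C * t" using x(1)[of j] j by (simp add: y_def)
        then show ?thesis using a by linarith
      qed
      show "(\<Sum>e<Suc n. y e * M e j) = \<mu> j"
      proof (cases "j = n")
        case True then show ?thesis using Mn by (simp add: yx) (simp add: y_def)
      next
        case False
        then show ?thesis using j x(2)[of j] Suc.prems(2)[of j n] by (simp add: yx)
      qed
    qed
  qed
qed (auto intro: exI[of _ 0])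

lemma Cm_fam_bound:
  fixes n m :: nat
  assumes "\<And>e. e < n \<Longrightarrow> Cm_fam m (E e)"
  shows "\<exists>M\<ge>0. \<forall>e k s. e < n \<longrightarrow> k \<le> m \<longrightarrow> s \<in> {0..1} \<longrightarrow> \<bar>E e k s\<bar> \<le> M"
proof -
  have "\<exists>M. \<forall>s\<in>{0..1}. \<bar>E e k s\<bar> \<le> M" if "e < n" "k \<le> m" for e k
  proof -
    have "compact (E e k ` {0..1})" by (intro compact_continuous_image Cm_fam_cont[OF assms] that compact_Icc)
    then show ?thesis using compact_imp_bounded bounded_iff by (metis image_eqI real_norm_def)
  qed
  then obtain M where M: "\<And>e k s. e < n \<Longrightarrow> k \<le> m \<Longrightarrow> s \<in> {0..1} \<Longrightarrow> \<bar>E e k s\<bar> \<le> M e k" by metis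
  show ?thesis
  proof (rule exI[of _ "\<Sum>e<n. \<Sum>k\<le>m. \<bar>M e k\<bar>"], intro conjI allI impI)
    show "0 \<le> (\<Sum>e<n. \<Sum>k\<le>m. \<bar>M e k\<bar>)" by (intro sum_nonneg) auto
    fix e k s assume h: "e < n" "k \<le> m" "s \<in> {0..1::real}"
    have "\<bar>E e k s\<bar> \<le> \<bar>M e k\<bar>" using M[OF h] by linarith
    also have "\<dots> \<le> (\<Sum>k\<le>m. \<bar>M e k\<bar>)" using h by (intro member_le_sum) auto
    also have "\<dots> \<le> (\<Sum>e<n. \<Sum>k\<le>m. \<bar>M e k\<bar>)"
      using h by (intro member_le_sum[where f = "\<lambda>e. \<Sum>k\<le>m. \<bar>M e k\<bar>"] sum_nonneg) auto
    finally show "\<bar>E e k s\<bar> \<le> (\<Sum>e<n. \<Sum>k\<le>m. \<bar>M e k\<bar>)" .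
  qed
qed

lemma combination_bound:
  fixes x :: "nat \<Rightarrow> real"
  assumes "\<And>e. e < n \<Longrightarrow> \<bar>x e\<bar> \<le> C * t" "\<And>e. e < n \<Longrightarrow> \<bar>y e\<bar> \<le> M"
  shows "\<bar>\<Sum>e<n. x e * y e\<bar> \<le> real n * (C * M) * t"
proof -
  have "\<bar>\<Sum>e<n. x e * y e\<bar> \<le> (\<Sum>e<n. \<bar>x e * y e\<bar>)" by (rule sum_abs)
  also have "\<dots> \<le> (\<Sum>e<n. (C * t) * M)"
    unfolding abs_mult using assms by (intro sum_mono mult_mono') (auto intro: order_trans[OF abs_ge_zero])
  finally show ?thesis by (simp add: mult_ac)
qed

text \<open>The basis functions are (x - 1)^e (x - 1/2)^(m+1), replaced by 0 up to 1/2, where they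
  vanish to order m. At 1 the first nonzero derivative of the e-th one has order e, so the array of
  derivatives is triangular.\<close>

lemma endpoint_jet:
  "\<exists>C\<ge>0. \<forall>\<eta> t. 0 \<le> t \<and> (\<forall>k\<le>m. \<bar>\<eta> k\<bar> \<le> t) \<longrightarrow>
     (\<exists>h. Cm_fam m h \<and> (\<forall>k\<le>m. \<forall>s\<le>1/2. h k s = 0) \<and> (\<forall>k\<le>m. h k 1 = \<eta> k) \<and>
        (\<forall>k\<le>m. \<forall>s\<in>{0..1}. \<bar>h k s\<bar> \<le> C * t))"
proof -
  define q :: "real poly" where "q = [:- (1/2), 1:] ^ Suc m"
  define p where "p e = [:- 1, 1:] ^ e * q" for e
  define E where "E = (\<lambda>e k x. if x \<in> {1/2<..} then poly ((pderiv ^^ k) (p e)) x else 0)"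
  have fr: "frontier {1/2::real<..} = {1/2}" by (auto simp: frontier_def interior_open)
  have E: "Cm_fam m (E e)" for e
    unfolding E_def
  proof (rule Cm_fam_cut[OF Cm_fam_poly])
    fix k and x :: real assume "k \<le> m" "x \<in> frontier {1/2::real<..}"
    then have "x = 1/2" "k < Suc m" using fr by auto
    moreover have "[:- (1/2), 1:] ^ Suc m dvd p e" unfolding p_def q_def by (rule dvd_triv_right)
    ultimately show "poly ((pderiv ^^ k) (p e)) x = 0"
      by (intro poly_pderiv_iter_zero[of "[:- (1/2), 1:]" "Suc m"]) auto
  qed
  have "\<exists>C\<ge>0. \<forall>\<mu> t. 0 \<le> t \<and> (\<forall>j<Suc m. \<bar>\<mu> j\<bar> \<le> t) \<longrightarrow>
     (\<exists>x. (\<forall>j<Suc m. \<bar>x j\<bar> \<le> C * t) \<and> (\<forall>j<Suc m. (\<Sum>e<Suc m. x e * E e j 1) = \<mu> j))"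
  proof (rule tri_solve)
    show "E j j 1 \<noteq> 0" for j
    proof -
      have "poly ((pderiv ^^ j) (p j)) 1 = fact j * poly q 1"
        unfolding p_def by (rule poly_pderiv_iter_root) (simp_all add: pderiv_pCons)
      moreover have "poly q 1 \<noteq> 0" unfolding q_def poly_power by simp
      ultimately show ?thesis by (simp add: E_def)
    qed
    show "E e j 1 = 0" if "j < e" for e j
    proof -
      have "[:- 1, 1:] ^ e dvd p e" unfolding p_def by (rule dvd_triv_left)
      then have "poly ((pderiv ^^ j) (p e)) 1 = 0" using that by (rule poly_pderiv_iter_zero) simp
      then show ?thesis by (simp add: E_def)
    qed
  qed
  then obtain C where C: "C \<ge> 0" "\<forall>\<mu> t. 0 \<le> t \<and> (\<forall>j<Suc m. \<bar>\<mu> j\<bar> \<le> t) \<longrightarrow>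
     (\<exists>x. (\<forall>j<Suc m. \<bar>x j\<bar> \<le> C * t) \<and> (\<forall>j<Suc m. (\<Sum>e<Suc m. x e * E e j 1) = \<mu> j))"
    by (elim exE conjE) (rule that; assumption)
  obtain M where M: "M \<ge> 0" "\<And>e k s. e < Suc m \<Longrightarrow> k \<le> m \<Longrightarrow> s \<in> {0..1} \<Longrightarrow> \<bar>E e k s\<bar> \<le> M"
    using Cm_fam_bound[of "Suc m" m E, OF E] by auto
  show ?thesis
  proof (rule exI[of _ "real (Suc m) * (C * M)"], intro conjI allI impI)
    show "0 \<le> real (Suc m) * (C * M)" using C M by simp
    fix \<eta> :: "nat \<Rightarrow> real" and t assume h: "0 \<le> t \<and> (\<forall>k\<le>m. \<bar>\<eta> k\<bar> \<le> t)"
    obtain x where x: "\<And>j. j < Suc m \<Longrightarrow> \<bar>x j\<bar> \<le> C * t" "\<And>j. j < Suc m \<Longrightarrow> (\<Sum>e<Suc m. x e * E e j 1) = \<eta> j"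
    proof -
      have "0 \<le> t \<and> (\<forall>j<Suc m. \<bar>\<eta> j\<bar> \<le> t)" using h by (simp add: less_Suc_eq_le)
      from C(2)[rule_format, OF this] show ?thesis using that by blast
    qed
    show "\<exists>h. Cm_fam m h \<and> (\<forall>k\<le>m. \<forall>s\<le>1/2. h k s = 0) \<and> (\<forall>k\<le>m. h k 1 = \<eta> k) \<and>
        (\<forall>k\<le>m. \<forall>s\<in>{0..1}. \<bar>h k s\<bar> \<le> real (Suc m) * (C * M) * t)"
    proof (rule exI[of _ "\<lambda>k s. \<Sum>e<Suc m. x e * E e k s"], intro conjI allI impI ballI)
      show "Cm_fam m (\<lambda>k s. \<Sum>e<Suc m. x e * E e k s)" by (intro Cm_fam_sum Cm_fam_cmult E)
      show "(\<Sum>e<Suc m. x e * E e k s) = 0" if "s \<le> 1/2" for k s using that by (intro sum.neutral) (auto simp: E_def)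
      show "(\<Sum>e<Suc m. x e * E e k 1) = \<eta> k" if "k \<le> m" for k using x(2)[of k] that by simp
      show "\<bar>\<Sum>e<Suc m. x e * E e k s\<bar> \<le> real (Suc m) * (C * M) * t" if "k \<le> m" "s \<in> {0..1}" for k s
        by (rule combination_bound[OF x(1) M(2)[OF _ that]])
    qed
  qed
qed

section \<open>Integration by parts and moments\<close>

lemma poly_parts:
  fixes V q :: "real poly"
  assumes "c \<le> d" "poly V c = 0" "poly V d = 0"
  shows "integral {c..d} (\<lambda>x. poly (pderiv V) x * poly q x) = - integral {c..d} (\<lambda>x. poly V x * poly (pderiv q) x)"
proof -
  have "(poly (V * q) has_vector_derivative poly (pderiv (V * q)) x) (at x within {c..d})" for x
    unfolding has_real_derivative_iff_has_vector_derivative[symmetric]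
    by (rule has_field_derivative_at_within[OF poly_DERIV])
  then have "(poly (pderiv (V * q)) has_integral (poly (V * q) d - poly (V * q) c)) {c..d}"
    by (intro fundamental_theorem_of_calculus[OF assms(1)])
  then have "integral {c..d} (poly (pderiv (V * q))) = poly (V * q) d - poly (V * q) c"
    by (rule integral_unique)
  then have "0 = integral {c..d} (poly (pderiv (V * q)))" using assms by simp
  also have "poly (pderiv (V * q)) = (\<lambda>x. poly (pderiv V) x * poly q x + poly V x * poly (pderiv q) x)"
    by (rule ext) (simp add: pderiv_mult algebra_simps)
  also have "integral {c..d} \<dots> = integral {c..d} (\<lambda>x. poly (pderiv V) x * poly q x) + integral {c..d} (\<lambda>x. poly V x * poly (pderiv q) x)"
    by (rule integral_add) (auto intro!: integrable_continuous_interval continuous_intros)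
  finally have "0 = integral {c..d} (\<lambda>x. poly (pderiv V) x * poly q x) + integral {c..d} (\<lambda>x. poly V x * poly (pderiv q) x)" .
  then show ?thesis by linarith
qed

lemma poly_parts_iter:
  fixes V q :: "real poly"
  assumes "c \<le> d" "\<And>k. k < e \<Longrightarrow> poly ((pderiv ^^ k) V) c = 0" "\<And>k. k < e \<Longrightarrow> poly ((pderiv ^^ k) V) d = 0"
  shows "integral {c..d} (\<lambda>x. poly ((pderiv ^^ e) V) x * poly q x)
       = (-1) ^ e * integral {c..d} (\<lambda>x. poly V x * poly ((pderiv ^^ e) q) x)"
  using assms(2,3)
proof (induction e arbitrary: q)
  case (Suc e)
  have "integral {c..d} (\<lambda>x. poly ((pderiv ^^ Suc e) V) x * poly q x)
      = - integral {c..d} (\<lambda>x. poly ((pderiv ^^ e) V) x * poly (pderiv q) x)"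
    using poly_parts[OF assms(1), of "(pderiv ^^ e) V" q] Suc.prems by simp
  also have "\<dots> = - ((-1) ^ e * integral {c..d} (\<lambda>x. poly V x * poly ((pderiv ^^ e) (pderiv q)) x))"
    by (subst Suc.IH) (use Suc.prems in auto)
  finally show ?case by (simp only: funpow_Suc_right o_def power_Suc)
qed simp

lemma pderiv_iter_monom_less: "j < e \<Longrightarrow> (pderiv ^^ e) (monom (a::real) j) = 0"
proof (induction e arbitrary: j a)
  case (Suc e)
  show ?case
  proof (cases j)
    case 0
    have "(pderiv ^^ e) 0 = (0 :: real poly)" by (induction e) auto
    then show ?thesis using 0 by (simp only: funpow_Suc_right o_def pderiv_monom) simp
  next
    case (Suc j')
    then show ?thesis using Suc.IH[of j'] Suc.prems by (simp only: funpow_Suc_right o_def pderiv_monom) simp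
  qed
qed simp

lemma pderiv_iter_monom_self: "(pderiv ^^ e) (monom (a::real) e) = [:fact e * a:]"
proof (induction e arbitrary: a)
  case (Suc e)
  show ?case by (simp only: funpow_Suc_right o_def pderiv_monom) (simp add: Suc.IH mult_ac)
qed (simp add: monom_0)

text \<open>By repeated integration by parts the moments of the derivatives of \<open>((x - c) (x - d)) ^ (2 m + 2)\<close>
  form a triangular array.\<close>

definition bump :: "nat \<Rightarrow> real \<Rightarrow> real \<Rightarrow> real poly" where
  "bump m c d = ([:- c, 1:] * [:- d, 1:]) ^ (2 * Suc m)"

lemma poly_bump: "poly (bump m c d) x = ((x - c) * (x - d)) ^ (2 * Suc m)"
proof -
  have "poly ([:- c, 1:] * [:- d, 1:]) x = (x - c) * (x - d)" by (simp add: algebra_simps)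
  then show ?thesis unfolding bump_def poly_power by (rule arg_cong)
qed

lemma bump_ends:
  assumes "k < 2 * Suc m"
  shows "poly ((pderiv ^^ k) (bump m c d)) c = 0" "poly ((pderiv ^^ k) (bump m c d)) d = 0"
proof -
  have 1: "[:- c, 1:] ^ (2 * Suc m) dvd bump m c d" "[:- d, 1:] ^ (2 * Suc m) dvd bump m c d"
    unfolding bump_def power_mult_distrib by (rule dvd_triv_left, rule dvd_triv_right)
  show "poly ((pderiv ^^ k) (bump m c d)) c = 0" by (rule poly_pderiv_iter_zero[OF 1(1) assms]) simp
  show "poly ((pderiv ^^ k) (bump m c d)) d = 0" by (rule poly_pderiv_iter_zero[OF 1(2) assms]) simp
qed

lemma bump_moment:
  assumes "c < d" "e < 2 * Suc m"
  shows "j < e \<Longrightarrow> integral {c..d} (\<lambda>x. poly ((pderiv ^^ e) (bump m c d)) x * x ^ j) = 0"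
    and "integral {c..d} (\<lambda>x. poly ((pderiv ^^ e) (bump m c d)) x * x ^ e) \<noteq> 0"
proof -
  have 1: "integral {c..d} (\<lambda>x. poly ((pderiv ^^ e) (bump m c d)) x * x ^ j)
      = (-1) ^ e * integral {c..d} (\<lambda>x. poly (bump m c d) x * poly ((pderiv ^^ e) (monom 1 j)) x)" for j
  proof -
    have "integral {c..d} (\<lambda>x. poly ((pderiv ^^ e) (bump m c d)) x * poly (monom 1 j) x)
      = (-1) ^ e * integral {c..d} (\<lambda>x. poly (bump m c d) x * poly ((pderiv ^^ e) (monom 1 j)) x)"
      by (rule poly_parts_iter) (use assms in \<open>auto intro!: bump_ends\<close>)
    then show ?thesis by (simp only: poly_monom mult_1)
  qed
  show "integral {c..d} (\<lambda>x. poly ((pderiv ^^ e) (bump m c d)) x * x ^ j) = 0" if "j < e"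
    unfolding 1 pderiv_iter_monom_less[OF that] by simp
  \<comment> \<open>The exponent in \<open>bump\<close> is even, so \<open>bump\<close> is
    nonnegative and its integral vanishes only if it does; it does not at the midpoint.\<close>
  have "integral {c..d} (poly (bump m c d)) \<noteq> 0"
  proof
    assume "integral {c..d} (poly (bump m c d)) = 0"
    then have "\<forall>x\<in>{c..d}. poly (bump m c d) x = 0"
      by (subst (asm) integral_eq_0_iff)
        (use assms(1) in \<open>auto simp: poly_bump power_mult intro!: continuous_intros simp del: mult_Suc_right\<close>)
    then have "poly (bump m c d) ((c + d) / 2) = 0" using assms by auto
    then have "((c + d) / 2 - c) * ((c + d) / 2 - d) = 0" unfolding poly_bump by (rule power_eq_0_iff[THEN iffD1, THEN conjunct1])
    then show False using assms by auto
  qed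
  then show "integral {c..d} (\<lambda>x. poly ((pderiv ^^ e) (bump m c d)) x * x ^ e) \<noteq> 0"
    unfolding 1 pderiv_iter_monom_self by simp
qed

text \<open>Two roles of differentiation: \<open>e\<close> selects the profile, the e-th derivative
  of the bump, and \<open>k\<close> is the order within the family of that profile.\<close>

definition bumpf :: "nat \<Rightarrow> real \<Rightarrow> real \<Rightarrow> nat \<Rightarrow> nat \<Rightarrow> real \<Rightarrow> real" where
  "bumpf m c d e k x = (if x \<in> {c..d} then poly ((pderiv ^^ k) ((pderiv ^^ e) (bump m c d))) x else 0)"

lemma pderiv_iter_iter: "(pderiv ^^ k) ((pderiv ^^ e) p) = (pderiv ^^ (k + e)) p"
  by (simp add: funpow_add)

text \<open>This fixes the exponent of \<open>bump\<close>: with k \<le> m and e \<le> m + 1 at most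
  2 m + 1 derivatives are taken, and all of these vanish at the end points. The value e = m + 1
  occurs in \<open>slot_area\<close>.\<close>

lemma Cm_fam_bumpf:
  assumes "c < d" "e \<le> Suc m" shows "Cm_fam m (bumpf m c d e)"
  unfolding bumpf_def
proof (rule Cm_fam_cut[OF Cm_fam_poly])
  fix k x assume "k \<le> m" "x \<in> frontier {c..d}"
  then have "x = c \<or> x = d" "k + e < 2 * Suc m" using assms by (auto simp: frontier_def)
  then show "poly ((pderiv ^^ k) ((pderiv ^^ e) (bump m c d))) x = 0"
    unfolding pderiv_iter_iter using bump_ends[of "k + e" m c d] by auto
qed

lemma bumpf_support:
  assumes "c < d" "e \<le> Suc m" "k \<le> m" "s \<notin> {c<..<d}" shows "bumpf m c d e k s = 0"
proof (cases "s \<in> {c..d}")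
  case True
  then have "s = c \<or> s = d" using assms by auto
  then show ?thesis using assms bump_ends[of "k + e" m c d] unfolding bumpf_def pderiv_iter_iter by auto
next
  case False
  then show ?thesis unfolding bumpf_def by (rule if_not_P)
qed

lemma bumpf_integral:
  assumes "0 \<le> c" "d \<le> 1"
  shows "integral {0..1} (\<lambda>s. bumpf m c d e k s * g s) = integral {c..d} (\<lambda>s. poly ((pderiv ^^ (k + e)) (bump m c d)) s * g s)"
proof -
  have "(\<lambda>s. bumpf m c d e k s * g s) = (\<lambda>s. if s \<in> {c..d} then poly ((pderiv ^^ (k + e)) (bump m c d)) s * g s else 0)"
    by (auto simp: bumpf_def pderiv_iter_iter)
  moreover have "{c..d} \<inter> {0..1} = {c..d}" using assms by auto
  ultimately show ?thesis by (simp only: integral_restrict_Int)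
qed

text \<open>If the energy vanished, so would the derivative of order m + 1 on the interval, against
  its nonzero moment of that order.\<close>

lemma bump_energy:
  assumes "c < d"
  shows "integral {c..d} (\<lambda>x. poly ((pderiv ^^ Suc m) (bump m c d)) x * poly ((pderiv ^^ Suc m) (bump m c d)) x) > 0"
proof -
  let ?p = "(pderiv ^^ Suc m) (bump m c d)"
  have nn: "integral {c..d} (\<lambda>x. poly ?p x * poly ?p x) \<ge> 0"
    by (rule integral_nonneg) (auto intro!: integrable_continuous_interval continuous_intros simp del: funpow.simps)
  have "integral {c..d} (\<lambda>x. poly ?p x * poly ?p x) \<noteq> 0"
  proof
    assume "integral {c..d} (\<lambda>x. poly ?p x * poly ?p x) = 0"
    then have "\<forall>x\<in>{c..d}. poly ?p x * poly ?p x = 0"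
      by (subst (asm) integral_eq_0_iff) (use assms in \<open>auto intro!: continuous_intros simp del: funpow.simps\<close>)
    then have "integral {c..d} (\<lambda>x. poly ?p x * x ^ Suc m) = integral {c..d} (\<lambda>x. 0)"
      by (intro integral_cong) auto
    then show False using bump_moment(2)[OF assms, of "Suc m" m] by simp
  qed
  then show ?thesis using nn by linarith
qed

text \<open>The velocity of a Taylor polynomial has degree below m, so a perturbation meets it only
  through its first m moments. Those of the profiles with e < m form a triangular array and can be
  combined to any values.\<close>

lemma slot_linear:
  fixes m :: nat
  assumes "0 \<le> c" "c < d" "d \<le> 1"
  shows "\<exists>C\<ge>0. \<forall>\<mu> t. 0 \<le> t \<and> (\<forall>j<m. \<bar>\<mu> j\<bar> \<le> t) \<longrightarrow>
     (\<exists>h. Cm_fam m h \<and> (\<forall>k\<le>m. \<forall>s. s \<notin> {c<..<d} \<longrightarrow> h k s = 0) \<and>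
        (\<forall>j<m. integral {0..1} (\<lambda>s. h 0 s * s ^ j) = \<mu> j) \<and>
        (\<forall>k\<le>m. \<forall>s\<in>{0..1}. \<bar>h k s\<bar> \<le> C * t))"
proof -
  define E where "E = bumpf m c d"
  have E: "Cm_fam m (E e)" if "e < m" for e unfolding E_def by (rule Cm_fam_bumpf) (use assms that in auto)
  define Mo where "Mo e j = integral {0..1} (\<lambda>s. E e 0 s * s ^ j)" for e j
  have Mo: "Mo e j = integral {c..d} (\<lambda>s. poly ((pderiv ^^ e) (bump m c d)) s * s ^ j)" for e j
    unfolding Mo_def E_def bumpf_integral[OF assms(1,3)] by simp
  have "\<exists>C\<ge>0. \<forall>\<mu> t. 0 \<le> t \<and> (\<forall>j<m. \<bar>\<mu> j\<bar> \<le> t) \<longrightarrow>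
     (\<exists>x. (\<forall>j<m. \<bar>x j\<bar> \<le> C * t) \<and> (\<forall>j<m. (\<Sum>e<m. x e * Mo e j) = \<mu> j))"
  proof (rule tri_solve)
    show "Mo j j \<noteq> 0" if "j < m" for j
      unfolding Mo using bump_moment(2)[OF assms(2), of j m] that by simp
    show "Mo e j = 0" if "j < e" "e < m" for e j
      unfolding Mo using bump_moment(1)[OF assms(2), of e m j] that by simp
  qed
  then obtain C where C: "C \<ge> 0" "\<forall>\<mu> t. 0 \<le> t \<and> (\<forall>j<m. \<bar>\<mu> j\<bar> \<le> t) \<longrightarrow>
     (\<exists>x. (\<forall>j<m. \<bar>x j\<bar> \<le> C * t) \<and> (\<forall>j<m. (\<Sum>e<m. x e * Mo e j) = \<mu> j))"
    by (elim exE conjE) (rule that; assumption)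
  obtain M where M: "M \<ge> 0" "\<And>e k s. e < m \<Longrightarrow> k \<le> m \<Longrightarrow> s \<in> {0..1} \<Longrightarrow> \<bar>E e k s\<bar> \<le> M"
    using Cm_fam_bound[of m m E, OF E] by auto
  show ?thesis
  proof (rule exI[of _ "real m * (C * M)"], intro conjI allI impI)
    show "0 \<le> real m * (C * M)" using C M by simp
    fix \<mu> :: "nat \<Rightarrow> real" and t assume h: "0 \<le> t \<and> (\<forall>j<m. \<bar>\<mu> j\<bar> \<le> t)"
    obtain x where x: "\<And>j. j < m \<Longrightarrow> \<bar>x j\<bar> \<le> C * t" "\<And>j. j < m \<Longrightarrow> (\<Sum>e<m. x e * Mo e j) = \<mu> j"
    proof -
      from C(2)[rule_format, OF h] show ?thesis using that by (elim exE conjE) auto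
    qed
    show "\<exists>h. Cm_fam m h \<and> (\<forall>k\<le>m. \<forall>s. s \<notin> {c<..<d} \<longrightarrow> h k s = 0) \<and>
        (\<forall>j<m. integral {0..1} (\<lambda>s. h 0 s * s ^ j) = \<mu> j) \<and>
        (\<forall>k\<le>m. \<forall>s\<in>{0..1}. \<bar>h k s\<bar> \<le> real m * (C * M) * t)"
    proof (rule exI[of _ "\<lambda>k s. \<Sum>e<m. x e * E e k s"], intro conjI allI impI ballI)
      show "Cm_fam m (\<lambda>k s. \<Sum>e<m. x e * E e k s)" by (intro Cm_fam_sum Cm_fam_cmult E) auto
      show "(\<Sum>e<m. x e * E e k s) = 0" if "k \<le> m" "s \<notin> {c<..<d}" for k s
        using bumpf_support[OF assms(2) _ that] by (intro sum.neutral) (auto simp: E_def)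
      show "integral {0..1} (\<lambda>s. (\<Sum>e<m. x e * E e 0 s) * s ^ j) = \<mu> j" if "j < m" for j
      proof -
        have "integral {0..1} (\<lambda>s. (\<Sum>e<m. x e * E e 0 s) * s ^ j) = integral {0..1} (\<lambda>s. \<Sum>e<m. x e * (E e 0 s * s ^ j))"
          by (simp add: sum_distrib_right mult.assoc)
        also have "\<dots> = (\<Sum>e<m. integral {0..1} (\<lambda>s. x e * (E e 0 s * s ^ j)))"
          by (rule integral_sum) (auto intro!: integrable_continuous_interval continuous_intros Cm_fam_cont[OF E])
        finally show ?thesis using x(2)[OF that] by (simp add: Mo_def)
      qed
      show "\<bar>\<Sum>e<m. x e * E e k s\<bar> \<le> real m * (C * M) * t" if "k \<le> m" "s \<in> {0..1}" for k s
        by (rule combination_bound[OF x(1) M(2)[OF _ that]])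
    qed
  qed
qed

text \<open>With W the bump, f and g are multiples of its derivatives of orders m and m + 1. Both
  are orthogonal to polynomials of degree below m, and integration by parts turns the area of the
  unscaled pair into -2 Q, with Q the energy of the derivative of order m + 1. Area being quadratic
  in the size, \<sigma> costs size sqrt |\<sigma>|.\<close>

lemma slot_area:
  assumes "1 \<le> m" "0 \<le> c" "c < d" "d \<le> 1"
  shows "\<exists>C\<ge>0. \<forall>\<sigma>. \<exists>f g. Cm_fam m f \<and> Cm_fam m g \<and>
        (\<forall>k\<le>m. \<forall>s. s \<notin> {c<..<d} \<longrightarrow> f k s = 0 \<and> g k s = 0) \<and>
        (\<forall>j<m. integral {0..1} (\<lambda>s. f 0 s * s ^ j) = 0 \<and> integral {0..1} (\<lambda>s. g 0 s * s ^ j) = 0) \<and>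
        integral {0..1} (\<lambda>s. f 0 s * g 1 s - f 1 s * g 0 s) = 2 * \<sigma> \<and>
        (\<forall>k\<le>m. \<forall>s\<in>{0..1}. \<bar>f k s\<bar> \<le> C * sqrt \<bar>\<sigma>\<bar> \<and> \<bar>g k s\<bar> \<le> C * sqrt \<bar>\<sigma>\<bar>)"
proof -
  define E where "E e = bumpf m c d (m + e)" for e
  have E: "Cm_fam m (E e)" if "e < 2" for e unfolding E_def by (rule Cm_fam_bumpf) (use assms that in auto)
  have E': "Cm_fam m (E 0)" "Cm_fam m (E 1)" using E by auto
  obtain M where M: "M \<ge> 0" "\<And>e k s. e < 2 \<Longrightarrow> k \<le> m \<Longrightarrow> s \<in> {0..1} \<Longrightarrow> \<bar>E e k s\<bar> \<le> M"
    using Cm_fam_bound[of 2 m E, OF E] by auto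
  let ?W = "\<lambda>e. (pderiv ^^ e) (bump m c d)"
  define Q where "Q = integral {c..d} (\<lambda>x. poly (?W (Suc m)) x * poly (?W (Suc m)) x)"
  have Q: "Q > 0" unfolding Q_def by (rule bump_energy[OF assms(3)])
  have mom: "integral {0..1} (\<lambda>s. E e 0 s * s ^ j) = 0" if "e < 2" "j < m" for e j
    unfolding E_def bumpf_integral[OF assms(2,4)] using bump_moment(1)[OF assms(3), of "m + e" m j] that by simp
  have supp: "E e k s = 0" if "e < 2" "k \<le> m" "s \<notin> {c<..<d}" for e k s
    unfolding E_def by (rule bumpf_support[OF assms(3)]) (use that in auto)
  have I: "integral {0..1} (\<lambda>s. E e k s * g s) = integral {c..d} (\<lambda>s. poly (?W (k + (m + e))) s * g s)" for e k g
    unfolding E_def by (rule bumpf_integral[OF assms(2,4)])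
  have ar: "integral {0..1} (\<lambda>s. E 0 0 s * E 1 1 s - E 0 1 s * E 1 0 s) = - 2 * Q"
  proof -
    have "integral {0..1} (\<lambda>s. E 0 0 s * E 1 1 s - E 0 1 s * E 1 0 s)
        = integral {0..1} (\<lambda>s. E 0 0 s * E 1 1 s) - integral {0..1} (\<lambda>s. E 0 1 s * E 1 0 s)"
      by (intro integral_diff integrable_continuous_interval continuous_intros Cm_fam_cont[OF E'(1)] Cm_fam_cont[OF E'(2)] assms(1)) simp_all
    also have "integral {0..1} (\<lambda>s. E 0 1 s * E 1 0 s) = integral {c..d} (\<lambda>s. poly (?W (Suc m)) s * E 1 0 s)"
      using I[of 0 1] by simp
    also have "\<dots> = Q"
      unfolding Q_def by (rule integral_cong) (simp add: E_def bumpf_def)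
    also have "integral {0..1} (\<lambda>s. E 0 0 s * E 1 1 s) = integral {c..d} (\<lambda>s. poly (?W m) s * E 1 1 s)"
      using I[of 0 0] by simp
    also have "\<dots> = integral {c..d} (\<lambda>s. poly (?W m) s * poly (pderiv (?W (Suc m))) s)"
      by (rule integral_cong) (simp add: E_def bumpf_def)
    also have "\<dots> = - Q"
      using poly_parts[of c d "?W m" "?W (Suc m)"] bump_ends[of m m c d] assms unfolding Q_def by simp
    finally show ?thesis by simp
  qed
  show ?thesis
  proof (rule exI[of _ "M / sqrt Q"], intro conjI allI)
    show "0 \<le> M / sqrt Q" using M Q by simp
    fix \<sigma> :: real
    \<comment> \<open>The weights must multiply to -\<sigma> / Q to turn the area -2 Q into 2
      \<sigma>; sharing this equally keeps both of size sqrt |\<sigma>|.\<close>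
    define \<alpha> where "\<alpha> = sqrt (\<bar>\<sigma>\<bar> / Q)"
    define \<beta> where "\<beta> = - sgn \<sigma> * \<alpha>"
    have "\<alpha> * \<alpha> * Q = \<bar>\<sigma>\<bar>" unfolding \<alpha>_def using Q by simp
    moreover have "\<alpha> * \<beta> * Q = - (sgn \<sigma> * (\<alpha> * \<alpha> * Q))" by (simp add: \<beta>_def)
    ultimately have ab: "\<alpha> * \<beta> * Q = - \<sigma>" by (simp add: sgn_mult_abs)
    have al: "\<bar>\<alpha>\<bar> \<le> sqrt \<bar>\<sigma>\<bar> / sqrt Q" "\<bar>\<beta>\<bar> \<le> sqrt \<bar>\<sigma>\<bar> / sqrt Q"
      using Q by (auto simp: \<alpha>_def \<beta>_def real_sqrt_divide abs_mult sgn_if)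
    show "\<exists>f g. Cm_fam m f \<and> Cm_fam m g \<and>
        (\<forall>k\<le>m. \<forall>s. s \<notin> {c<..<d} \<longrightarrow> f k s = 0 \<and> g k s = 0) \<and>
        (\<forall>j<m. integral {0..1} (\<lambda>s. f 0 s * s ^ j) = 0 \<and> integral {0..1} (\<lambda>s. g 0 s * s ^ j) = 0) \<and>
        integral {0..1} (\<lambda>s. f 0 s * g 1 s - f 1 s * g 0 s) = 2 * \<sigma> \<and>
        (\<forall>k\<le>m. \<forall>s\<in>{0..1}. \<bar>f k s\<bar> \<le> M / sqrt Q * sqrt \<bar>\<sigma>\<bar> \<and> \<bar>g k s\<bar> \<le> M / sqrt Q * sqrt \<bar>\<sigma>\<bar>)"
    proof (rule exI[of _ "\<lambda>k s. \<alpha> * E 0 k s"], rule exI[of _ "\<lambda>k s. \<beta> * E 1 k s"], intro conjI allI impI ballI)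
      show "Cm_fam m (\<lambda>k s. \<alpha> * E 0 k s)" "Cm_fam m (\<lambda>k s. \<beta> * E 1 k s)" by (intro Cm_fam_cmult E; simp)+
      show "\<alpha> * E 0 k s = 0" "\<beta> * E 1 k s = 0" if "k \<le> m" "s \<notin> {c<..<d}" for k s
        using supp[OF _ that] by auto
      show "integral {0..1} (\<lambda>s. \<alpha> * E 0 0 s * s ^ j) = 0" "integral {0..1} (\<lambda>s. \<beta> * E 1 0 s * s ^ j) = 0" if "j < m" for j
        using mom[OF _ that] by (simp_all add: mult.assoc)
      have "(\<lambda>s. \<alpha> * E 0 0 s * (\<beta> * E 1 1 s) - \<alpha> * E 0 1 s * (\<beta> * E 1 0 s)) = (\<lambda>s. (\<alpha> * \<beta>) * (E 0 0 s * E 1 1 s - E 0 1 s * E 1 0 s))"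
        by (simp add: algebra_simps)
      then show "integral {0..1} (\<lambda>s. \<alpha> * E 0 0 s * (\<beta> * E 1 1 s) - \<alpha> * E 0 1 s * (\<beta> * E 1 0 s)) = 2 * \<sigma>"
        using ar ab by (simp add: mult.commute[of Q])
      have bd: "\<bar>x * y\<bar> \<le> M / sqrt Q * sqrt \<bar>\<sigma>\<bar>" if "\<bar>x\<bar> \<le> sqrt \<bar>\<sigma>\<bar> / sqrt Q" "\<bar>y\<bar> \<le> M" for x y
        using mult_mono'[OF that] by (simp add: abs_mult mult_ac)
      show "\<bar>\<alpha> * E 0 k s\<bar> \<le> M / sqrt Q * sqrt \<bar>\<sigma>\<bar>" if "k \<le> m" "s \<in> {0..1}" for k s
        by (rule bd[OF al(1)]) (rule M(2)[OF _ that], simp)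
      show "\<bar>\<beta> * E 1 k s\<bar> \<le> M / sqrt Q * sqrt \<bar>\<sigma>\<bar>" if "k \<le> m" "s \<in> {0..1}" for k s
        by (rule bd[OF al(2)]) (rule M(2)[OF _ that], simp)
    qed
  qed
qed

text \<open>Only the first half of the unit interval is divided, because the corrections from
  \<open>endpoint_jet\<close> vanish there.\<close>

lemma disjoint_slots:
  assumes "finite P"
  shows "\<exists>c d :: 'a \<Rightarrow> real. \<forall>q\<in>P. 0 \<le> c q \<and> c q < d q \<and> d q \<le> 1/2 \<and>
     (\<forall>q'\<in>P. q \<noteq> q' \<longrightarrow> {c q<..<d q} \<inter> {c q'<..<d q'} = {})"
proof -
  obtain e where e: "bij_betw e P {0..<card P}" using ex_bij_betw_finite_nat[OF assms] by blast
  define N where "N = 2 * real (card P)"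
  define c where "c q = real (e q) / N" for q
  define d where "d q = (real (e q) + 1) / N" for q
  show ?thesis
  proof (rule exI[of _ c], rule exI[of _ d], intro ballI conjI impI)
    fix q assume q: "q \<in> P"
    have eq: "e q < card P" using bij_betwE[OF e] q by auto
    then have N: "N > 0" by (simp add: N_def)
    show "0 \<le> c q" using N by (simp add: c_def)
    show "c q < d q" using N by (simp add: c_def d_def divide_strict_right_mono)
    have "2 * (real (e q) + 1) \<le> N" using eq by (simp add: N_def)
    then show "d q \<le> 1/2" using N by (simp add: d_def field_simps)
    fix q' assume q': "q' \<in> P" "q \<noteq> q'"
    have "e q \<noteq> e q'" using e q q' by (metis bij_betw_imp_inj_on inj_on_eq_iff)
    then consider "e q + 1 \<le> e q'" | "e q' + 1 \<le> e q" by linarith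
    then show "{c q<..<d q} \<inter> {c q'<..<d q'} = {}"
    proof cases
      case 1
      then have "real (e q) + 1 \<le> real (e q')" by linarith
      then have "d q \<le> c q'" using N unfolding c_def d_def by (intro divide_right_mono) auto
      then show ?thesis by auto
    next
      case 2
      then have "real (e q') + 1 \<le> real (e q)" by linarith
      then have "d q' \<le> c q" using N unfolding c_def d_def by (intro divide_right_mono) auto
      then show ?thesis by auto
    qed
  qed
qed

lemma abs_integral_unit_le:
  fixes f :: "real \<Rightarrow> real"
  assumes "continuous_on {0..1} f" "\<And>s. s \<in> {0..1} \<Longrightarrow> \<bar>f s\<bar> \<le> M"
  shows "\<bar>integral {0..1} f\<bar> \<le> M"
  using integral_bound[of 0 1 f M] assms by simp

text \<open>The gap problem on \<open>[0, 1]\<close>: \<open>\<kappa> i\<close> are the coefficients of the velocity of the Taylor polynomial,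
  \<open>\<eta> i\<close> is the jet to be reached at \<open>1\<close> and \<open>a i j\<close> the area. Every index pair \<open>(i, j)\<close> has an interval
  of its own in \<open>[0, 1/2]\<close>: the diagonal ones carry the prescribed moments, the others the area that is
  left.\<close>

lemma unit_solution:
  fixes r m :: nat
  assumes m: "1 \<le> m"
  shows "\<exists>B C. 1 \<le> B \<and> 0 \<le> C \<and> (\<forall>\<kappa> \<eta> a \<epsilon>. 0 \<le> \<epsilon> \<and> (\<forall>i\<in>{1..r}. \<forall>j\<in>{1..r}. a i j + a j i = 0) \<and>
     tame m B {1..r} \<kappa> a \<epsilon> \<and> (\<forall>i\<in>{1..r}. \<forall>k\<le>m. \<bar>\<eta> i k\<bar> \<le> \<epsilon>) \<longrightarrow>
     (\<exists>X. \<forall>i\<in>{1..r}. Cm_fam m (X i) \<and> (\<forall>k\<le>m. X i k 0 = 0 \<and> X i k 1 = \<eta> i k) \<and>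
        (\<forall>k\<le>m. \<forall>s\<in>{0..1}. \<bar>X i k s\<bar> \<le> C * (\<epsilon> + sqrt \<epsilon>)) \<and>
        (\<forall>j\<in>{1..r}. a i j =
           ((\<Sum>d<m. \<kappa> i d / real (Suc d)) * \<eta> j 0 - (\<Sum>d<m. \<kappa> j d / real (Suc d)) * \<eta> i 0) / 2
           + (\<Sum>d<m. \<kappa> j d * integral {0..1} (\<lambda>s. X i 0 s * s ^ d) - \<kappa> i d * integral {0..1} (\<lambda>s. X j 0 s * s ^ d))
           + integral {0..1} (\<lambda>s. X i 0 s * X j 1 s - X i 1 s * X j 0 s) / 2)))"
proof -
  let ?I = "{1..r}"
  define P where "P = ?I \<times> ?I"
  have fP: "finite P" by (simp add: P_def)
  obtain c d :: "nat \<times> nat \<Rightarrow> real" where cd: "\<And>q. q \<in> P \<Longrightarrow> 0 \<le> c q" "\<And>q. q \<in> P \<Longrightarrow> c q < d q" "\<And>q. q \<in> P \<Longrightarrow> d q \<le> 1/2"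
    and disj: "\<And>q q'. q \<in> P \<Longrightarrow> q' \<in> P \<Longrightarrow> q \<noteq> q' \<Longrightarrow> {c q<..<d q} \<inter> {c q'<..<d q'} = {}"
    using disjoint_slots[OF fP] by metis
  define Lin where "Lin q \<mu> M h \<longleftrightarrow> Cm_fam m h \<and> (\<forall>k\<le>m. \<forall>s. s \<notin> {c q<..<d q} \<longrightarrow> h k s = 0) \<and>
        (\<forall>j<m. integral {0..1} (\<lambda>s. h 0 s * s ^ j) = \<mu> j) \<and> (\<forall>k\<le>m. \<forall>s\<in>{0..1}. \<bar>h k s\<bar> \<le> M)" for q \<mu> M and h :: "nat \<Rightarrow> real \<Rightarrow> real"
  define Ar where "Ar q \<sigma> M f g \<longleftrightarrow> Cm_fam m f \<and> Cm_fam m g \<and>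
        (\<forall>k\<le>m. \<forall>s. s \<notin> {c q<..<d q} \<longrightarrow> f k s = 0 \<and> g k s = 0) \<and>
        (\<forall>j<m. integral {0..1} (\<lambda>s. f 0 s * s ^ j) = 0 \<and> integral {0..1} (\<lambda>s. g 0 s * s ^ j) = 0) \<and>
        integral {0..1} (\<lambda>s. f 0 s * g 1 s - f 1 s * g 0 s) = 2 * \<sigma> \<and>
        (\<forall>k\<le>m. \<forall>s\<in>{0..1}. \<bar>f k s\<bar> \<le> M \<and> \<bar>g k s\<bar> \<le> M)" for q \<sigma> M and f g :: "nat \<Rightarrow> real \<Rightarrow> real"
  have Lin_mono: "Lin q \<mu> M' h" if "Lin q \<mu> M h" "M \<le> M'" for q \<mu> M M' h
    using that unfolding Lin_def by (meson order_trans)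
  have Ar_mono: "Ar q \<sigma> M' f g" if "Ar q \<sigma> M f g" "M \<le> M'" for q \<sigma> M M' f g
    using that unfolding Ar_def by (meson order_trans)
  have "\<forall>q\<in>P. \<exists>C. C \<ge> 0 \<and> (\<forall>\<mu> t. 0 \<le> t \<and> (\<forall>j<m. \<bar>\<mu> j\<bar> \<le> t) \<longrightarrow> (\<exists>h. Lin q \<mu> (C * t) h))"
  proof
    fix q assume q: "q \<in> P"
    have "d q \<le> 1" using cd(3)[OF q] by simp
    then show "\<exists>C. C \<ge> 0 \<and> (\<forall>\<mu> t. 0 \<le> t \<and> (\<forall>j<m. \<bar>\<mu> j\<bar> \<le> t) \<longrightarrow> (\<exists>h. Lin q \<mu> (C * t) h))"
      unfolding Lin_def using slot_linear[OF cd(1,2)[OF q], of m] by simp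
  qed
  from bchoice[OF this] obtain CL where
    CL': "\<forall>q\<in>P. CL q \<ge> 0 \<and> (\<forall>\<mu> t. 0 \<le> t \<and> (\<forall>j<m. \<bar>\<mu> j\<bar> \<le> t) \<longrightarrow> (\<exists>h. Lin q \<mu> (CL q * t) h))"
    by (elim exE) (rule that)
  have CL1: "CL q \<ge> 0" if "q \<in> P" for q using CL' that by simp
  have CL2: "\<exists>h. Lin q \<mu> (CL q * t) h" if "q \<in> P" "0 \<le> t" "\<And>j. j < m \<Longrightarrow> \<bar>\<mu> j\<bar> \<le> t" for q \<mu> t
    using CL' that by simp
  have "\<forall>q\<in>P. \<exists>C. C \<ge> 0 \<and> (\<forall>\<sigma>. \<exists>f g. Ar q \<sigma> (C * sqrt \<bar>\<sigma>\<bar>) f g)"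
  proof
    fix q assume q: "q \<in> P"
    have "d q \<le> 1" using cd(3)[OF q] by simp
    then show "\<exists>C. C \<ge> 0 \<and> (\<forall>\<sigma>. \<exists>f g. Ar q \<sigma> (C * sqrt \<bar>\<sigma>\<bar>) f g)"
      unfolding Ar_def using slot_area[OF m cd(1,2)[OF q]] by simp
  qed
  from bchoice[OF this] obtain CA where CA': "\<forall>q\<in>P. CA q \<ge> 0 \<and> (\<forall>\<sigma>. \<exists>f g. Ar q \<sigma> (CA q * sqrt \<bar>\<sigma>\<bar>) f g)"
    by (elim exE) (rule that)
  have CA1: "CA q \<ge> 0" if "q \<in> P" for q using CA' that by simp
  have CA2: "\<exists>f g. Ar q \<sigma> (CA q * sqrt \<bar>\<sigma>\<bar>) f g" if "q \<in> P" for q \<sigma> using CA' that by simp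
  obtain Ch where Ch: "Ch \<ge> 0" "\<And>\<eta> t. 0 \<le> t \<and> (\<forall>k\<le>m. \<bar>\<eta> k\<bar> \<le> t) \<Longrightarrow>
     (\<exists>h. Cm_fam m h \<and> (\<forall>k\<le>m. \<forall>s\<le>1/2. h k s = 0) \<and> (\<forall>k\<le>m. h k 1 = \<eta> k) \<and>
        (\<forall>k\<le>m. \<forall>s\<in>{0..1}. \<bar>h k s\<bar> \<le> Ch * t))"
    using endpoint_jet[of m] by (elim exE conjE) (rule that, assumption, simp)
  define Sol where "Sol \<kappa> a \<epsilon> C l s \<longleftrightarrow> (\<forall>i\<in>?I. \<forall>d<m. \<bar>l i d\<bar> \<le> C * \<epsilon>) \<and> (\<forall>i\<in>?I. \<forall>j\<in>?I. \<bar>s i j\<bar> \<le> C * \<epsilon>) \<and>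
        (\<forall>i\<in>?I. \<forall>j\<in>?I. a i j = (\<Sum>d<m. l i d * \<kappa> j d) - (\<Sum>d<m. l j d * \<kappa> i d) + s i j)"
    for \<kappa> a and \<epsilon> C :: real and l s :: "nat \<Rightarrow> nat \<Rightarrow> real"
  obtain B C1 where BC: "1 \<le> B" "0 \<le> C1" and pv: "\<forall>(I::nat set) \<kappa> \<rho> \<epsilon>. finite I \<and> card I = r \<and> 0 \<le> \<epsilon> \<and>
     (\<forall>i\<in>I. \<forall>j\<in>I. \<rho> i j + \<rho> j i = 0) \<and> tame m B I \<kappa> \<rho> \<epsilon> \<longrightarrow>
     (\<exists>l s. (\<forall>i\<in>I. \<forall>d<m. \<bar>l i d\<bar> \<le> C1 * \<epsilon>) \<and> (\<forall>i\<in>I. \<forall>j\<in>I. \<bar>s i j\<bar> \<le> C1 * \<epsilon>) \<and>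
        (\<forall>i\<in>I. \<forall>j\<in>I. \<rho> i j = (\<Sum>d<m. l i d * \<kappa> j d) - (\<Sum>d<m. l j d * \<kappa> i d) + s i j))"
    using pivot[of r m] by (elim exE conjE) (rule that; assumption)
  have piv: "\<exists>l s. Sol \<kappa> a \<epsilon> C1 l s"
    if "0 \<le> \<epsilon>" "\<forall>i\<in>?I. \<forall>j\<in>?I. a i j + a j i = 0" "tame m B ?I \<kappa> a \<epsilon>" for \<kappa> a \<epsilon>
    unfolding Sol_def by (rule pv[rule_format]) (use that in simp)
  define CLs where "CLs = (\<Sum>q\<in>P. CL q)"
  define CAs where "CAs = (\<Sum>q\<in>P. CA q)"
  have CLs: "CL q \<le> CLs" "CA q \<le> CAs" if "q \<in> P" for q
    unfolding CLs_def CAs_def using fP that CL1 CA1 by (auto intro!: member_le_sum)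
  have CLs0: "0 \<le> CLs" unfolding CLs_def by (rule sum_nonneg) (rule CL1)
  have CAs0: "0 \<le> CAs" unfolding CAs_def by (rule sum_nonneg) (rule CA1)
  note CLs0 = CLs0 CAs0
  define D where "D = CLs * (C1 + Ch + 1) + CAs * (sqrt C1 + Ch)"
  have D0: "0 \<le> D" using CLs0 BC Ch by (simp add: D_def)
  define C where "C = Ch + real (card P) * D"
  have C0: "0 \<le> C" using Ch D0 by (simp add: C_def)
  show ?thesis
  proof (rule exI[of _ B], rule exI[of _ C], intro conjI allI impI)
    show "1 \<le> B" "0 \<le> C" by fact+
    fix \<kappa> \<eta> a and \<epsilon> :: real
    assume H: "0 \<le> \<epsilon> \<and> (\<forall>i\<in>?I. \<forall>j\<in>?I. a i j + a j i = 0) \<and>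
     tame m B ?I \<kappa> a \<epsilon> \<and> (\<forall>i\<in>?I. \<forall>k\<le>m. \<bar>\<eta> i k\<bar> \<le> \<epsilon>)"
    then have e: "0 \<le> \<epsilon>" and alt: "\<forall>i\<in>?I. \<forall>j\<in>?I. a i j + a j i = 0" and T: "tame m B ?I \<kappa> a \<epsilon>"
      and et: "\<And>i k. i \<in> ?I \<Longrightarrow> k \<le> m \<Longrightarrow> \<bar>\<eta> i k\<bar> \<le> \<epsilon>" by auto
    have se: "0 \<le> sqrt \<epsilon>" using e by simp
    obtain l sg where ls: "Sol \<kappa> a \<epsilon> C1 l sg" using piv[OF e alt T] by blast
    then have l: "\<And>i d. i \<in> ?I \<Longrightarrow> d < m \<Longrightarrow> \<bar>l i d\<bar> \<le> C1 * \<epsilon>" and sg: "\<And>i j. i \<in> ?I \<Longrightarrow> j \<in> ?I \<Longrightarrow> \<bar>sg i j\<bar> \<le> C1 * \<epsilon>"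
      and lsa: "\<And>i j. i \<in> ?I \<Longrightarrow> j \<in> ?I \<Longrightarrow> a i j = (\<Sum>d<m. l i d * \<kappa> j d) - (\<Sum>d<m. l j d * \<kappa> i d) + sg i j"
      unfolding Sol_def by auto
    have "\<forall>i\<in>?I. \<exists>h. Cm_fam m h \<and> (\<forall>k\<le>m. \<forall>s\<le>1/2. h k s = 0) \<and> (\<forall>k\<le>m. h k 1 = \<eta> i k) \<and>
        (\<forall>k\<le>m. \<forall>s\<in>{0..1}. \<bar>h k s\<bar> \<le> Ch * \<epsilon>)"
      using Ch(2) e et by simp
    from bchoice[OF this] obtain h where h': "\<forall>i\<in>?I. Cm_fam m (h i) \<and> (\<forall>k\<le>m. \<forall>s\<le>1/2. h i k s = 0) \<and> (\<forall>k\<le>m. h i k 1 = \<eta> i k) \<and>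
        (\<forall>k\<le>m. \<forall>s\<in>{0..1}. \<bar>h i k s\<bar> \<le> Ch * \<epsilon>)" by (elim exE) (rule that)
    have h: "\<And>i. i \<in> ?I \<Longrightarrow> Cm_fam m (h i)"
      "\<And>i k s. i \<in> ?I \<Longrightarrow> k \<le> m \<Longrightarrow> s \<le> 1/2 \<Longrightarrow> h i k s = 0" "\<And>i k. i \<in> ?I \<Longrightarrow> k \<le> m \<Longrightarrow> h i k 1 = \<eta> i k"
      "\<And>i k s. i \<in> ?I \<Longrightarrow> k \<le> m \<Longrightarrow> s \<in> {0..1} \<Longrightarrow> \<bar>h i k s\<bar> \<le> Ch * \<epsilon>" using h' by blast+
    \<comment> \<open>Moments still to be produced: those from the pivoting, less those which
      \<open>h\<close> already has. The last summand cancels the boundary terms that \<eta>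
      contributes to the area formula.\<close>
    define \<mu> where "\<mu> i j = l i j - integral {0..1} (\<lambda>s. h i 0 s * s ^ j) + \<eta> i 0 / real (Suc j) / 2" for i j
    \<comment> \<open>The remainder of the pivoting, less the area that the corrections
      \<open>h\<close> already sweep out.\<close>
    define \<sigma> where "\<sigma> q = sg (fst q) (snd q) - integral {0..1} (\<lambda>s. h (fst q) 0 s * h (snd q) 1 s - h (fst q) 1 s * h (snd q) 0 s) / 2" for q
    have \<mu>b: "\<bar>\<mu> i j\<bar> \<le> (C1 + Ch + 1) * \<epsilon>" if i: "i \<in> ?I" and j: "j < m" for i j
    proof -
      have "\<bar>integral {0..1} (\<lambda>s. h i 0 s * s ^ j)\<bar> \<le> Ch * \<epsilon>"
      proof (rule abs_integral_unit_le)
        show "continuous_on {0..1} (\<lambda>s. h i 0 s * s ^ j)" by (intro continuous_intros Cm_fam_cont[OF h(1)[OF i]]) simp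
        fix s :: real assume s: "s \<in> {0..1}"
        then have "\<bar>h i 0 s\<bar> * \<bar>s ^ j\<bar> \<le> (Ch * \<epsilon>) * 1"
          using h(4)[OF i _ s, of 0] by (intro mult_mono') (auto simp: power_le_one)
        then show "\<bar>h i 0 s * s ^ j\<bar> \<le> Ch * \<epsilon>" by (simp add: abs_mult)
      qed
      moreover have "\<bar>\<eta> i 0 / real (Suc j) / 2\<bar> \<le> \<epsilon>"
      proof -
        have "\<bar>\<eta> i 0 / real (Suc j) / 2\<bar> = \<bar>\<eta> i 0\<bar> / (real (Suc j) * 2)" by (simp add: abs_divide)
        also have "\<dots> \<le> \<bar>\<eta> i 0\<bar> / 1" by (intro divide_left_mono) auto
        finally show ?thesis using et[OF i, of 0] by simp
      qed
      ultimately show ?thesis using l[OF i j] unfolding \<mu>_def distrib_right by linarith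
    qed
    \<comment> \<open>Here \<epsilon> + sqrt \<epsilon> originates: the remaining area is at most C1
      \<epsilon> plus a quadratic term from \<open>h\<close>, and \<open>slot_area\<close> takes its
      root.\<close>
    have \<sigma>b: "sqrt \<bar>\<sigma> q\<bar> \<le> (sqrt C1 + Ch) * (\<epsilon> + sqrt \<epsilon>)" if q: "q \<in> P" for q
    proof -
      obtain i j where ij: "q = (i, j)" "i \<in> ?I" "j \<in> ?I" using q by (auto simp: P_def)
      have "\<bar>integral {0..1} (\<lambda>s. h i 0 s * h j 1 s - h i 1 s * h j 0 s)\<bar> \<le> 2 * (Ch * \<epsilon>)\<^sup>2"
      proof (rule abs_integral_unit_le)
        show "continuous_on {0..1} (\<lambda>s. h i 0 s * h j 1 s - h i 1 s * h j 0 s)"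
          using m by (intro continuous_intros Cm_fam_cont[OF h(1)[OF ij(2)]] Cm_fam_cont[OF h(1)[OF ij(3)]]) auto
        fix s :: real assume s: "s \<in> {0..1}"
        have hb: "\<bar>h i 0 s\<bar> \<le> Ch * \<epsilon>" "\<bar>h i 1 s\<bar> \<le> Ch * \<epsilon>" "\<bar>h j 0 s\<bar> \<le> Ch * \<epsilon>" "\<bar>h j 1 s\<bar> \<le> Ch * \<epsilon>"
          using h(4)[OF ij(2) _ s] h(4)[OF ij(3) _ s] m by auto
        have "\<bar>h i 0 s * h j 1 s\<bar> \<le> (Ch * \<epsilon>)\<^sup>2" "\<bar>h i 1 s * h j 0 s\<bar> \<le> (Ch * \<epsilon>)\<^sup>2"
          unfolding abs_mult power2_eq_square using hb by (auto intro!: mult_mono')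
        then show "\<bar>h i 0 s * h j 1 s - h i 1 s * h j 0 s\<bar> \<le> 2 * (Ch * \<epsilon>)\<^sup>2" by linarith
      qed
      then have "\<bar>\<sigma> q\<bar> \<le> C1 * \<epsilon> + (Ch * \<epsilon>)\<^sup>2" using sg[OF ij(2,3)] unfolding \<sigma>_def ij(1) by simp
      then have "sqrt \<bar>\<sigma> q\<bar> \<le> sqrt (C1 * \<epsilon> + (Ch * \<epsilon>)\<^sup>2)" by simp
      also have "\<dots> \<le> sqrt (C1 * \<epsilon>) + sqrt ((Ch * \<epsilon>)\<^sup>2)" using BC e by (intro sqrt_add_le_add_sqrt) auto
      also have "\<dots> = sqrt C1 * sqrt \<epsilon> + Ch * \<epsilon>" using Ch e by (simp add: real_sqrt_mult)
      also have "\<dots> \<le> (sqrt C1 + Ch) * (\<epsilon> + sqrt \<epsilon>)" using BC Ch e se by (simp add: algebra_simps)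
      finally show ?thesis .
    qed
    have "\<forall>i\<in>?I. \<exists>h. Lin (i, i) (\<mu> i) (CL (i, i) * ((C1 + Ch + 1) * \<epsilon>)) h"
      using BC Ch e \<mu>b by (auto intro!: CL2 simp: P_def)
    from bchoice[OF this] obtain \<psi> where \<psi>: "\<And>i. i \<in> ?I \<Longrightarrow> Lin (i, i) (\<mu> i) (CL (i, i) * ((C1 + Ch + 1) * \<epsilon>)) (\<psi> i)" by blast
    have "\<forall>q\<in>P. \<exists>fg. Ar q (\<sigma> q) (CA q * sqrt \<bar>\<sigma> q\<bar>) (fst fg) (snd fg)" using CA2 by (simp add: split_paired_Ex)
    from bchoice[OF this] obtain fg where fg: "\<And>q. q \<in> P \<Longrightarrow> Ar q (\<sigma> q) (CA q * sqrt \<bar>\<sigma> q\<bar>) (fst (fg q)) (snd (fg q))" by blast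
    define f where "f q = fst (fg q)" for q
    define g where "g q = snd (fg q)" for q
    have ar: "Ar q (\<sigma> q) (CA q * sqrt \<bar>\<sigma> q\<bar>) (f q) (g q)" if "q \<in> P" for q using fg[OF that] by (simp add: f_def g_def)
    \<comment> \<open>\<open>Y q i\<close> is what slot \<open>q\<close> contributes to index
      \<open>i\<close>. Area is placed only in slots (p1, p2) with p1 < p2; the opposite order
      follows by antisymmetry.\<close>
    define Y where "Y q i = (if fst q = snd q then (if i = fst q then \<psi> i else (\<lambda>k s. 0))
      else if fst q < snd q then (if i = fst q then f q else if i = snd q then g q else (\<lambda>k s. 0)) else (\<lambda>k s. 0))" for q i
    have Y: "Cm_fam m (Y q i) \<and> (\<forall>k\<le>m. \<forall>s. s \<notin> {c q<..<d q} \<longrightarrow> Y q i k s = 0) \<and>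
        (\<forall>k\<le>m. \<forall>s\<in>{0..1}. \<bar>Y q i k s\<bar> \<le> D * (\<epsilon> + sqrt \<epsilon>)) \<and>
        (\<forall>j<m. integral {0..1} (\<lambda>s. Y q i 0 s * s ^ j) = (if q = (i, i) then \<mu> i j else 0))" if q: "q \<in> P" for q i
    proof -
      have D1: "CL q * ((C1 + Ch + 1) * \<epsilon>) \<le> D * (\<epsilon> + sqrt \<epsilon>)"
      proof -
        have "CL q * ((C1 + Ch + 1) * \<epsilon>) \<le> CLs * ((C1 + Ch + 1) * (\<epsilon> + sqrt \<epsilon>))"
          using CLs(1)[OF q] CLs0 BC Ch e se by (intro mult_mono) auto
        also have "\<dots> = (CLs * (C1 + Ch + 1)) * (\<epsilon> + sqrt \<epsilon>)" by simp
        also have "\<dots> \<le> D * (\<epsilon> + sqrt \<epsilon>)" unfolding D_def using CLs0 BC Ch e se by (intro mult_right_mono) auto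
        finally show ?thesis .
      qed
      have D2: "CA q * sqrt \<bar>\<sigma> q\<bar> \<le> D * (\<epsilon> + sqrt \<epsilon>)"
      proof -
        have "CA q * sqrt \<bar>\<sigma> q\<bar> \<le> CAs * ((sqrt C1 + Ch) * (\<epsilon> + sqrt \<epsilon>))"
          using CLs(2)[OF q] CLs0 \<sigma>b[OF q] by (intro mult_mono) auto
        also have "\<dots> = (CAs * (sqrt C1 + Ch)) * (\<epsilon> + sqrt \<epsilon>)" by simp
        also have "\<dots> \<le> D * (\<epsilon> + sqrt \<epsilon>)" unfolding D_def using CLs0 BC Ch e se by (intro mult_right_mono) auto
        finally show ?thesis .
      qed
      have D3: "0 \<le> D * (\<epsilon> + sqrt \<epsilon>)" using D0 e se by simp
      obtain p1 p2 where pq: "q = (p1, p2)" by (cases q)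
      have p1: "p1 \<in> ?I" using q by (simp add: pq P_def)
      have "(Y q i = (\<lambda>k s. 0) \<and> q \<noteq> (i, i)) \<or> (q = (i, i) \<and> Y q i = \<psi> i \<and> i \<in> ?I) \<or> (Y q i = f q \<and> q \<noteq> (i, i)) \<or> (Y q i = g q \<and> q \<noteq> (i, i))"
        using p1 unfolding pq Y_def fst_conv snd_conv
        by (cases "p1 = p2"; cases "p1 < p2"; cases "i = p1"; cases "i = p2") simp_all
      then consider (z) "Y q i = (\<lambda>k s. 0)" "q \<noteq> (i, i)" | (p) "q = (i, i)" "Y q i = \<psi> i" "i \<in> ?I"
        | (f) "Y q i = f q" "q \<noteq> (i, i)" | (g) "Y q i = g q" "q \<noteq> (i, i)"
        by blast
      then show ?thesis
      proof cases
        case z then show ?thesis using D3 Cm_fam_zero by simp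
      next
        case p
        then have "Lin q (\<mu> i) (CL q * ((C1 + Ch + 1) * \<epsilon>)) (\<psi> i)" using \<psi> by simp
        from Lin_mono[OF this D1] show ?thesis unfolding Lin_def p(2) using p(1) by simp
      next
        case f
        from Ar_mono[OF ar[OF q] D2] show ?thesis unfolding Ar_def f(1) using f(2) by simp
      next
        case g
        from Ar_mono[OF ar[OF q] D2] show ?thesis unfolding Ar_def g(1) using g(2) by simp
      qed
    qed
    define X where "X i k s = h i k s + (\<Sum>q\<in>P. Y q i k s)" for i k s
    have XC: "Cm_fam m (X i)" if "i \<in> ?I" for i
    proof -
      have "Cm_fam m (\<lambda>k s. h i k s + (\<Sum>q\<in>P. Y q i k s))"
        by (rule Cm_fam_add[OF h(1)[OF that] Cm_fam_sum]) (use Y in simp)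
      moreover have "(\<lambda>k s. h i k s + (\<Sum>q\<in>P. Y q i k s)) = X i" by (intro ext) (simp add: X_def)
      ultimately show ?thesis by simp
    qed
    have Y0: "(\<Sum>q\<in>P. Y q i k s) = 0" if "k \<le> m" "s \<le> 0 \<or> s \<ge> 1/2" for i k s
    proof (rule sum.neutral, rule ballI)
      fix q assume q: "q \<in> P"
      have "s \<notin> {c q<..<d q}" using cd[OF q] that by auto
      then show "Y q i k s = 0" using Y[OF q] that by blast
    qed
    have Xb: "\<bar>X i k s\<bar> \<le> C * (\<epsilon> + sqrt \<epsilon>)" if i: "i \<in> ?I" and k: "k \<le> m" and s: "s \<in> {0..1}" for i k s
    proof -
      have "\<bar>X i k s\<bar> \<le> \<bar>h i k s\<bar> + \<bar>\<Sum>q\<in>P. Y q i k s\<bar>" unfolding X_def by (rule abs_triangle_ineq)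
      also have "\<bar>\<Sum>q\<in>P. Y q i k s\<bar> \<le> (\<Sum>q\<in>P. \<bar>Y q i k s\<bar>)" by (rule sum_abs)
      also have "\<dots> \<le> real (card P) * (D * (\<epsilon> + sqrt \<epsilon>))" by (rule sum_bounded_above) (use Y k s in blast)
      finally have "\<bar>X i k s\<bar> \<le> \<bar>h i k s\<bar> + real (card P) * (D * (\<epsilon> + sqrt \<epsilon>))" by simp
      moreover have "\<bar>h i k s\<bar> \<le> Ch * (\<epsilon> + sqrt \<epsilon>)"
        using h(4)[OF i k s] mult_left_mono[of \<epsilon> "\<epsilon> + sqrt \<epsilon>" Ch] Ch se by simp
      ultimately show ?thesis unfolding C_def distrib_right[of Ch] by (simp add: mult.assoc)
    qed
    have mom: "integral {0..1} (\<lambda>s. X i 0 s * s ^ j) = l i j + \<eta> i 0 / real (Suc j) / 2" if i: "i \<in> ?I" and j: "j < m" for i j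
    proof -
      have "integral {0..1} (\<lambda>s. X i 0 s * s ^ j) = integral {0..1} (\<lambda>s. h i 0 s * s ^ j + (\<Sum>q\<in>P. Y q i 0 s * s ^ j))"
        unfolding X_def by (simp add: distrib_right sum_distrib_right)
      also have "\<dots> = integral {0..1} (\<lambda>s. h i 0 s * s ^ j) + integral {0..1} (\<lambda>s. (\<Sum>q\<in>P. Y q i 0 s * s ^ j))"
        by (intro integral_add integrable_continuous_interval continuous_intros Cm_fam_cont[OF h(1)[OF i]] Cm_fam_cont[of m "Y _ i"]) (use Y in auto)
      also have "integral {0..1} (\<lambda>s. (\<Sum>q\<in>P. Y q i 0 s * s ^ j)) = (\<Sum>q\<in>P. integral {0..1} (\<lambda>s. Y q i 0 s * s ^ j))"
        by (intro integral_sum fP integrable_continuous_interval continuous_intros Cm_fam_cont[of m "Y _ i"]) (use Y in auto)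
      also have "\<dots> = (\<Sum>q\<in>P. if q = (i, i) then \<mu> i j else 0)" by (rule sum.cong) (use Y j in auto)
      also have "\<dots> = \<mu> i j" using fP i by (simp add: P_def)
      finally show ?thesis by (simp add: \<mu>_def)
    qed
    \<comment> \<open>No cross terms: at each s at most one slot is active and \<open>h\<close>
      vanishes on the slots. Two different indices i < j are both nonzero only in the slot (i,
      j).\<close>
    have prod: "X i k s * X j k' s = h i k s * h j k' s + f (i, j) k s * g (i, j) k' s"
      if i: "i \<in> ?I" and j: "j \<in> ?I" and ij: "i < j" and k: "k \<le> m" "k' \<le> m" for i j k k' s
    proof -
      have qP: "(i, j) \<in> P" using i j by (simp add: P_def)
      have f0: "f (i, j) k s = 0" if "s \<notin> {c (i, j)<..<d (i, j)}" using ar[OF qP] that k unfolding Ar_def by blast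
      show ?thesis
      proof (cases "\<exists>q\<in>P. s \<in> {c q<..<d q}")
        case True
        then obtain q where q: "q \<in> P" "s \<in> {c q<..<d q}" by blast
        then have "s \<le> 1/2" using cd(3)[OF q(1)] by auto
        then have h0: "h i k s = 0" using h(2) i k by simp
        have only: "(\<Sum>q'\<in>P. Y q' i k s) = Y q i k s" if "k \<le> m" for i k
        proof -
          have "(\<Sum>q'\<in>P. Y q' i k s) = (\<Sum>q'\<in>P. if q' = q then Y q i k s else 0)"
          proof (rule sum.cong[OF refl])
            fix q' assume q': "q' \<in> P"
            show "Y q' i k s = (if q' = q then Y q i k s else 0)"
            proof (cases "q' = q")
              case False
              then have "s \<notin> {c q'<..<d q'}" using disj[OF q(1) q'] q(2) by blast
              then show ?thesis using False Y[OF q'] that by simp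
            qed simp
          qed
          then show ?thesis using fP q by simp
        qed
        have X: "X i k s * X j k' s = Y q i k s * Y q j k' s"
        proof -
          have "h j k' s = 0" using h(2) j k \<open>s \<le> 1/2\<close> by simp
          then show ?thesis using h0 only k by (simp add: X_def)
        qed
        show ?thesis
        proof (cases "q = (i, j)")
          case True
          then show ?thesis using X h0 ij by (simp add: Y_def)
        next
          case False
          then have "s \<notin> {c (i, j)<..<d (i, j)}" using disj[OF q(1) qP] q(2) by blast
          moreover have "Y q i k s * Y q j k' s = 0" using False ij by (cases q) (auto simp: Y_def)
          ultimately show ?thesis using X h0 f0 by simp
        qed
      next
        case False
        then have "(\<Sum>q\<in>P. Y q i k s) = 0" "(\<Sum>q\<in>P. Y q j k' s) = 0" using Y k by (auto intro!: sum.neutral)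
        moreover have "f (i, j) k s = 0" using f0 False qP by blast
        ultimately show ?thesis by (simp add: X_def)
      qed
    qed
    \<comment> \<open>The right-hand side of \<open>area_difference\<close> on the unit interval:
      increments of the Taylor polynomials against the end values, velocities against moments, and
      the area of the perturbations themselves.\<close>
    define R where "R i j = ((\<Sum>d<m. \<kappa> i d / real (Suc d)) * \<eta> j 0 - (\<Sum>d<m. \<kappa> j d / real (Suc d)) * \<eta> i 0) / 2
           + (\<Sum>d<m. \<kappa> j d * integral {0..1} (\<lambda>s. X i 0 s * s ^ d) - \<kappa> i d * integral {0..1} (\<lambda>s. X j 0 s * s ^ d))
           + integral {0..1} (\<lambda>s. X i 0 s * X j 1 s - X i 1 s * X j 0 s) / 2" for i j
    have Ranti: "R i j = - R j i" for i j
    proof -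
      have "(\<lambda>s. X i 0 s * X j 1 s - X i 1 s * X j 0 s) = (\<lambda>s. - (X j 0 s * X i 1 s - X j 1 s * X i 0 s))" by (simp add: algebra_simps)
      then have "integral {0..1} (\<lambda>s. X i 0 s * X j 1 s - X i 1 s * X j 0 s) = - integral {0..1} (\<lambda>s. X j 0 s * X i 1 s - X j 1 s * X i 0 s)"
        by (simp only: integral_neg)
      then show ?thesis unfolding R_def sum_subtractf by (simp add: field_simps)
    qed
    have lt: "a i j = R i j" if i: "i \<in> ?I" and j: "j \<in> ?I" and ij: "i < j" for i j
    proof -
      have qP: "(i, j) \<in> P" using i j by (simp add: P_def)
      have pw: "X i 0 s * X j 1 s - X i 1 s * X j 0 s =
         (h i 0 s * h j 1 s - h i 1 s * h j 0 s) + (f (i, j) 0 s * g (i, j) 1 s - f (i, j) 1 s * g (i, j) 0 s)" for s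
        using prod[OF i j ij, of 0 1 s] prod[OF i j ij, of 1 0 s] m by simp
      have Cfg: "Cm_fam m (f (i, j))" "Cm_fam m (g (i, j))" using ar[OF qP] unfolding Ar_def by blast+
      have "integral {0..1} (\<lambda>s. X i 0 s * X j 1 s - X i 1 s * X j 0 s)
          = integral {0..1} (\<lambda>s. (h i 0 s * h j 1 s - h i 1 s * h j 0 s) + (f (i, j) 0 s * g (i, j) 1 s - f (i, j) 1 s * g (i, j) 0 s))"
        by (simp only: pw)
      also have "\<dots> = integral {0..1} (\<lambda>s. h i 0 s * h j 1 s - h i 1 s * h j 0 s) + integral {0..1} (\<lambda>s. f (i, j) 0 s * g (i, j) 1 s - f (i, j) 1 s * g (i, j) 0 s)"
        using m by (intro integral_add integrable_continuous_interval continuous_intros Cm_fam_cont[OF h(1)[OF i]] Cm_fam_cont[OF h(1)[OF j]] Cm_fam_cont[OF Cfg(1)] Cm_fam_cont[OF Cfg(2)]) auto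
      also have "integral {0..1} (\<lambda>s. f (i, j) 0 s * g (i, j) 1 s - f (i, j) 1 s * g (i, j) 0 s) = 2 * \<sigma> (i, j)"
        using ar[OF qP] unfolding Ar_def by blast
      finally have A: "integral {0..1} (\<lambda>s. X i 0 s * X j 1 s - X i 1 s * X j 0 s) / 2 = sg i j" by (simp add: \<sigma>_def)
      have "(\<Sum>d<m. \<kappa> j d * integral {0..1} (\<lambda>s. X i 0 s * s ^ d) - \<kappa> i d * integral {0..1} (\<lambda>s. X j 0 s * s ^ d))
          = (\<Sum>d<m. (l i d * \<kappa> j d - l j d * \<kappa> i d) + (\<kappa> j d / real (Suc d) * \<eta> i 0 / 2 - \<kappa> i d / real (Suc d) * \<eta> j 0 / 2))"
      proof (rule sum.cong[OF refl])
        fix d assume "d \<in> {..<m}"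
        then have d: "d < m" by simp
        show "\<kappa> j d * integral {0..1} (\<lambda>s. X i 0 s * s ^ d) - \<kappa> i d * integral {0..1} (\<lambda>s. X j 0 s * s ^ d)
          = (l i d * \<kappa> j d - l j d * \<kappa> i d) + (\<kappa> j d / real (Suc d) * \<eta> i 0 / 2 - \<kappa> i d / real (Suc d) * \<eta> j 0 / 2)"
          unfolding mom[OF i d] mom[OF j d] by (simp add: algebra_simps del: of_nat_Suc)
      qed
      also have "\<dots> = (\<Sum>d<m. l i d * \<kappa> j d) - (\<Sum>d<m. l j d * \<kappa> i d) + ((\<Sum>d<m. \<kappa> j d / real (Suc d)) * \<eta> i 0 / 2 - (\<Sum>d<m. \<kappa> i d / real (Suc d)) * \<eta> j 0 / 2)"
        by (simp add: sum.distrib sum_subtractf sum_distrib_right sum_divide_distrib)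
      finally show ?thesis unfolding R_def A lsa[OF i j] by (simp add: field_simps)
    qed
    have eq: "a i j = R i j" if i: "i \<in> ?I" and j: "j \<in> ?I" for i j
    proof -
      have aa: "a i j = - a j i" using alt i j by (simp add: eq_neg_iff_add_eq_0)
      consider "i < j" | "j < i" | "i = j" by linarith
      then show ?thesis
      proof cases
        case 1 then show ?thesis using lt i j by simp
      next
        case 2 then show ?thesis using lt[OF j i] aa Ranti[of i j] by simp
      next
        case 3 then show ?thesis using aa Ranti[of i i] by simp
      qed
    qed
    show "\<exists>X. \<forall>i\<in>?I. Cm_fam m (X i) \<and> (\<forall>k\<le>m. X i k 0 = 0 \<and> X i k 1 = \<eta> i k) \<and>
        (\<forall>k\<le>m. \<forall>s\<in>{0..1}. \<bar>X i k s\<bar> \<le> C * (\<epsilon> + sqrt \<epsilon>)) \<and>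
        (\<forall>j\<in>?I. a i j =
           ((\<Sum>d<m. \<kappa> i d / real (Suc d)) * \<eta> j 0 - (\<Sum>d<m. \<kappa> j d / real (Suc d)) * \<eta> i 0) / 2
           + (\<Sum>d<m. \<kappa> j d * integral {0..1} (\<lambda>s. X i 0 s * s ^ d) - \<kappa> i d * integral {0..1} (\<lambda>s. X j 0 s * s ^ d))
           + integral {0..1} (\<lambda>s. X i 0 s * X j 1 s - X i 1 s * X j 0 s) / 2)"
    proof (rule exI[of _ X], intro ballI conjI allI impI)
      fix i assume i: "i \<in> ?I"
      show "Cm_fam m (X i)" by (rule XC[OF i])
      show "X i k 0 = 0" if "k \<le> m" for k using h(2)[OF i that, of 0] Y0[OF that, of 0] by (simp add: X_def)
      show "X i k 1 = \<eta> i k" if "k \<le> m" for k using h(3)[OF i that] Y0[OF that, of 1] by (simp add: X_def)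
      show "\<bar>X i k s\<bar> \<le> C * (\<epsilon> + sqrt \<epsilon>)" if "k \<le> m" "s \<in> {0..1}" for k s by (rule Xb[OF i that])
      show "a i j =
           ((\<Sum>d<m. \<kappa> i d / real (Suc d)) * \<eta> j 0 - (\<Sum>d<m. \<kappa> j d / real (Suc d)) * \<eta> i 0) / 2
           + (\<Sum>d<m. \<kappa> j d * integral {0..1} (\<lambda>s. X i 0 s * s ^ d) - \<kappa> i d * integral {0..1} (\<lambda>s. X j 0 s * s ^ d))
           + integral {0..1} (\<lambda>s. X i 0 s * X j 1 s - X i 1 s * X j 0 s) / 2"
        if "j \<in> ?I" for j by (rule eq[OF i that, unfolded R_def])
    qed
  qed
qed

section \<open>The area terms as an alternating bilinear form\<close>

text \<open>With \<^term>\<open>alt_ext G\<close> in place of \<^term>\<open>G\<close>, the area terms are defined and alternating for all index pairs.\<close>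

definition alt_ext :: "(nat \<Rightarrow> nat \<Rightarrow> nat \<Rightarrow> real \<Rightarrow> real) \<Rightarrow> nat \<Rightarrow> nat \<Rightarrow> nat \<Rightarrow> real \<Rightarrow> real" where
  "alt_ext G i j k t = (if j < i then G i j k t else if i < j then - G j i k t else 0)"

lemma LBINT_eq_integral:
  fixes f :: "real \<Rightarrow> real"
  assumes "a \<le> b" "continuous_on {a..b} f"
  shows "(LBINT x=a..b. f x) = integral {a..b} f"
  by (rule interval_integral_eq_integral[OF assms(1)]) (rule borel_integrable_atLeastAtMost'[OF assms(2)])

lemma area_term_eq:
  assumes m: "1 \<le> m" and ab: "a \<le> b"
  shows "area_term m F G i j a b = G i j 0 b - G i j 0 a
     - 1/2 * integral {a..b} (\<lambda>x. tay m (F i) a 0 x * tay m (F j) a 1 x - tay m (F i) a 1 x * tay m (F j) a 0 x)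
     + 1/2 * F j 0 a * (F i 0 b - tay m (F i) a 0 b) - 1/2 * F i 0 a * (F j 0 b - tay m (F j) a 0 b)"
proof -
  have "continuous_on {a..b} (\<lambda>x. tay m (F i) a 0 x * tay m (F j) a 1 x - tay m (F i) a 1 x * tay m (F j) a 0 x)"
    by (intro continuous_intros Cm_fam_cont[OF Cm_fam_tay]) (use m in auto)
  from LBINT_eq_integral[OF ab this] show ?thesis
    unfolding area_term_def deriv_taylor[OF m] unfolding taylor_tay by simp
qed

lemma area_term_alt_ext:
  assumes "1 \<le> m" "a \<le> b"
  shows "area_term m F (alt_ext G) i j a b + area_term m F (alt_ext G) j i a b = 0"
proof -
  have "(\<lambda>x. tay m (F i) a 0 x * tay m (F j) a 1 x - tay m (F i) a 1 x * tay m (F j) a 0 x)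
      = (\<lambda>x. - (tay m (F j) a 0 x * tay m (F i) a 1 x - tay m (F j) a 1 x * tay m (F i) a 0 x))"
    by (simp add: algebra_simps)
  then have "integral {a..b} (\<lambda>x. tay m (F i) a 0 x * tay m (F j) a 1 x - tay m (F i) a 1 x * tay m (F j) a 0 x)
     = - integral {a..b} (\<lambda>x. tay m (F j) a 0 x * tay m (F i) a 1 x - tay m (F j) a 1 x * tay m (F i) a 0 x)"
    by (simp only: integral_neg)
  then show ?thesis unfolding area_term_eq[OF assms] alt_ext_def by (simp add: algebra_simps)
qed

lemma area_term_alt_ext_eq: "j < i \<Longrightarrow> area_term m F (alt_ext G) i j a b = area_term m F G i j a b"
  by (simp add: area_term_def alt_ext_def)

lemma rest_idx:
  assumes "1 \<le> j" "j < i" "i \<le> r"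
  shows "finite (rest_idx r i j)" "{1..r} = insert i (insert j (rest_idx r i j))" "i \<notin> rest_idx r i j" "j \<notin> rest_idx r i j"
  using assms by (auto simp: rest_idx_def)

text \<open>Merging (p, q) with (q, p) produces the last sum of \<open>gen_area\<close>, with 2 by 2
  minors of x and y as coefficients.\<close>

lemma sum_alternating:
  fixes A :: "nat \<Rightarrow> nat \<Rightarrow> real"
  assumes "finite S" "\<And>p q. A p q + A q p = 0"
  shows "(\<Sum>p\<in>S. \<Sum>q\<in>S. x p * y q * A p q)
     = (\<Sum>(k, n)\<in>{(k, n). k \<in> S \<and> n \<in> S \<and> k > n}. (y n * x k - x n * y k) * A k n)"
proof -
  let ?D = "{(k, n). k \<in> S \<and> n \<in> S \<and> k > n}" and ?E = "{(k, n). k \<in> S \<and> n \<in> S \<and> k < n}" and ?Z = "{(k, n). k \<in> S \<and> n \<in> S \<and> k = n}"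
  have f: "finite (S \<times> S)" using assms by simp
  have A: "A q p = - A p q" for p q using assms(2)[of p q] by linarith
  have A0: "A p p = 0" for p using assms(2)[of p p] by simp
  have sub: "?D \<subseteq> S \<times> S" "?E \<subseteq> S \<times> S" "?Z \<subseteq> S \<times> S" by auto
  have fD: "finite ?D" "finite ?E" "finite ?Z" using f sub finite_subset by blast+
  have "(\<Sum>p\<in>S. \<Sum>q\<in>S. x p * y q * A p q) = (\<Sum>(k, n)\<in>S \<times> S. x k * y n * A k n)"
    by (simp add: sum.cartesian_product)
  also have "S \<times> S = ?D \<union> (?E \<union> ?Z)" by auto
  also have "(\<Sum>(k, n)\<in>?D \<union> (?E \<union> ?Z). x k * y n * A k n) = (\<Sum>(k, n)\<in>?D. x k * y n * A k n) + ((\<Sum>(k, n)\<in>?E. x k * y n * A k n) + (\<Sum>(k, n)\<in>?Z. x k * y n * A k n))"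
    using fD by (subst sum.union_disjoint, simp, simp, force, subst sum.union_disjoint) auto
  also have "(\<Sum>(k, n)\<in>?Z. x k * y n * A k n) = 0" by (rule sum.neutral) (auto simp: A0)
  also have "(\<Sum>(k, n)\<in>?E. x k * y n * A k n) = (\<Sum>(k, n)\<in>?D. x n * y k * A n k)"
    by (rule sum.reindex_bij_witness[of _ prod.swap prod.swap]) auto
  also have "(\<Sum>(k, n)\<in>?D. x k * y n * A k n) + ((\<Sum>(k, n)\<in>?D. x n * y k * A n k) + 0)
      = (\<Sum>(k, n)\<in>?D. x k * y n * A k n + x n * y k * A n k)"
    by (simp add: sum.distrib[symmetric] case_prod_beta)
  also have "\<dots> = (\<Sum>(k, n)\<in>?D. (y n * x k - x n * y k) * A k n)"
  proof (rule sum.cong[OF refl], clarify)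
    fix k n
    show "x k * y n * A k n + x n * y k * A n k = (y n * x k - x n * y k) * A k n"
      unfolding A[of n k] by (simp add: algebra_simps)
  qed
  finally show ?thesis .
qed

text \<open>The vector \<open>e\<^sub>i - (\<Sum>k\<in>S. c k e\<^sub>k)\<close>, as long as \<open>p\<close> ranges over \<open>{1..r}\<close> and \<open>S = {1..r} - {i, j}\<close>.\<close>

definition first_vec :: "nat \<Rightarrow> nat \<Rightarrow> (nat \<Rightarrow> real) \<Rightarrow> nat \<Rightarrow> real" where
  "first_vec i j c p = (if p = i then 1 else if p = j then 0 else - c p)"

lemma sum_first_vec:
  assumes "1 \<le> j" "j < i" "i \<le> r"
  shows "(\<Sum>p\<in>{1..r}. first_vec i j c p * x p) = x i - (\<Sum>p\<in>rest_idx r i j. c p * x p)"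
    and "(\<Sum>p\<in>{1..r}. first_vec j i c p * x p) = x j - (\<Sum>p\<in>rest_idx r i j. c p * x p)"
proof -
  note R = rest_idx[OF assms]
  have "(\<Sum>p\<in>rest_idx r i j. first_vec i j c p * x p) = (\<Sum>p\<in>rest_idx r i j. - (c p * x p))"
    "(\<Sum>p\<in>rest_idx r i j. first_vec j i c p * x p) = (\<Sum>p\<in>rest_idx r i j. - (c p * x p))"
    using R by (auto intro!: sum.cong simp: first_vec_def)
  then show "(\<Sum>p\<in>{1..r}. first_vec i j c p * x p) = x i - (\<Sum>p\<in>rest_idx r i j. c p * x p)"
    "(\<Sum>p\<in>{1..r}. first_vec j i c p * x p) = x j - (\<Sum>p\<in>rest_idx r i j. c p * x p)"
    using R assms by (simp_all add: first_vec_def sum_negf)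
qed

lemma gen_area_bilinear:
  assumes m: "1 \<le> m" and ab: "a \<le> b" and ij: "1 \<le> j" "j < i" "i \<le> r"
  shows "gen_area m r F G i j a b c c' =
     (\<Sum>p\<in>{1..r}. \<Sum>q\<in>{1..r}. first_vec i j c' p * first_vec j i c q * area_term m F (alt_ext G) p q a b)"
proof -
  define A where "A p q = area_term m F (alt_ext G) p q a b" for p q
  let ?S = "rest_idx r i j"
  note R = rest_idx[OF ij]
  have anti: "A p q + A q p = 0" for p q unfolding A_def by (rule area_term_alt_ext[OF m ab])
  have anti': "A p q = - A q p" for p q using anti[of p q] by linarith
  have AG: "area_term m F G p q a b = A p q" if "q < p" for p q using that by (simp add: A_def area_term_alt_ext_eq)
  have "(\<Sum>p\<in>{1..r}. \<Sum>q\<in>{1..r}. first_vec i j c' p * first_vec j i c q * A p q)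
      = (\<Sum>p\<in>{1..r}. first_vec i j c' p * (\<Sum>q\<in>{1..r}. first_vec j i c q * A p q))"
    by (simp add: sum_distrib_left mult.assoc)
  also have "\<dots> = (\<Sum>p\<in>{1..r}. first_vec i j c' p * (A p j - (\<Sum>q\<in>?S. c q * A p q)))"
    unfolding sum_first_vec(2)[OF ij] ..
  also have "\<dots> = (A i j - (\<Sum>q\<in>?S. c q * A i q)) - (\<Sum>p\<in>?S. c' p * (A p j - (\<Sum>q\<in>?S. c q * A p q)))"
    unfolding sum_first_vec(1)[OF ij] ..
  also have "(\<Sum>p\<in>?S. c' p * (A p j - (\<Sum>q\<in>?S. c q * A p q))) = (\<Sum>p\<in>?S. c' p * A p j) - (\<Sum>p\<in>?S. \<Sum>q\<in>?S. c' p * c q * A p q)"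
    by (simp add: right_diff_distrib sum_subtractf sum_distrib_left mult.assoc)
  also have "(\<Sum>p\<in>?S. \<Sum>q\<in>?S. c' p * c q * A p q) = (\<Sum>(k, n)\<in>{(k, n). k \<in> ?S \<and> n \<in> ?S \<and> k > n}. (c n * c' k - c' n * c k) * A k n)"
    by (rule sum_alternating[OF R(1) anti])
  \<comment> \<open>\<open>gen_area\<close> uses area terms with decreasing indices only, so
    \<open>S\<close> is split at \<open>i\<close> and the terms beyond it change sign.\<close>
  also have "(\<Sum>q\<in>?S. c q * A i q) = (\<Sum>k\<in>{1..<i} - {j}. c k * A i k) - (\<Sum>k\<in>{i<..r}. c k * A k i)"
  proof -
    have "?S = ({1..<i} - {j}) \<union> {i<..r}" using ij by (auto simp: rest_idx_def)
    moreover have "({1..<i} - {j}) \<inter> {i<..r} = {}" by auto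
    ultimately have "(\<Sum>q\<in>?S. c q * A i q) = (\<Sum>k\<in>{1..<i} - {j}. c k * A i k) + (\<Sum>k\<in>{i<..r}. c k * A i k)"
      by (simp add: sum.union_disjoint)
    also have "(\<Sum>k\<in>{i<..r}. c k * A i k) = (\<Sum>k\<in>{i<..r}. - (c k * A k i))"
      by (rule sum.cong[OF refl]) (subst anti', simp)
    finally show ?thesis by (simp add: sum_negf)
  qed
  also have "(\<Sum>p\<in>?S. c' p * A p j) = - (\<Sum>k\<in>{1..<j}. c' k * A j k) + (\<Sum>k\<in>{j<..r} - {i}. c' k * A k j)"
  proof -
    have "?S = {1..<j} \<union> ({j<..r} - {i})" using ij by (auto simp: rest_idx_def)
    moreover have "{1..<j} \<inter> ({j<..r} - {i}) = {}" by auto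
    ultimately have "(\<Sum>p\<in>?S. c' p * A p j) = (\<Sum>k\<in>{1..<j}. c' k * A k j) + (\<Sum>k\<in>{j<..r} - {i}. c' k * A k j)"
      by (simp add: sum.union_disjoint)
    also have "(\<Sum>k\<in>{1..<j}. c' k * A k j) = (\<Sum>k\<in>{1..<j}. - (c' k * A j k))"
      by (rule sum.cong[OF refl]) (subst anti', simp)
    finally show ?thesis by (simp add: sum_negf)
  qed
  finally have E: "(\<Sum>p\<in>{1..r}. \<Sum>q\<in>{1..r}. first_vec i j c' p * first_vec j i c q * A p q) =
     A i j + (\<Sum>k\<in>{1..<j}. c' k * A j k) - (\<Sum>k\<in>{j<..r} - {i}. c' k * A k j)
     - (\<Sum>k\<in>{1..<i} - {j}. c k * A i k) + (\<Sum>k\<in>{i<..r}. c k * A k i)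
     + (\<Sum>(k, n)\<in>{(k, n). k \<in> ?S \<and> n \<in> ?S \<and> k > n}. (c n * c' k - c' n * c k) * A k n)" by simp
  have "gen_area m r F G i j a b c c' = A i j + (\<Sum>k\<in>{1..<j}. c' k * A j k) - (\<Sum>k\<in>{j<..r} - {i}. c' k * A k j)
     - (\<Sum>k\<in>{1..<i} - {j}. c k * A i k) + (\<Sum>k\<in>{i<..r}. c k * A k i)
     + (\<Sum>(k, n)\<in>{(k, n). k \<in> ?S \<and> n \<in> ?S \<and> k > n}. (c n * c' k - c' n * c k) * A k n)"
    unfolding gen_area_def
    by (intro arg_cong2[where f = "(+)"] arg_cong2[where f = "(-)"] sum.cong refl) (use ij in \<open>auto simp: AG\<close>)
  then show ?thesis using E by (simp add: A_def)
qed

lemma velocity_term_eq: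
  assumes m: "1 \<le> m" and ab: "a \<le> b" and ij: "1 \<le> j" "j < i" "i \<le> r"
  shows "velocity_term m F (rest_idx r i j) i a b c = integral {a..b} (\<lambda>x. \<bar>\<Sum>p\<in>{1..r}. first_vec i j c p * tay m (F p) a 1 x\<bar>)"
    and "velocity_term m F (rest_idx r i j) j a b c = integral {a..b} (\<lambda>x. \<bar>\<Sum>p\<in>{1..r}. first_vec j i c p * tay m (F p) a 1 x\<bar>)"
proof -
  have "velocity_term m F S p a b c = integral {a..b} (\<lambda>x. \<bar>tay m (F p) a 1 x - (\<Sum>k\<in>S. c k * tay m (F k) a 1 x)\<bar>)" for S p
    unfolding velocity_term_def deriv_taylor[OF m]
    by (intro LBINT_eq_integral[OF ab] continuous_intros Cm_fam_cont[OF Cm_fam_tay] m)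
  then show "velocity_term m F (rest_idx r i j) i a b c = integral {a..b} (\<lambda>x. \<bar>\<Sum>p\<in>{1..r}. first_vec i j c p * tay m (F p) a 1 x\<bar>)"
    "velocity_term m F (rest_idx r i j) j a b c = integral {a..b} (\<lambda>x. \<bar>\<Sum>p\<in>{1..r}. first_vec j i c p * tay m (F p) a 1 x\<bar>)"
    unfolding sum_first_vec[OF ij] by auto
qed

lemma Cm_fam_FTC:
  assumes "Cm_fam m f" "Cm_fam m g" "1 \<le> m" "a \<le> b"
  shows "integral {a..b} (\<lambda>x. f 0 x * g 1 x + f 1 x * g 0 x) = f 0 b * g 0 b - f 0 a * g 0 a"
proof (rule integral_unique, rule fundamental_theorem_of_calculus[OF assms(4)])
  fix x
  have "((\<lambda>x. f 0 x * g 0 x) has_real_derivative f 0 x * g 1 x + f 1 x * g 0 x) (at x)"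
    using DERIV_mult[OF Cm_famD[OF assms(1), of 0 x] Cm_famD[OF assms(2), of 0 x]] assms(3) by (simp add: algebra_simps)
  then show "((\<lambda>x. f 0 x * g 0 x) has_vector_derivative f 0 x * g 1 x + f 1 x * g 0 x) (at x within {a..b})"
    unfolding has_real_derivative_iff_has_vector_derivative[symmetric] by (rule has_field_derivative_at_within)
qed

text \<open>Only \<open>h = f - T\<close> and \<open>k = g - S\<close> enter the right-hand side undifferentiated against the velocities of
  \<open>T\<close> and \<open>S\<close>, which is what makes the quantities \<open>\<Delta>\<^sub>i\<close> and \<open>\<Delta>\<^sub>j\<close> appear.\<close>

lemma area_difference:
  fixes f g T S :: "nat \<Rightarrow> real \<Rightarrow> real"
  assumes C: "Cm_fam m f" "Cm_fam m g" "Cm_fam m T" "Cm_fam m S" and m: "1 \<le> m" and ab: "a \<le> b"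
    and fa: "f 0 a = T 0 a" and ga: "g 0 a = S 0 a"
  shows "1/2 * integral {a..b} (\<lambda>x. f 0 x * g 1 x - f 1 x * g 0 x) - 1/2 * integral {a..b} (\<lambda>x. T 0 x * S 1 x - T 1 x * S 0 x)
      + 1/2 * S 0 a * (f 0 b - T 0 b) - 1/2 * T 0 a * (g 0 b - S 0 b)
    = 1/2 * ((T 0 b - T 0 a) * (g 0 b - S 0 b) - (S 0 b - S 0 a) * (f 0 b - T 0 b))
      + integral {a..b} (\<lambda>x. (f 0 x - T 0 x) * S 1 x - T 1 x * (g 0 x - S 0 x))
      + 1/2 * integral {a..b} (\<lambda>x. (f 0 x - T 0 x) * (g 1 x - S 1 x) - (f 1 x - T 1 x) * (g 0 x - S 0 x))"
proof -
  define h where "h k x = f k x - T k x" for k x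
  define l where "l k x = g k x - S k x" for k x
  have Ch: "Cm_fam m h" using Cm_fam_add[OF C(1) Cm_fam_cmult[OF C(3), of "-1"]] by (simp add: h_def[abs_def])
  have Cl: "Cm_fam m l" using Cm_fam_add[OF C(2) Cm_fam_cmult[OF C(4), of "-1"]] by (simp add: l_def[abs_def])
  have int: "(\<lambda>x. D k x * E k' x) integrable_on {a..b}" if "Cm_fam m D" "Cm_fam m E" "k \<le> m" "k' \<le> m" for D E k k'
    by (intro integrable_continuous_interval continuous_intros Cm_fam_cont[OF that(1)] Cm_fam_cont[OF that(2)] that)
  define J where "J D k E k' = integral {a..b} (\<lambda>x. D k x * E k' x)" for D E :: "nat \<Rightarrow> real \<Rightarrow> real" and k k'
  have dif: "integral {a..b} (\<lambda>x. D 0 x * E 1 x - D' 1 x * E' 0 x) = J D 0 E 1 - J D' 1 E' 0"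
    if "Cm_fam m D" "Cm_fam m E" "Cm_fam m D'" "Cm_fam m E'" for D E D' E'
    unfolding J_def using that m by (intro integral_diff int) auto
  have Jadd: "J D k (\<lambda>k x. E k x + E' k x) k' = J D k E k' + J D k E' k'" "J (\<lambda>k x. E k x + E' k x) k D k' = J E k D k' + J E' k D k'"
    if "Cm_fam m D" "Cm_fam m E" "Cm_fam m E'" "k \<le> m" "k' \<le> m" for D E E' k k'
    unfolding J_def distrib_left distrib_right using that by (intro integral_add int; simp)+
  have FTC: "J D 0 E 1 + J D 1 E 0 = D 0 b * E 0 b - D 0 a * E 0 a" if "Cm_fam m D" "Cm_fam m E" for D E
    unfolding Cm_fam_FTC[OF that m ab, symmetric] J_def using m that by (subst integral_add) (auto intro!: int)
  have f: "f = (\<lambda>k x. T k x + h k x)" and g: "g = (\<lambda>k x. S k x + l k x)" by (auto simp: h_def l_def)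
  have fg: "J f 0 g 1 = J T 0 S 1 + J T 0 l 1 + (J h 0 S 1 + J h 0 l 1)" "J f 1 g 0 = J T 1 S 0 + J T 1 l 0 + (J h 1 S 0 + J h 1 l 0)"
    unfolding f g using m C Ch Cl by (simp_all add: Jadd Cm_fam_add)
  have z: "h 0 a = 0" "l 0 a = 0" using fa ga by (auto simp: h_def l_def)
  \<comment> \<open>As \<open>h\<close> and \<open>l\<close> vanish at \<open>a\<close>, integration
    by parts leaves boundary terms at \<open>b\<close> only. With the two explicit terms on the left
    they form the increments of T and S.\<close>
  have P1: "J T 0 l 1 + J T 1 l 0 = T 0 b * l 0 b" using FTC[OF C(3) Cl] z by simp
  have P2: "J h 0 S 1 + J h 1 S 0 = h 0 b * S 0 b" using FTC[OF Ch C(4)] z by simp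
  have r1: "integral {a..b} (\<lambda>x. h 0 x * S 1 x - T 1 x * l 0 x) = J h 0 S 1 - J T 1 l 0" by (rule dif) fact+
  have r2: "integral {a..b} (\<lambda>x. h 0 x * l 1 x - h 1 x * l 0 x) = J h 0 l 1 - J h 1 l 0" by (rule dif) fact+
  have l1: "integral {a..b} (\<lambda>x. f 0 x * g 1 x - f 1 x * g 0 x) = J f 0 g 1 - J f 1 g 0" by (rule dif) fact+
  have l2: "integral {a..b} (\<lambda>x. T 0 x * S 1 x - T 1 x * S 0 x) = J T 0 S 1 - J T 1 S 0" by (rule dif) fact+
  show ?thesis
    unfolding h_def[symmetric] l_def[symmetric] l1 l2 r1 r2 fg
    using P1 P2 by (simp add: algebra_simps)
qed

section \<open>Extension over a single gap\<close>

text \<open>All that the construction on one gap asks for, with a single constant: Whitney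
  remainders of the horizontal jets and the A/V bound for coefficients in [-B, B]. The inequalities
  are kept weak and free of division so that a least \<epsilon> exists.\<close>

definition gap_ok :: "nat \<Rightarrow> nat \<Rightarrow> real \<Rightarrow> (nat \<Rightarrow> nat \<Rightarrow> real \<Rightarrow> real) \<Rightarrow> (nat \<Rightarrow> nat \<Rightarrow> nat \<Rightarrow> real \<Rightarrow> real)
    \<Rightarrow> real \<Rightarrow> real \<Rightarrow> real \<Rightarrow> bool" where
  "gap_ok m r B F G a b \<epsilon> \<longleftrightarrow>
     (\<forall>i\<in>{1..r}. \<forall>k\<le>m. \<bar>F i k b - tay m (F i) a k b\<bar> \<le> \<epsilon> * (b - a) ^ (m - k)) \<and>
     (\<forall>i j. 1 \<le> j \<and> j < i \<and> i \<le> r \<longrightarrow> (\<forall>c c'. (\<forall>k. \<bar>c k\<bar> \<le> B \<and> \<bar>c' k\<bar> \<le> B) \<longrightarrow>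
        \<bar>gen_area m r F G i j a b c c'\<bar> \<le> \<epsilon> * ((b - a) ^ (2 * m) + (b - a) ^ m *
          (velocity_term m F (rest_idx r i j) i a b c' + velocity_term m F (rest_idx r i j) j a b c))))"

text \<open>The A/V bound only weakens when \<Delta> grows, so \<Delta> may be replaced by the sum
  of the absolute values of the rescaled coefficients. The weights of \<open>F p (Suc d) a\<close>
  are the \<kappa> of \<open>tame\<close>.\<close>

lemma abs_velocity_le:
  fixes u :: "nat \<Rightarrow> real"
  assumes m: "1 \<le> m" and ab: "a < b"
  shows "integral {a..b} (\<lambda>x. \<bar>\<Sum>p\<in>I. u p * tay m (F p) a 1 x\<bar>)
     \<le> (b - a) ^ m * (\<Sum>d<m. \<bar>\<Sum>p\<in>I. u p * (F p (Suc d) a / fact d * (b - a) ^ Suc d / (b - a) ^ m)\<bar>)"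
proof -
  let ?L = "b - a"
  define U where "U d = (\<Sum>p\<in>I. u p * (F p (Suc d) a / fact d))" for d
  have sm: "{..m - 1} = {..<m}" using m by auto
  have K: "(\<Sum>p\<in>I. u p * (F p (Suc d) a / fact d * ?L ^ Suc d / ?L ^ m)) = U d * ?L ^ Suc d / ?L ^ m" for d
    unfolding U_def sum_distrib_right sum_divide_distrib by (rule sum.cong) auto
  have pt: "\<bar>\<Sum>p\<in>I. u p * tay m (F p) a 1 x\<bar> \<le> (\<Sum>d<m. \<bar>U d\<bar> * ?L ^ d)" if "x \<in> {a..b}" for x
  proof -
    have "(\<Sum>p\<in>I. u p * tay m (F p) a 1 x) = (\<Sum>p\<in>I. \<Sum>d<m. u p * (F p (Suc d) a / fact d) * (x - a) ^ d)"
      unfolding tay_def sm sum_distrib_left by (simp add: mult.assoc)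
    also have "\<dots> = (\<Sum>d<m. U d * (x - a) ^ d)"
      unfolding U_def sum_distrib_right by (rule sum.swap)
    finally have "\<bar>\<Sum>p\<in>I. u p * tay m (F p) a 1 x\<bar> \<le> (\<Sum>d<m. \<bar>U d * (x - a) ^ d\<bar>)" by (simp add: sum_abs)
    also have "\<dots> \<le> (\<Sum>d<m. \<bar>U d\<bar> * ?L ^ d)"
      unfolding abs_mult power_abs using that by (intro sum_mono mult_left_mono power_mono) auto
    finally show ?thesis .
  qed
  have "\<bar>integral {a..b} (\<lambda>x. \<bar>\<Sum>p\<in>I. u p * tay m (F p) a 1 x\<bar>)\<bar> \<le> (\<Sum>d<m. \<bar>U d\<bar> * ?L ^ d) * ?L"
  proof -
    have "continuous_on {a..b} (\<lambda>x. \<bar>\<Sum>p\<in>I. u p * tay m (F p) a 1 x\<bar>)"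
      by (intro continuous_intros Cm_fam_cont[OF Cm_fam_tay] m)
    from integral_bound[OF less_imp_le[OF ab] this, of "\<Sum>d<m. \<bar>U d\<bar> * ?L ^ d"] pt show ?thesis
      by simp
  qed
  also have "(\<Sum>d<m. \<bar>U d\<bar> * ?L ^ d) * ?L = ?L ^ m * (\<Sum>d<m. \<bar>U d * ?L ^ Suc d / ?L ^ m\<bar>)"
    unfolding sum_distrib_left sum_distrib_right
  proof (rule sum.cong[OF refl])
    fix d assume "d \<in> {..<m}"
    then show "\<bar>U d\<bar> * ?L ^ d * ?L = ?L ^ m * \<bar>U d * ?L ^ Suc d / ?L ^ m\<bar>"
      using ab by (simp add: abs_mult)
  qed
  finally show ?thesis unfolding K by linarith
qed

lemma gap_ok_tame:
  assumes m: "1 \<le> m" and ab: "a < b" and B: "1 \<le> B" and e: "0 \<le> \<epsilon>" and ok: "gap_ok m r B F G a b \<epsilon>"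
  shows "tame m B {1..r} (\<lambda>p d. F p (Suc d) a / fact d * (b - a) ^ Suc d / (b - a) ^ m)
     (\<lambda>p q. area_term m F (alt_ext G) p q a b / (b - a) ^ (2 * m)) \<epsilon>"
proof -
  let ?L = "b - a"
  let ?A = "\<lambda>p q. area_term m F (alt_ext G) p q a b"
  define N where "N u = (\<Sum>d<m. \<bar>\<Sum>p\<in>{1..r}. u p * (F p (Suc d) a / fact d * ?L ^ Suc d / ?L ^ m)\<bar>)" for u :: "nat \<Rightarrow> real"
  have L: "?L > 0" using ab by simp
  have key: "\<bar>\<Sum>p\<in>{1..r}. \<Sum>q\<in>{1..r}. u p * v q * ?A p q\<bar> \<le> \<epsilon> * (1 + N u + N v) * ?L ^ (2 * m)"
    if ij: "1 \<le> j" "j < i" "i \<le> r" and uv: "u i = 1" "u j = 0" "v i = 0" "v j = 1"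
      "\<And>k. k \<in> {1..r} \<Longrightarrow> \<bar>u k\<bar> \<le> B" "\<And>k. k \<in> {1..r} \<Longrightarrow> \<bar>v k\<bar> \<le> B" for i j u v
  proof -
    \<comment> \<open>The sign is that in \<open>first_vec\<close>. \<open>u\<close> and
      \<open>v\<close> are bounded on {1..r} only, while \<open>gap_ok\<close> asks for a bound at
      every index, hence the value 0 elsewhere.\<close>
    define c where "c k = (if k \<in> {1..r} then - v k else 0)" for k
    define c' where "c' k = (if k \<in> {1..r} then - u k else 0)" for k
    have cB: "\<forall>k. \<bar>c k\<bar> \<le> B \<and> \<bar>c' k\<bar> \<le> B" using uv B by (auto simp: c_def c'_def)
    have fu: "first_vec i j c' p = u p" if "p \<in> {1..r}" for p using that uv by (auto simp: first_vec_def c'_def)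
    have fv: "first_vec j i c p = v p" if "p \<in> {1..r}" for p using that uv by (auto simp: first_vec_def c_def)
    have su: "(\<Sum>p\<in>{1..r}. first_vec i j c' p * y p) = (\<Sum>p\<in>{1..r}. u p * y p)"
      and sv: "(\<Sum>p\<in>{1..r}. first_vec j i c p * y p) = (\<Sum>p\<in>{1..r}. v p * y p)" for y
      by (rule sum.cong; simp add: fu fv)+
    have 1: "gen_area m r F G i j a b c c' = (\<Sum>p\<in>{1..r}. \<Sum>q\<in>{1..r}. u p * v q * ?A p q)"
      unfolding gen_area_bilinear[OF m less_imp_le[OF ab] ij] by (intro sum.cong refl) (simp add: fu fv)
    have 2: "velocity_term m F (rest_idx r i j) i a b c' \<le> ?L ^ m * N u"
      unfolding velocity_term_eq[OF m less_imp_le[OF ab] ij] N_def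
      unfolding su by (rule abs_velocity_le[OF m ab])
    have 3: "velocity_term m F (rest_idx r i j) j a b c \<le> ?L ^ m * N v"
      unfolding velocity_term_eq[OF m less_imp_le[OF ab] ij] N_def
      unfolding sv by (rule abs_velocity_le[OF m ab])
    have "\<bar>gen_area m r F G i j a b c c'\<bar> \<le> \<epsilon> * (?L ^ (2 * m) + ?L ^ m *
          (velocity_term m F (rest_idx r i j) i a b c' + velocity_term m F (rest_idx r i j) j a b c))"
      using ok ij cB unfolding gap_ok_def by blast
    also have "\<dots> \<le> \<epsilon> * (?L ^ (2 * m) + ?L ^ m * (?L ^ m * N u + ?L ^ m * N v))"
      using 2 3 e L by (intro mult_left_mono add_mono) auto
    also have "\<dots> = \<epsilon> * (1 + N u + N v) * ?L ^ (2 * m)"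
      unfolding mult_2 power_add by (simp add: distrib_left distrib_right mult_ac)
    finally show ?thesis unfolding 1 .
  qed
  show ?thesis
    unfolding tame_def
  proof (intro ballI impI allI)
    fix i j u v
    assume i: "i \<in> {1..r}" and j: "j \<in> {1..r}" and ne: "i \<noteq> j"
      and uv: "u i = 1 \<and> u j = 0 \<and> v i = 0 \<and> v j = 1 \<and> (\<forall>k\<in>{1..r}. \<bar>u k\<bar> \<le> B \<and> \<bar>v k\<bar> \<le> B)"
    have sc: "(\<Sum>p\<in>{1..r}. \<Sum>q\<in>{1..r}. u p * v q * (?A p q / ?L ^ (2 * m))) = (\<Sum>p\<in>{1..r}. \<Sum>q\<in>{1..r}. u p * v q * ?A p q) / ?L ^ (2 * m)"
      by (simp add: sum_divide_distrib)
    have "\<bar>\<Sum>p\<in>{1..r}. \<Sum>q\<in>{1..r}. u p * v q * ?A p q\<bar> \<le> \<epsilon> * (1 + N u + N v) * ?L ^ (2 * m)"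
    proof (cases "j < i")
      case True then show ?thesis using key[of j i u v] i j uv by auto
    next
      \<comment> \<open>The A/V condition speaks of j < i. In the other order u and v are exchanged:
        the form is alternating and the bound symmetric.\<close>
      case False
      have "(\<Sum>p\<in>{1..r}. \<Sum>q\<in>{1..r}. u p * v q * ?A p q) = (\<Sum>q\<in>{1..r}. \<Sum>p\<in>{1..r}. u p * v q * ?A p q)"
        by (rule sum.swap)
      also have "\<dots> = (\<Sum>q\<in>{1..r}. \<Sum>p\<in>{1..r}. - (v q * u p * ?A q p))"
      proof (intro sum.cong refl)
        fix p q
        have "?A p q = - ?A q p" using area_term_alt_ext[OF m less_imp_le[OF ab], of F G p q] by linarith
        then show "u p * v q * ?A p q = - (v q * u p * ?A q p)" by simp
      qed
      also have "\<dots> = - (\<Sum>q\<in>{1..r}. \<Sum>p\<in>{1..r}. v q * u p * ?A q p)" by (simp add: sum_negf)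
      finally have "\<bar>\<Sum>p\<in>{1..r}. \<Sum>q\<in>{1..r}. u p * v q * ?A p q\<bar> = \<bar>\<Sum>q\<in>{1..r}. \<Sum>p\<in>{1..r}. v q * u p * ?A q p\<bar>" by simp
      then show ?thesis using key[of i j v u] i j uv ne False by (auto simp: add_ac)
    qed
    then have "\<bar>\<Sum>p\<in>{1..r}. \<Sum>q\<in>{1..r}. u p * v q * ?A p q\<bar> / ?L ^ (2 * m) \<le> \<epsilon> * (1 + N u + N v)"
      using L by (simp add: pos_divide_le_eq)
    then show "\<bar>\<Sum>p\<in>{1..r}. \<Sum>q\<in>{1..r}. u p * v q * (?A p q / ?L ^ (2 * m))\<bar>
       \<le> \<epsilon> * (1 + (\<Sum>d<m. \<bar>\<Sum>p\<in>{1..r}. u p * (F p (Suc d) a / fact d * ?L ^ Suc d / ?L ^ m)\<bar>) +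
           (\<Sum>d<m. \<bar>\<Sum>p\<in>{1..r}. v p * (F p (Suc d) a / fact d * ?L ^ Suc d / ?L ^ m)\<bar>))"
      unfolding sc N_def[symmetric] using L by (simp add: abs_divide)
  qed
qed

lemma integral_rescale:
  fixes f :: "real \<Rightarrow> real"
  assumes "a < b" "continuous_on UNIV f"
  shows "integral {a..b} (\<lambda>x. f ((x - a) / (b - a))) = (b - a) * integral {0..1} f"
proof -
  let ?L = "b - a"
  have "(f has_integral (integral {0..1} f)) (cbox 0 1)"
    using assms(2) by (auto intro!: integrable_integral integrable_continuous_interval continuous_on_subset[of UNIV])
  from has_integral_affinity'[OF this, of "1 / ?L" "- a / ?L"] assms(1)
  have "((\<lambda>x. f (x / ?L - a / ?L)) has_integral integral {0..1} f / (1 / ?L)) (cbox (a / ?L / (1 / ?L)) ((1 + a / ?L) / (1 / ?L)))"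
    by (simp add: divide_inverse mult_ac)
  moreover have "a / ?L / (1 / ?L) = a" "(1 + a / ?L) / (1 / ?L) = b" using assms(1) by (auto simp: field_simps)
  ultimately show ?thesis by (simp add: diff_divide_distrib integral_unique mult.commute)
qed

text \<open>\<open>unit_solution\<close> is carried over by \<open>Cm_fam_rescale\<close>. Members
  of orders 0 and 1 scale by L^m and L^(m-1), and the substitution in the integral gives another L,
  so areas scale by L^(2 m), as in the denominator of the A/V condition.\<close>

lemma gap_solution:
  assumes m: "1 \<le> m"
  shows "\<exists>B M. 1 \<le> B \<and> 0 \<le> M \<and> (\<forall>F G a b \<epsilon>. a < b \<and> 0 \<le> \<epsilon> \<and> gap_ok m r B F G a b \<epsilon> \<longrightarrow>
     (\<exists>g. \<forall>i\<in>{1..r}. Cm_fam m (g i) \<and> (\<forall>k\<le>m. g i k a = F i k a \<and> g i k b = F i k b) \<and>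
        (\<forall>k\<le>m. \<forall>x\<in>{a..b}. \<bar>g i k x - tay m (F i) a k x\<bar> \<le> M * (\<epsilon> + sqrt \<epsilon>) * (b - a) ^ (m - k)) \<and>
        (\<forall>j\<in>{1..r}. j < i \<longrightarrow>
           1/2 * integral {a..b} (\<lambda>x. g i 0 x * g j 1 x - g i 1 x * g j 0 x) = G i j 0 b - G i j 0 a)))"
proof -
  let ?I = "{1..r}"
  from unit_solution[OF m, of r] obtain B M where BM: "1 \<le> B" "0 \<le> M" and
    us: "\<forall>\<kappa> \<eta> a \<epsilon>. 0 \<le> \<epsilon> \<and> (\<forall>i\<in>?I. \<forall>j\<in>?I. a i j + a j i = 0) \<and>
     tame m B ?I \<kappa> a \<epsilon> \<and> (\<forall>i\<in>?I. \<forall>k\<le>m. \<bar>\<eta> i k\<bar> \<le> \<epsilon>) \<longrightarrow>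
     (\<exists>X. \<forall>i\<in>?I. Cm_fam m (X i) \<and> (\<forall>k\<le>m. X i k 0 = 0 \<and> X i k 1 = \<eta> i k) \<and>
        (\<forall>k\<le>m. \<forall>s\<in>{0..1}. \<bar>X i k s\<bar> \<le> M * (\<epsilon> + sqrt \<epsilon>)) \<and>
        (\<forall>j\<in>?I. a i j =
           ((\<Sum>d<m. \<kappa> i d / real (Suc d)) * \<eta> j 0 - (\<Sum>d<m. \<kappa> j d / real (Suc d)) * \<eta> i 0) / 2
           + (\<Sum>d<m. \<kappa> j d * integral {0..1} (\<lambda>s. X i 0 s * s ^ d) - \<kappa> i d * integral {0..1} (\<lambda>s. X j 0 s * s ^ d))
           + integral {0..1} (\<lambda>s. X i 0 s * X j 1 s - X i 1 s * X j 0 s) / 2))"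
    by (elim exE conjE) (rule that; assumption)
  show ?thesis
  proof (rule exI[of _ B], rule exI[of _ M], intro conjI allI impI)
    show "1 \<le> B" "0 \<le> M" by fact+
    fix F G and a b \<epsilon> :: real
    assume H: "a < b \<and> 0 \<le> \<epsilon> \<and> gap_ok m r B F G a b \<epsilon>"
    then have ab: "a < b" and e: "0 \<le> \<epsilon>" and ok: "gap_ok m r B F G a b \<epsilon>" by auto
    define L where "L = b - a"
    have L: "L > 0" using ab by (simp add: L_def)
    define \<kappa> where "\<kappa> p d = F p (Suc d) a / fact d * L ^ Suc d / L ^ m" for p d
    define \<eta> where "\<eta> i k = (F i k b - tay m (F i) a k b) / L ^ (m - k)" for i k
    define A where "A p q = area_term m F (alt_ext G) p q a b" for p q
    have "\<forall>i\<in>?I. \<forall>j\<in>?I. A i j / L ^ (2 * m) + A j i / L ^ (2 * m) = 0"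
      using area_term_alt_ext[OF m less_imp_le[OF ab], of F G] by (simp add: A_def add_divide_distrib[symmetric])
    moreover have "tame m B ?I \<kappa> (\<lambda>i j. A i j / L ^ (2 * m)) \<epsilon>"
      using gap_ok_tame[OF m ab BM(1) e ok] by (simp add: \<kappa>_def[abs_def] A_def L_def)
    moreover have "\<forall>i\<in>?I. \<forall>k\<le>m. \<bar>\<eta> i k\<bar> \<le> \<epsilon>"
      using ok L unfolding gap_ok_def \<eta>_def L_def[symmetric] by (simp add: abs_divide pos_divide_le_eq)
    ultimately have hyp: "0 \<le> \<epsilon> \<and> (\<forall>i\<in>?I. \<forall>j\<in>?I. A i j / L ^ (2 * m) + A j i / L ^ (2 * m) = 0) \<and>
      tame m B ?I \<kappa> (\<lambda>i j. A i j / L ^ (2 * m)) \<epsilon> \<and> (\<forall>i\<in>?I. \<forall>k\<le>m. \<bar>\<eta> i k\<bar> \<le> \<epsilon>)" using e by blast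
    obtain X where X: "\<forall>i\<in>?I. Cm_fam m (X i) \<and> (\<forall>k\<le>m. X i k 0 = 0 \<and> X i k 1 = \<eta> i k) \<and>
        (\<forall>k\<le>m. \<forall>s\<in>{0..1}. \<bar>X i k s\<bar> \<le> M * (\<epsilon> + sqrt \<epsilon>)) \<and>
        (\<forall>j\<in>?I. A i j / L ^ (2 * m) =
           ((\<Sum>d<m. \<kappa> i d / real (Suc d)) * \<eta> j 0 - (\<Sum>d<m. \<kappa> j d / real (Suc d)) * \<eta> i 0) / 2
           + (\<Sum>d<m. \<kappa> j d * integral {0..1} (\<lambda>s. X i 0 s * s ^ d) - \<kappa> i d * integral {0..1} (\<lambda>s. X j 0 s * s ^ d))
           + integral {0..1} (\<lambda>s. X i 0 s * X j 1 s - X i 1 s * X j 0 s) / 2)"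
      using us[THEN spec[of _ \<kappa>], THEN spec[of _ \<eta>], THEN spec[of _ "\<lambda>i j. A i j / L ^ (2 * m)"], THEN spec[of _ \<epsilon>], THEN mp, OF hyp]
      by (elim exE) (rule that)
    define g where "g i k x = tay m (F i) a k x + L ^ (m - k) * X i k ((x - a) / L)" for i k x
    have Cg: "Cm_fam m (g i)" if "i \<in> ?I" for i
    proof -
      have "Cm_fam m (X i)" using X that by blast
      from Cm_fam_add[OF Cm_fam_tay Cm_fam_rescale[OF this, of L a], of "F i" a] L show ?thesis
        by (simp add: g_def[abs_def])
    qed
    have ga: "g i k a = F i k a" if "i \<in> ?I" "k \<le> m" for i k
      using X that L by (simp add: g_def)
    have gb: "g i k b = F i k b" if "i \<in> ?I" "k \<le> m" for i k
    proof -
      have "X i k 1 = \<eta> i k" using X that by blast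
      moreover have "(b - a) / L = 1" using L by (simp add: L_def)
      ultimately show ?thesis using L by (simp add: g_def \<eta>_def)
    qed
    have area: "1/2 * integral {a..b} (\<lambda>x. g i 0 x * g j 1 x - g i 1 x * g j 0 x) = G i j 0 b - G i j 0 a"
      if i: "i \<in> ?I" and j: "j \<in> ?I" and ji: "j < i" for i j
    proof -
      have XC: "Cm_fam m (X i)" "Cm_fam m (X j)" using X i j by blast+
      have XU: "continuous_on S (X i 0)" "continuous_on S (X i 1)" "continuous_on S (X j 0)" "continuous_on S (X j 1)" for S
        using XC m by (auto intro: Cm_fam_cont)
      have sm: "{..m - 1} = {..<m}" using m by auto
      have LL: "L ^ m * (L ^ (m - 1) * L) = L ^ (2 * m)"
        using m by (simp add: power_Suc2[symmetric] mult_2 power_add[symmetric])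
      have T1: "tay m (F p) a 1 x = L ^ (m - 1) * (\<Sum>d<m. \<kappa> p d * ((x - a) / L) ^ d)" for p x
        unfolding tay_def sm sum_distrib_left
      proof (rule sum.cong[OF refl])
        fix d
        have "L ^ (m - 1) * L = L ^ m" using m by (simp add: power_Suc2[symmetric])
        then have "L ^ m = L * L ^ (m - 1)" by (simp add: mult.commute)
        then show "F p (1 + d) a / fact d * (x - a) ^ d = L ^ (m - 1) * (\<kappa> p d * ((x - a) / L) ^ d)"
          using L by (simp add: \<kappa>_def power_divide field_simps)
      qed
      have T0: "tay m (F p) a 0 b - tay m (F p) a 0 a = L ^ m * (\<Sum>d<m. \<kappa> p d / real (Suc d))" for p
      proof -
        have e: "m - 0 = Suc (m - 1)" using m by simp
        have "tay m (F p) a 0 b = F p 0 a + (\<Sum>d<m. F p (Suc d) a / fact (Suc d) * L ^ Suc d)"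
          unfolding tay_def e sum.atMost_Suc_shift sm L_def by simp
        moreover have "(\<Sum>d<m. F p (Suc d) a / fact (Suc d) * L ^ Suc d) = L ^ m * (\<Sum>d<m. \<kappa> p d / real (Suc d))"
          unfolding sum_distrib_left by (rule sum.cong) (use L in \<open>auto simp: \<kappa>_def simp del: of_nat_Suc\<close>)
        ultimately show ?thesis by simp
      qed
      have g0: "g p 0 x - tay m (F p) a 0 x = L ^ m * X p 0 ((x - a) / L)"
        "g p 1 x - tay m (F p) a 1 x = L ^ (m - 1) * X p 1 ((x - a) / L)" for p x
        by (simp_all add: g_def)
      have X1: "X p 0 ((b - a) / L) = \<eta> p 0" if "p \<in> ?I" for p
        using X that L by (simp add: L_def)
      have res: "integral {a..b} (\<lambda>x. f ((x - a) / L)) = L * integral {0..1} f" if "continuous_on UNIV f" for f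
        unfolding L_def by (rule integral_rescale[OF ab that])
      have I1: "integral {a..b} (\<lambda>x. (g i 0 x - tay m (F i) a 0 x) * tay m (F j) a 1 x - tay m (F i) a 1 x * (g j 0 x - tay m (F j) a 0 x))
         = L ^ (2 * m) * (\<Sum>d<m. \<kappa> j d * integral {0..1} (\<lambda>s. X i 0 s * s ^ d) - \<kappa> i d * integral {0..1} (\<lambda>s. X j 0 s * s ^ d))"
      proof -
        define \<phi> where "\<phi> s = (\<Sum>d<m. \<kappa> j d * (X i 0 s * s ^ d) - \<kappa> i d * (X j 0 s * s ^ d))" for s
        have "(\<lambda>x. (g i 0 x - tay m (F i) a 0 x) * tay m (F j) a 1 x - tay m (F i) a 1 x * (g j 0 x - tay m (F j) a 0 x))
            = (\<lambda>x. (L ^ m * L ^ (m - 1)) * \<phi> ((x - a) / L))"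
          unfolding g0 T1 \<phi>_def sum_subtractf by (rule ext) (simp add: sum_distrib_left algebra_simps)
        moreover have "continuous_on UNIV \<phi>" unfolding \<phi>_def by (intro continuous_intros XU)
        ultimately have "integral {a..b} (\<lambda>x. (g i 0 x - tay m (F i) a 0 x) * tay m (F j) a 1 x - tay m (F i) a 1 x * (g j 0 x - tay m (F j) a 0 x))
            = L ^ (2 * m) * integral {0..1} \<phi>" using LL by (simp add: res mult.assoc)
        also have "integral {0..1} \<phi> = (\<Sum>d<m. integral {0..1} (\<lambda>s. \<kappa> j d * (X i 0 s * s ^ d) - \<kappa> i d * (X j 0 s * s ^ d)))"
          unfolding \<phi>_def by (intro integral_sum integrable_continuous_interval continuous_intros XU) auto
        also have "\<dots> = (\<Sum>d<m. \<kappa> j d * integral {0..1} (\<lambda>s. X i 0 s * s ^ d) - \<kappa> i d * integral {0..1} (\<lambda>s. X j 0 s * s ^ d))"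
          by (intro sum.cong refl, subst integral_diff) (auto intro!: integrable_continuous_interval continuous_intros XU)
        finally show ?thesis .
      qed
      have I2: "integral {a..b} (\<lambda>x. (g i 0 x - tay m (F i) a 0 x) * (g j 1 x - tay m (F j) a 1 x) - (g i 1 x - tay m (F i) a 1 x) * (g j 0 x - tay m (F j) a 0 x))
         = L ^ (2 * m) * integral {0..1} (\<lambda>s. X i 0 s * X j 1 s - X i 1 s * X j 0 s)"
      proof -
        define \<phi> where "\<phi> s = X i 0 s * X j 1 s - X i 1 s * X j 0 s" for s
        have "(\<lambda>x. (g i 0 x - tay m (F i) a 0 x) * (g j 1 x - tay m (F j) a 1 x) - (g i 1 x - tay m (F i) a 1 x) * (g j 0 x - tay m (F j) a 0 x))
            = (\<lambda>x. (L ^ m * L ^ (m - 1)) * \<phi> ((x - a) / L))"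
          unfolding g0 \<phi>_def by (rule ext) (simp add: algebra_simps)
        moreover have "continuous_on UNIV \<phi>" unfolding \<phi>_def by (intro continuous_intros XU)
        ultimately have "integral {a..b} (\<lambda>x. (g i 0 x - tay m (F i) a 0 x) * (g j 1 x - tay m (F j) a 1 x) - (g i 1 x - tay m (F i) a 1 x) * (g j 0 x - tay m (F j) a 0 x))
            = L ^ (2 * m) * integral {0..1} \<phi>" using LL by (simp add: res mult.assoc)
        then show ?thesis unfolding \<phi>_def .
      qed
      have L2: "L ^ (2 * m) = L ^ m * L ^ m" by (simp only: mult_2 power_add)
      have arith: "l * l * ((P * e' - Q * e) / 2 + S + J / 2) = 1/2 * ((l * P) * (l * e') - (l * Q) * (l * e)) + l * l * S + 1/2 * (l * l * J)"
        for l P Q e e' S J :: real by (simp add: field_simps)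
      have "A i j = L ^ (2 * m) * (A i j / L ^ (2 * m))" using L by simp
      also have "A i j / L ^ (2 * m) = ((\<Sum>d<m. \<kappa> i d / real (Suc d)) * \<eta> j 0 - (\<Sum>d<m. \<kappa> j d / real (Suc d)) * \<eta> i 0) / 2
           + (\<Sum>d<m. \<kappa> j d * integral {0..1} (\<lambda>s. X i 0 s * s ^ d) - \<kappa> i d * integral {0..1} (\<lambda>s. X j 0 s * s ^ d))
           + integral {0..1} (\<lambda>s. X i 0 s * X j 1 s - X i 1 s * X j 0 s) / 2"
        by (rule X[THEN bspec, OF i, THEN conjunct2, THEN conjunct2, THEN conjunct2, THEN bspec, OF j])
      finally have A1: "A i j = 1/2 * ((tay m (F i) a 0 b - tay m (F i) a 0 a) * (g j 0 b - tay m (F j) a 0 b) - (tay m (F j) a 0 b - tay m (F j) a 0 a) * (g i 0 b - tay m (F i) a 0 b))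
          + L ^ (2 * m) * (\<Sum>d<m. \<kappa> j d * integral {0..1} (\<lambda>s. X i 0 s * s ^ d) - \<kappa> i d * integral {0..1} (\<lambda>s. X j 0 s * s ^ d))
          + 1/2 * (L ^ (2 * m) * integral {0..1} (\<lambda>s. X i 0 s * X j 1 s - X i 1 s * X j 0 s))"
        unfolding T0 g0 X1[OF i] X1[OF j] L2 by (simp only: arith)
      have A2: "A i j = G i j 0 b - G i j 0 a
     - 1/2 * integral {a..b} (\<lambda>x. tay m (F i) a 0 x * tay m (F j) a 1 x - tay m (F i) a 1 x * tay m (F j) a 0 x)
     + 1/2 * F j 0 a * (F i 0 b - tay m (F i) a 0 b) - 1/2 * F i 0 a * (F j 0 b - tay m (F j) a 0 b)"
        unfolding A_def area_term_alt_ext_eq[OF ji] by (rule area_term_eq[OF m less_imp_le[OF ab]])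
      have A3: "1/2 * integral {a..b} (\<lambda>x. g i 0 x * g j 1 x - g i 1 x * g j 0 x) - 1/2 * integral {a..b} (\<lambda>x. tay m (F i) a 0 x * tay m (F j) a 1 x - tay m (F i) a 1 x * tay m (F j) a 0 x)
      + 1/2 * tay m (F j) a 0 a * (g i 0 b - tay m (F i) a 0 b) - 1/2 * tay m (F i) a 0 a * (g j 0 b - tay m (F j) a 0 b) = A i j"
        unfolding A1 I1[symmetric] I2[symmetric]
        by (rule area_difference[OF Cg[OF i] Cg[OF j] Cm_fam_tay Cm_fam_tay m less_imp_le[OF ab]]) (simp_all only: tay_self ga[OF i le0] ga[OF j le0])
      \<comment> \<open>\<open>A2\<close> and \<open>A3\<close> express the same quantity through
        \<open>G\<close> and through \<open>g\<close>; the Taylor terms in them cancel.\<close>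
      show ?thesis using A3 unfolding A2 tay_self gb[OF i le0] gb[OF j le0] by linarith
    qed
    show "\<exists>g. \<forall>i\<in>?I. Cm_fam m (g i) \<and> (\<forall>k\<le>m. g i k a = F i k a \<and> g i k b = F i k b) \<and>
        (\<forall>k\<le>m. \<forall>x\<in>{a..b}. \<bar>g i k x - tay m (F i) a k x\<bar> \<le> M * (\<epsilon> + sqrt \<epsilon>) * (b - a) ^ (m - k)) \<and>
        (\<forall>j\<in>?I. j < i \<longrightarrow>
           1/2 * integral {a..b} (\<lambda>x. g i 0 x * g j 1 x - g i 1 x * g j 0 x) = G i j 0 b - G i j 0 a)"
    proof (rule exI[of _ g], intro ballI conjI allI impI)
      fix i assume i: "i \<in> ?I"
      show "Cm_fam m (g i)" by (rule Cg[OF i])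
      show "g i k a = F i k a" "g i k b = F i k b" if "k \<le> m" for k using ga gb i that by auto
      show "\<bar>g i k x - tay m (F i) a k x\<bar> \<le> M * (\<epsilon> + sqrt \<epsilon>) * (b - a) ^ (m - k)" if "k \<le> m" "x \<in> {a..b}" for k x
      proof -
        have "(x - a) / L \<in> {0..1}" using that L by (simp add: L_def)
        then have "\<bar>X i k ((x - a) / L)\<bar> \<le> M * (\<epsilon> + sqrt \<epsilon>)" using X i that by blast
        then show ?thesis using L by (simp add: g_def abs_mult L_def[symmetric] mult.commute mult_left_mono)
      qed
      show "1/2 * integral {a..b} (\<lambda>x. g i 0 x * g j 1 x - g i 1 x * g j 0 x) = G i j 0 b - G i j 0 a"
        if "j \<in> ?I" "j < i" for j by (rule area[OF i that])
    qed
  qed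
qed

section \<open>Sufficiency\<close>

lemma finite_delta:
  assumes "finite S" "\<And>x. x \<in> S \<Longrightarrow> \<exists>\<delta>>0. P x \<delta>" "\<And>x \<delta> \<delta>'. P x \<delta> \<Longrightarrow> 0 < \<delta>' \<Longrightarrow> \<delta>' \<le> \<delta> \<Longrightarrow> P x \<delta>'"
  shows "\<exists>\<delta>>0::real. \<forall>x\<in>S. P x \<delta>"
  using assms(1,2)
proof (induction S rule: finite_induct)
  case empty then show ?case by (auto intro: exI[of _ 1])
next
  case (insert y S)
  then obtain d1 d2 where d: "d1 > 0" "P y d1" "d2 > 0" "\<forall>x\<in>S. P x d2" by (meson insertCI)
  show ?case
  proof (intro exI[of _ "min d1 d2"] conjI ballI)
    show "0 < min d1 d2" using d by simp
    fix x assume "x \<in> insert y S"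
    then show "P x (min d1 d2)" using d assms(3)[of _ _ "min d1 d2"] by fastforce
  qed
qed

section \<open>Whitney and A/V estimates on single gaps\<close>

lemma whitney_taylor_bound:
  assumes "whitney_field m K F" "k \<le> m" "\<epsilon> > 0"
  shows "\<exists>\<delta>>0. \<forall>a\<in>K. \<forall>b\<in>K. \<bar>a - b\<bar> < \<delta> \<longrightarrow> \<bar>F k b - tay m F a k b\<bar> \<le> \<epsilon> * \<bar>b - a\<bar> ^ (m - k)"
proof -
  obtain d where d: "d > 0" "\<And>a b. a \<in> K \<Longrightarrow> b \<in> K \<Longrightarrow> a \<noteq> b \<Longrightarrow> \<bar>a - b\<bar> < d \<Longrightarrow>
        \<bar>F k b - (\<Sum>l\<le>m - k. F (k + l) a / fact l * (b - a) ^ l)\<bar> / \<bar>b - a\<bar> ^ (m - k) < \<epsilon>"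
    using assms unfolding whitney_field_def by meson
  show ?thesis
  proof (intro exI[of _ d] conjI ballI impI)
    fix a b assume ab: "a \<in> K" "b \<in> K" "\<bar>a - b\<bar> < d"
    show "\<bar>F k b - tay m F a k b\<bar> \<le> \<epsilon> * \<bar>b - a\<bar> ^ (m - k)"
    proof (cases "a = b")
      case True then show ?thesis using assms(3) by simp
    next
      case False
      have "\<bar>b - a\<bar> ^ (m - k) > 0" using False by simp
      then show ?thesis using d(2)[OF ab(1,2) False ab(3)] by (simp add: tay_def pos_divide_less_eq)
    qed
  qed (use d in auto)
qed

text \<open>For k < m the Whitney remainder has order m - k \<ge> 1. Hence each component of the jet
  has the next one as derivative along \<open>K\<close>, as \<open>glue_gaps\<close>
  requires.\<close>

lemma whitney_first_order:
  assumes W: "whitney_field m K F" and k: "k < m" and t: "t \<in> K" and e: "\<epsilon> > 0"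
  shows "\<exists>\<delta>>0. \<forall>a\<in>K. \<bar>a - t\<bar> < \<delta> \<longrightarrow> \<bar>F k a - F k t - F (Suc k) t * (a - t)\<bar> \<le> \<epsilon> * \<bar>a - t\<bar>"
proof -
  have e2: "\<epsilon> / 2 > 0" using e by simp
  obtain d1 where d1: "d1 > 0" "\<And>a b. a \<in> K \<Longrightarrow> b \<in> K \<Longrightarrow> \<bar>a - b\<bar> < d1 \<Longrightarrow> \<bar>F k b - tay m F a k b\<bar> \<le> \<epsilon> / 2 * \<bar>b - a\<bar> ^ (m - k)"
    using whitney_taylor_bound[OF W less_imp_le[OF k] e2] by blast
  have "(tay m F t k has_derivative (\<lambda>x. F (Suc k) t * x)) (at t)"
    using Cm_famD[OF Cm_fam_tay k, of F t t] unfolding has_field_derivative_def tay_self by simp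
  then have "\<forall>e>0. \<exists>d>0. \<forall>y. norm (y - t) < d \<longrightarrow> norm (tay m F t k y - tay m F t k t - F (Suc k) t * (y - t)) \<le> e * norm (y - t)"
    unfolding has_derivative_at_alt by (rule conjunct2)
  then obtain d2 where d2: "d2 > 0" "\<And>y. \<bar>y - t\<bar> < d2 \<Longrightarrow> \<bar>tay m F t k y - F k t - F (Suc k) t * (y - t)\<bar> \<le> \<epsilon> / 2 * \<bar>y - t\<bar>"
    using e2 unfolding real_norm_def tay_self by meson
  show ?thesis
  proof (intro exI[of _ "min 1 (min d1 d2)"] conjI ballI impI)
    fix a assume a: "a \<in> K" "\<bar>a - t\<bar> < min 1 (min d1 d2)"
    have "\<bar>F k a - tay m F t k a\<bar> \<le> \<epsilon> / 2 * \<bar>a - t\<bar> ^ (m - k)"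
      using d1(2)[OF t a(1)] a(2) by (simp add: abs_minus_commute)
    also have "\<bar>a - t\<bar> ^ (m - k) \<le> \<bar>a - t\<bar> ^ 1" using a(2) k by (intro power_decreasing) auto
    finally have 1: "\<bar>F k a - tay m F t k a\<bar> \<le> \<epsilon> / 2 * \<bar>a - t\<bar>" using e by simp
    have "\<bar>tay m F t k a - F k t - F (Suc k) t * (a - t)\<bar> \<le> \<epsilon> / 2 * \<bar>a - t\<bar>" using d2(2)[of a] a(2) by simp
    then have "\<bar>F k a - F k t - F (Suc k) t * (a - t)\<bar> \<le> \<epsilon> / 2 * \<bar>a - t\<bar> + \<epsilon> / 2 * \<bar>a - t\<bar>" using 1 by linarith
    also have "\<dots> = \<epsilon> * \<bar>a - t\<bar>" by (simp add: field_simps)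
    finally show "\<bar>F k a - F k t - F (Suc k) t * (a - t)\<bar> \<le> \<epsilon> * \<bar>a - t\<bar>" .
  qed (use d1 d2 in auto)
qed

text \<open>The A/V condition ranges over functions that are undefined off S, \<open>gap_ok\<close>
  over all functions; this and the two lemmas on restriction below reconcile them.\<close>

lemma first_vec_restrict:
  assumes "1 \<le> j" "j < i" "i \<le> r" "p \<in> {1..r}"
  shows "first_vec i j (restrict c (rest_idx r i j)) p = first_vec i j c p"
    and "first_vec j i (restrict c (rest_idx r i j)) p = first_vec j i c p"
  using assms by (auto simp: first_vec_def rest_idx_def)

lemma gen_area_restrict:
  assumes m: "1 \<le> m" and ab: "a \<le> b" and ij: "1 \<le> j" "j < i" "i \<le> r"
  shows "gen_area m r F G i j a b (restrict c (rest_idx r i j)) (restrict c' (rest_idx r i j)) = gen_area m r F G i j a b c c'"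
  unfolding gen_area_bilinear[OF assms] by (intro sum.cong refl) (simp add: first_vec_restrict[OF ij])

lemma velocity_term_restrict: "velocity_term m F S p a b (restrict c S) = velocity_term m F S p a b c"
  unfolding velocity_term_def by (simp cong: sum.cong)

lemma velocity_term_nonneg:
  assumes m: "1 \<le> m" and ab: "a \<le> b" and ij: "1 \<le> j" "j < i" "i \<le> r"
  shows "0 \<le> velocity_term m F (rest_idx r i j) i a b c" "0 \<le> velocity_term m F (rest_idx r i j) j a b c"
  unfolding velocity_term_eq[OF assms]
  by (intro integral_nonneg integrable_continuous_interval continuous_intros Cm_fam_cont[OF Cm_fam_tay] m; simp)+

text \<open>The condition is applied to the compact set [-B, B]; as there are finitely many index
  pairs and orders, one \<delta> serves all.\<close>

lemma gen_AV_gap_ok: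
  assumes m: "1 \<le> m" and W: "\<And>i. i \<in> {1..r} \<Longrightarrow> whitney_field m K (F i)" and AV: "gen_AV_condition m r K F G" and e: "\<epsilon> > 0"
  shows "\<exists>\<delta>>0. \<forall>a\<in>K. \<forall>b\<in>K. a < b \<and> b - a < \<delta> \<longrightarrow> gap_ok m r B F G a b \<epsilon>"
proof -
  have "\<exists>\<delta>>0. \<forall>x\<in>{1..r} \<times> {..m}. \<forall>a\<in>K. \<forall>b\<in>K. a < b \<and> b - a < \<delta> \<longrightarrow>
      \<bar>F (fst x) (snd x) b - tay m (F (fst x)) a (snd x) b\<bar> \<le> \<epsilon> * (b - a) ^ (m - snd x)"
  proof (rule finite_delta)
    fix x assume "x \<in> {1..r} \<times> {..m}"
    then have x: "fst x \<in> {1..r}" "snd x \<le> m" by auto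
    show "\<exists>\<delta>>0. \<forall>a\<in>K. \<forall>b\<in>K. a < b \<and> b - a < \<delta> \<longrightarrow>
      \<bar>F (fst x) (snd x) b - tay m (F (fst x)) a (snd x) b\<bar> \<le> \<epsilon> * (b - a) ^ (m - snd x)"
      using whitney_taylor_bound[OF W[OF x(1)] x(2) e] by (metis abs_minus_commute abs_of_pos diff_gt_0_iff_gt)
  qed force+
  then obtain d1 where d1: "d1 > 0" "\<And>i k a b. i \<in> {1..r} \<Longrightarrow> k \<le> m \<Longrightarrow> a \<in> K \<Longrightarrow> b \<in> K \<Longrightarrow> a < b \<Longrightarrow> b - a < d1 \<Longrightarrow>
      \<bar>F i k b - tay m (F i) a k b\<bar> \<le> \<epsilon> * (b - a) ^ (m - k)" by force
  define Bd where "Bd = (\<lambda>(i, j) a b. \<forall>c c'. (\<forall>k. \<bar>c k\<bar> \<le> B \<and> \<bar>c' k\<bar> \<le> B) \<longrightarrow>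
        \<bar>gen_area m r F G i j a b c c'\<bar> \<le> \<epsilon> * ((b - a) ^ (2 * m) + (b - a) ^ m *
          (velocity_term m F (rest_idx r i j) i a b c' + velocity_term m F (rest_idx r i j) j a b c)))"
  have "\<exists>\<delta>>0. \<forall>x\<in>{x \<in> {1..r} \<times> {1..r}. snd x < fst x}. \<forall>a\<in>K. \<forall>b\<in>K. a < b \<and> b - a < \<delta> \<longrightarrow> Bd x a b"
  proof (rule finite_delta)
    fix x assume "x \<in> {x \<in> {1..r} \<times> {1..r}. snd x < fst x}"
    then obtain i j where x: "x = (i, j)" "1 \<le> j" "j < i" "i \<le> r" by (cases x) auto
    let ?S = "rest_idx r i j"
    have "compact {- B..B}" by simp
    then obtain d where d: "d > 0" "\<And>a b. a \<in> K \<Longrightarrow> b \<in> K \<Longrightarrow> 0 < b - a \<Longrightarrow> b - a < d \<Longrightarrow>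
         (SUP (c, c') \<in> (?S \<rightarrow>\<^sub>E {- B..B}) \<times> (?S \<rightarrow>\<^sub>E {- B..B}).
            ereal (\<bar>gen_area m r F G i j a b c c'\<bar> /
              ((b - a) ^ (2 * m) + (b - a) ^ m *
                (velocity_term m F ?S i a b c' + velocity_term m F ?S j a b c)))) \<le> ereal \<epsilon>"
      using AV e x unfolding gen_AV_condition_def by meson
    show "\<exists>\<delta>>0. \<forall>a\<in>K. \<forall>b\<in>K. a < b \<and> b - a < \<delta> \<longrightarrow> Bd x a b"
    proof (intro exI[of _ d] conjI ballI impI)
      fix a b assume ab: "a \<in> K" "b \<in> K" "a < b \<and> b - a < d"
      then have le: "a \<le> b" and L: "0 < b - a" by auto
      show "Bd x a b"
        unfolding Bd_def x(1) prod.case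
      proof (intro allI impI)
        fix c c' :: "nat \<Rightarrow> real" assume cB: "\<forall>k. \<bar>c k\<bar> \<le> B \<and> \<bar>c' k\<bar> \<le> B"
        define c1 where "c1 = restrict c ?S"
        define c2 where "c2 = restrict c' ?S"
        define V where "V = (b - a) ^ (2 * m) + (b - a) ^ m * (velocity_term m F ?S i a b c2 + velocity_term m F ?S j a b c1)"
        have "V > 0" unfolding V_def
          using velocity_term_nonneg[OF m le x(2-4)] L by (intro add_pos_nonneg mult_nonneg_nonneg add_nonneg_nonneg) auto
        have "(c1, c2) \<in> (?S \<rightarrow>\<^sub>E {- B..B}) \<times> (?S \<rightarrow>\<^sub>E {- B..B})"
          using cB by (auto simp: c1_def c2_def abs_le_iff minus_le_iff)
        then have "ereal (\<bar>gen_area m r F G i j a b c1 c2\<bar> / V) \<le> (SUP (c, c') \<in> (?S \<rightarrow>\<^sub>E {- B..B}) \<times> (?S \<rightarrow>\<^sub>E {- B..B}).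
            ereal (\<bar>gen_area m r F G i j a b c c'\<bar> /
              ((b - a) ^ (2 * m) + (b - a) ^ m *
                (velocity_term m F ?S i a b c' + velocity_term m F ?S j a b c))))"
          unfolding V_def by (rule SUP_upper2) simp
        also have "\<dots> \<le> ereal \<epsilon>" using d(2) ab L by simp
        finally have "\<bar>gen_area m r F G i j a b c1 c2\<bar> \<le> \<epsilon> * V" using \<open>V > 0\<close> by (simp add: pos_divide_le_eq)
        then show "\<bar>gen_area m r F G i j a b c c'\<bar> \<le> \<epsilon> * ((b - a) ^ (2 * m) + (b - a) ^ m *
          (velocity_term m F ?S i a b c' + velocity_term m F ?S j a b c))"
          unfolding V_def c1_def c2_def velocity_term_restrict gen_area_restrict[OF m le x(2-4)] .
      qed
    qed (use d in auto)
  qed force+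
  then obtain d2 where d2: "d2 > 0" "\<And>i j a b. 1 \<le> j \<and> j < i \<and> i \<le> r \<Longrightarrow> a \<in> K \<Longrightarrow> b \<in> K \<Longrightarrow> a < b \<Longrightarrow> b - a < d2 \<Longrightarrow> Bd (i, j) a b"
    by force
  show ?thesis
  proof (intro exI[of _ "min d1 d2"] conjI ballI impI)
    fix a b assume ab: "a \<in> K" "b \<in> K" "a < b \<and> b - a < min d1 d2"
    have "Bd (i, j) a b" if "1 \<le> j \<and> j < i \<and> i \<le> r" for i j using d2(2)[OF that ab(1,2)] ab(3) by simp
    then show "gap_ok m r B F G a b \<epsilon>"
      unfolding gap_ok_def Bd_def prod.case using d1(2)[OF _ _ ab(1,2)] ab(3) by simp
  qed (use d1 d2 in auto)
qed

text \<open>The A/V condition says nothing about long gaps. There some \<epsilon> works because the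
  area form is bounded on the box of coefficients and the denominator is at least (b - a)^(2
  m).\<close>

lemma gap_ok_exists:
  assumes m: "1 \<le> m" and ab: "a < b" and B: "1 \<le> B"
  shows "\<exists>\<epsilon>\<ge>0. gap_ok m r B F G a b \<epsilon>"
proof -
  let ?L = "b - a"
  have L: "?L > 0" using ab by simp
  define w where "w i k = \<bar>F i k b - tay m (F i) a k b\<bar> / ?L ^ (m - k)" for i k
  define e1 where "e1 = (\<Sum>i\<in>{1..r}. \<Sum>k\<le>m. w i k)"
  define A where "A p q = area_term m F (alt_ext G) p q a b" for p q
  define e2 where "e2 = (\<Sum>p\<in>{1..r}. \<Sum>q\<in>{1..r}. B * B * \<bar>A p q\<bar>) / ?L ^ (2 * m)"
  have w0: "w i k \<ge> 0" for i k using L by (simp add: w_def)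
  have e1: "w i k \<le> e1" if "i \<in> {1..r}" "k \<le> m" for i k
  proof -
    have "w i k \<le> (\<Sum>k\<le>m. w i k)" using that w0 by (intro member_le_sum) auto
    also have "\<dots> \<le> e1" unfolding e1_def using that w0
      by (intro member_le_sum[where f = "\<lambda>i. \<Sum>k\<le>m. w i k"] sum_nonneg) auto
    finally show ?thesis .
  qed
  have e10: "e1 \<ge> 0" unfolding e1_def using w0 by (intro sum_nonneg) auto
  have e20: "e2 \<ge> 0" unfolding e2_def using L B by (intro divide_nonneg_nonneg sum_nonneg) auto
  have "gap_ok m r B F G a b (e1 + e2)"
    unfolding gap_ok_def
  proof (intro conjI ballI allI impI)
    fix i k assume ik: "i \<in> {1..r}" "k \<le> m"
    have "\<bar>F i k b - tay m (F i) a k b\<bar> = w i k * ?L ^ (m - k)" using L by (simp add: w_def)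
    also have "\<dots> \<le> (e1 + e2) * ?L ^ (m - k)" using e1[OF ik] e20 L by (intro mult_right_mono) auto
    finally show "\<bar>F i k b - tay m (F i) a k b\<bar> \<le> (e1 + e2) * ?L ^ (m - k)" .
  next
    fix i j and c c' :: "nat \<Rightarrow> real"
    assume ij: "1 \<le> j \<and> j < i \<and> i \<le> r" and cB: "\<forall>k. \<bar>c k\<bar> \<le> B \<and> \<bar>c' k\<bar> \<le> B"
    then have ij': "1 \<le> j" "j < i" "i \<le> r" by auto
    define V where "V = velocity_term m F (rest_idx r i j) i a b c' + velocity_term m F (rest_idx r i j) j a b c"
    have V: "V \<ge> 0" unfolding V_def using velocity_term_nonneg[OF m less_imp_le[OF ab] ij'] by (intro add_nonneg_nonneg) auto
    have fB: "\<bar>first_vec i' j' c p\<bar> \<le> B" "\<bar>first_vec i' j' c' p\<bar> \<le> B" for i' j' p using cB B by (auto simp: first_vec_def)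
    have "\<bar>gen_area m r F G i j a b c c'\<bar> \<le> (\<Sum>p\<in>{1..r}. \<Sum>q\<in>{1..r}. \<bar>first_vec i j c' p * first_vec j i c q * A p q\<bar>)"
      unfolding gen_area_bilinear[OF m less_imp_le[OF ab] ij'] A_def[symmetric]
      by (rule order_trans[OF sum_abs], rule sum_mono, rule sum_abs)
    also have "\<dots> \<le> (\<Sum>p\<in>{1..r}. \<Sum>q\<in>{1..r}. B * B * \<bar>A p q\<bar>)"
      unfolding abs_mult using fB B by (intro sum_mono mult_mono) auto
    also have "\<dots> = e2 * ?L ^ (2 * m)" using L by (simp add: e2_def)
    also have "\<dots> \<le> (e1 + e2) * (?L ^ (2 * m) + ?L ^ m * V)"
      using e10 e20 L V by (intro mult_mono) auto
    finally show "\<bar>gen_area m r F G i j a b c c'\<bar> \<le> (e1 + e2) * (?L ^ (2 * m) + ?L ^ m *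
          (velocity_term m F (rest_idx r i j) i a b c' + velocity_term m F (rest_idx r i j) j a b c))"
      unfolding V_def .
  qed
  then show ?thesis using e10 e20 by (intro exI[of _ "e1 + e2"]) simp
qed

text \<open>Choosing the least admissible \<open>\<epsilon>\<close> for each gap makes the perturbations tend to zero with the length of
  the gap.\<close>

lemma gap_ok_least:
  assumes m: "1 \<le> m" and ab: "a < b" and B: "1 \<le> B"
  shows "\<exists>e\<ge>0. gap_ok m r B F G a b e \<and> (\<forall>\<epsilon>\<ge>0. gap_ok m r B F G a b \<epsilon> \<longrightarrow> e \<le> \<epsilon>)"
proof -
  define E where "E = {\<epsilon>. 0 \<le> \<epsilon> \<and> gap_ok m r B F G a b \<epsilon>}"
  have ne: "E \<noteq> {}" using gap_ok_exists[OF assms] by (auto simp: E_def)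
  have bb: "bdd_below E" by (rule bdd_belowI[of _ 0]) (simp add: E_def)
  \<comment> \<open>Each clause of \<open>gap_ok\<close> has the form x \<le> \<epsilon> y with y >
    0 and so passes to the infimum.\<close>
  have inf: "x \<le> Inf E * y" if "\<And>\<epsilon>. \<epsilon> \<in> E \<Longrightarrow> x \<le> \<epsilon> * y" "y > 0" for x y
  proof -
    have "x / y \<le> Inf E" by (rule cInf_greatest[OF ne]) (use that in \<open>simp add: pos_divide_le_eq\<close>)
    then show ?thesis using that(2) by (simp add: pos_divide_le_eq)
  qed
  have L: "b - a > 0" using ab by simp
  have "gap_ok m r B F G a b (Inf E)"
    unfolding gap_ok_def
  proof (intro conjI ballI allI impI)
    fix i k assume "i \<in> {1..r}" "k \<le> m"
    then show "\<bar>F i k b - tay m (F i) a k b\<bar> \<le> Inf E * (b - a) ^ (m - k)"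
      using L by (intro inf) (auto simp: E_def gap_ok_def)
  next
    fix i j and c c' :: "nat \<Rightarrow> real"
    assume ij: "1 \<le> j \<and> j < i \<and> i \<le> r" and cB: "\<forall>k. \<bar>c k\<bar> \<le> B \<and> \<bar>c' k\<bar> \<le> B"
    then have ij': "1 \<le> j" "j < i" "i \<le> r" by auto
    have V: "velocity_term m F (rest_idx r i j) i a b c' + velocity_term m F (rest_idx r i j) j a b c \<ge> 0"
      using velocity_term_nonneg[OF m less_imp_le[OF ab] ij'] by (intro add_nonneg_nonneg) auto
    show "\<bar>gen_area m r F G i j a b c c'\<bar> \<le> Inf E * ((b - a) ^ (2 * m) + (b - a) ^ m *
          (velocity_term m F (rest_idx r i j) i a b c' + velocity_term m F (rest_idx r i j) j a b c))"
    proof (rule inf)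
      fix \<epsilon> assume "\<epsilon> \<in> E"
      then have "gap_ok m r B F G a b \<epsilon>" by (simp add: E_def)
      then show "\<bar>gen_area m r F G i j a b c c'\<bar> \<le> \<epsilon> * ((b - a) ^ (2 * m) + (b - a) ^ m *
          (velocity_term m F (rest_idx r i j) i a b c' + velocity_term m F (rest_idx r i j) j a b c))"
        unfolding gap_ok_def using ij cB by blast
    qed (use V L in \<open>auto intro!: add_pos_nonneg\<close>)
  qed
  moreover have "0 \<le> Inf E" by (rule cInf_greatest[OF ne]) (simp add: E_def)
  moreover have "Inf E \<le> \<epsilon>" if "0 \<le> \<epsilon>" "gap_ok m r B F G a b \<epsilon>" for \<epsilon>
    by (rule cInf_lower[OF _ bb]) (use that in \<open>simp add: E_def\<close>)
  ultimately show ?thesis by blast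
qed

lemma tay_near:
  assumes "\<And>k. k \<le> m \<Longrightarrow> \<bar>F k a\<bar> \<le> M" "k \<le> m" "0 \<le> x - a" "x - a \<le> 1"
  shows "\<bar>tay m F a k x - F k a\<bar> \<le> real m * M * (x - a)"
proof (cases "m - k")
  case 0
  have M: "0 \<le> M" using order_trans[OF abs_ge_zero assms(1)[OF order_refl]] .
  have "tay m F a k x = F k a" unfolding tay_def 0 by simp
  then show ?thesis using assms M by simp
next
  case (Suc n)
  have M: "0 \<le> M" using order_trans[OF abs_ge_zero assms(1)[OF order_refl]] .
  have "tay m F a k x - F k a = (\<Sum>l\<le>n. F (k + Suc l) a / fact (Suc l) * (x - a) ^ Suc l)"
    unfolding tay_def Suc sum.atMost_Suc_shift by simp
  also have "\<bar>\<dots>\<bar> \<le> (\<Sum>l\<le>n. \<bar>F (k + Suc l) a / fact (Suc l) * (x - a) ^ Suc l\<bar>)" by (rule sum_abs)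
  also have "\<dots> \<le> (\<Sum>l\<le>n. M * (x - a))"
  proof (rule sum_mono)
    fix l assume "l \<in> {..n}"
    then have l: "k + Suc l \<le> m" using Suc by auto
    have "\<bar>F (k + Suc l) a / fact (Suc l)\<bar> \<le> M / 1"
      unfolding abs_divide using assms(1)[OF l] M by (intro frac_le) (auto simp del: fact_Suc)
    then have 1: "\<bar>F (k + Suc l) a / fact (Suc l)\<bar> \<le> M" by (simp only: div_by_1)
    have 2: "\<bar>(x - a) ^ Suc l\<bar> \<le> x - a"
      using power_decreasing[of 1 "Suc l" "x - a"] assms by (simp add: abs_mult power_abs)
    show "\<bar>F (k + Suc l) a / fact (Suc l) * (x - a) ^ Suc l\<bar> \<le> M * (x - a)"
      unfolding abs_mult[of "F (k + Suc l) a / fact (Suc l)"] by (rule mult_mono[OF 1 2 M abs_ge_zero])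
  qed
  also have "\<dots> = real (Suc n) * M * (x - a)" by simp
  also have "\<dots> \<le> real m * M * (x - a)" using Suc assms M by (intro mult_right_mono) auto
  finally show ?thesis .
qed

lemma jet_bounded:
  assumes "jet m K F" "compact K"
  shows "\<exists>M. \<forall>k\<le>m. \<forall>a\<in>K. \<bar>F k a\<bar> \<le> M"
proof -
  have "\<exists>M. \<forall>a\<in>K. \<bar>F k a\<bar> \<le> M" if "k \<le> m" for k
  proof -
    have "compact (F k ` K)" using assms that by (auto simp: jet_def intro: compact_continuous_image)
    then show ?thesis using compact_imp_bounded bounded_iff by (metis image_eqI real_norm_def)
  qed
  then obtain M where M: "\<And>k a. k \<le> m \<Longrightarrow> a \<in> K \<Longrightarrow> \<bar>F k a\<bar> \<le> M k" by metis
  show ?thesis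
  proof (rule exI[of _ "\<Sum>k\<le>m. \<bar>M k\<bar>"], intro allI impI ballI)
    fix k a assume "k \<le> m" "a \<in> K"
    then have "\<bar>F k a\<bar> \<le> \<bar>M k\<bar>" using M[of k a] by linarith
    also have "\<dots> \<le> (\<Sum>k\<le>m. \<bar>M k\<bar>)" using \<open>k \<le> m\<close> by (intro member_le_sum) auto
    finally show "\<bar>F k a\<bar> \<le> (\<Sum>k\<le>m. \<bar>M k\<bar>)" .
  qed
qed

text \<open>On a gap one solution serves all indices together, because the areas couple them. The
  gluing then treats each index separately, and the areas persist since the result equals the chosen
  pieces on the gaps.\<close>

lemma horizontal_extension:
  assumes m: "1 \<le> m" and K: "compact K" "K \<noteq> {}" and W: "\<And>i. i \<in> {1..r} \<Longrightarrow> whitney_field m K (F i)"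
    and AV: "gen_AV_condition m r K F G"
  shows "\<exists>f. (\<forall>i\<in>{1..r}. Cm_fam m (f i) \<and> (\<forall>k. \<forall>t\<in>K. f i k t = F i k t)) \<and>
     (\<forall>i\<in>{1..r}. \<forall>j\<in>{1..r}. j < i \<longrightarrow> (\<forall>a b. gap K a b \<longrightarrow>
        1/2 * integral {a..b} (\<lambda>x. f i 0 x * f j 1 x - f i 1 x * f j 0 x) = G i j 0 b - G i j 0 a))"
proof -
  let ?I = "{1..r}"
  define Sol where "Sol a b M \<epsilon> g \<longleftrightarrow> (\<forall>i\<in>?I. Cm_fam m (g i) \<and> (\<forall>k\<le>m. g i k a = F i k a \<and> g i k b = F i k b) \<and>
        (\<forall>k\<le>m. \<forall>x\<in>{a..b}. \<bar>g i k x - tay m (F i) a k x\<bar> \<le> M * (\<epsilon> + sqrt \<epsilon>) * (b - a) ^ (m - k)) \<and>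
        (\<forall>j\<in>?I. j < i \<longrightarrow>
           1/2 * integral {a..b} (\<lambda>x. g i 0 x * g j 1 x - g i 1 x * g j 0 x) = G i j 0 b - G i j 0 a))"
    for a b M \<epsilon> g
  obtain B M where BM: "1 \<le> B" "0 \<le> M" and
    "\<forall>F G a b \<epsilon>. a < b \<and> 0 \<le> \<epsilon> \<and> gap_ok m r B F G a b \<epsilon> \<longrightarrow>
     (\<exists>g. \<forall>i\<in>?I. Cm_fam m (g i) \<and> (\<forall>k\<le>m. g i k a = F i k a \<and> g i k b = F i k b) \<and>
        (\<forall>k\<le>m. \<forall>x\<in>{a..b}. \<bar>g i k x - tay m (F i) a k x\<bar> \<le> M * (\<epsilon> + sqrt \<epsilon>) * (b - a) ^ (m - k)) \<and>
        (\<forall>j\<in>?I. j < i \<longrightarrow>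
           1/2 * integral {a..b} (\<lambda>x. g i 0 x * g j 1 x - g i 1 x * g j 0 x) = G i j 0 b - G i j 0 a))"
    using gap_solution[OF m, of r] by (elim exE conjE) (rule that; assumption)
  then have sol: "a < b \<and> 0 \<le> \<epsilon> \<and> gap_ok m r B F G a b \<epsilon> \<longrightarrow> (\<exists>g. Sol a b M \<epsilon> g)" for a b \<epsilon>
    unfolding Sol_def by (elim allE)
  have "\<exists>e g. \<forall>a b. gap K a b \<longrightarrow> (0 \<le> e a b \<and> (\<forall>\<epsilon>\<ge>0. gap_ok m r B F G a b \<epsilon> \<longrightarrow> e a b \<le> \<epsilon>)) \<and> Sol a b M (e a b) (g a b)"
  proof -
    have "\<exists>e g. gap K a b \<longrightarrow> (0 \<le> e \<and> (\<forall>\<epsilon>\<ge>0. gap_ok m r B F G a b \<epsilon> \<longrightarrow> e \<le> \<epsilon>)) \<and> Sol a b M e g" for a b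
    proof (cases "gap K a b")
      case True
      then have "a < b" by (simp add: gap_def)
      from gap_ok_least[OF m this BM(1), of r F G] obtain e where "0 \<le> e" "gap_ok m r B F G a b e"
        "\<forall>\<epsilon>\<ge>0. gap_ok m r B F G a b \<epsilon> \<longrightarrow> e \<le> \<epsilon>" by blast
      moreover obtain g where "Sol a b M e g" using sol \<open>a < b\<close> calculation by blast
      ultimately show ?thesis by blast
    qed simp
    then show ?thesis by metis
  qed
  then obtain e g where e: "\<And>a b. gap K a b \<Longrightarrow> 0 \<le> e a b" "\<And>a b \<epsilon>. gap K a b \<Longrightarrow> 0 \<le> \<epsilon> \<Longrightarrow> gap_ok m r B F G a b \<epsilon> \<Longrightarrow> e a b \<le> \<epsilon>"
    and g: "\<And>a b. gap K a b \<Longrightarrow> Sol a b M (e a b) (g a b)" by metis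
  have "\<exists>f. Cm_fam m f \<and> (\<forall>k. \<forall>t\<in>K. f k t = F i k t) \<and> (\<forall>a b k x. gap K a b \<longrightarrow> a \<le> x \<longrightarrow> x \<le> b \<longrightarrow> k \<le> m \<longrightarrow> f k x = g a b i k x)"
    if i: "i \<in> ?I" for i
  proof -
    have jet: "jet m K (F i)" using W[OF i] by (simp add: whitney_field_def)
    obtain N where N: "\<And>k a. k \<le> m \<Longrightarrow> a \<in> K \<Longrightarrow> \<bar>F i k a\<bar> \<le> N" using jet_bounded[OF jet K(1)] by blast
    have N0: "0 \<le> N" using N[of 0] K(2) by (metis abs_ge_zero all_not_in_conv le0 order_trans)
    show ?thesis
    proof (rule glue_gaps[OF K, of m "F i" "\<lambda>a b. g a b i"])
      fix k t and \<epsilon> :: real assume "k \<le> m" "t \<in> K" "\<epsilon> > 0"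
      then show "\<exists>\<delta>>0. \<forall>a\<in>K. \<bar>a - t\<bar> < \<delta> \<longrightarrow> \<bar>F i k a - F i k t\<bar> < \<epsilon>"
        using jet unfolding jet_def continuous_on_iff dist_real_def by blast
    next
      fix k t and \<epsilon> :: real assume "k < m" "t \<in> K" "\<epsilon> > 0"
      then show "\<exists>\<delta>>0. \<forall>a\<in>K. \<bar>a - t\<bar> < \<delta> \<longrightarrow> \<bar>F i k a - F i k t - F i (Suc k) t * (a - t)\<bar> \<le> \<epsilon> * \<bar>a - t\<bar>"
        by (rule whitney_first_order[OF W[OF i]])
    next
      fix a b assume "gap K a b"
      then show "Cm_fam m (g a b i)" using g i unfolding Sol_def by blast
    next
      fix a b k assume "gap K a b" "k \<le> m"
      then show "g a b i k a = F i k a" "g a b i k b = F i k b" using g i unfolding Sol_def by blast+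
    next
      fix \<epsilon> :: real assume \<epsilon>: "\<epsilon> > 0"
      \<comment> \<open>If the least constant \<open>e a b\<close> of a gap is at most s^2 with s
        \<le> 1, then e + sqrt e \<le> 2 s, so the perturbation is at most 2 M s times a power of
        the length. This is to stay below half of the target.\<close>
      define s where "s = min 1 (\<epsilon> / (4 * (M + 1)))"
      have s: "0 < s" "s \<le> 1" "M * (2 * s) < \<epsilon> / 2"
      proof -
        show "0 < s" "s \<le> 1" using \<epsilon> BM by (auto simp: s_def)
        have "M * (2 * s) \<le> M * (2 * (\<epsilon> / (4 * (M + 1))))" using BM by (intro mult_left_mono) (auto simp: s_def)
        also have "\<dots> < \<epsilon> / 2" using BM \<epsilon> by (simp add: field_simps)
        finally show "M * (2 * s) < \<epsilon> / 2" .
      qed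
      have "s\<^sup>2 > 0" using s by simp
      from gen_AV_gap_ok[OF m W AV this, of B] obtain d where d: "d > 0"
        "\<And>a b. a \<in> K \<Longrightarrow> b \<in> K \<Longrightarrow> a < b \<Longrightarrow> b - a < d \<Longrightarrow> gap_ok m r B F G a b (s\<^sup>2)" by blast
      \<comment> \<open>The bound 1 keeps powers of b - a at most 1, \<open>d\<close> gives
        \<open>gap_ok\<close> with s^2, and the last bound makes the Taylor polynomial vary by less
        than \<epsilon> / 2 on the gap, by \<open>tay_near\<close>.\<close>
      define \<delta> where "\<delta> = min (min 1 d) (\<epsilon> / (2 * (real m * N + 1)))"
      have mN: "real m * N + 1 > 0" using N0 by (simp add: add_nonneg_pos)
      show "\<exists>\<delta>>0. \<forall>a b x k. gap K a b \<and> b - a < \<delta> \<and> a \<le> x \<and> x \<le> b \<and> k \<le> m \<longrightarrow> \<bar>g a b i k x - F i k a\<bar> < \<epsilon>"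
      proof (intro exI[of _ \<delta>] conjI allI impI)
        show "\<delta> > 0" using d \<epsilon> mN by (simp add: \<delta>_def)
        fix a b x k assume "gap K a b \<and> b - a < \<delta> \<and> a \<le> x \<and> x \<le> b \<and> k \<le> m"
        then have gp: "gap K a b" and ba: "b - a < \<delta>" and x: "a \<le> x" "x \<le> b" and k: "k \<le> m" by auto
        have abK: "a \<in> K" "b \<in> K" "a < b" using gp by (auto simp: gap_def)
        have "e a b \<le> s\<^sup>2" using e(2)[OF gp _ d(2)[OF abK]] ba by (simp add: \<delta>_def)
        then have "sqrt (e a b) \<le> s" using s by (simp add: real_le_lsqrt)
        moreover have "s\<^sup>2 \<le> s" using s by (simp add: power2_eq_square mult_left_le)
        ultimately have es: "e a b + sqrt (e a b) \<le> 2 * s" using \<open>e a b \<le> s\<^sup>2\<close> by linarith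
        have "\<bar>g a b i k x - tay m (F i) a k x\<bar> \<le> M * (e a b + sqrt (e a b)) * (b - a) ^ (m - k)"
          using g[OF gp] i k x unfolding Sol_def by simp
        also have "\<dots> \<le> M * (2 * s) * 1"
          using es BM e(1)[OF gp] ba abK s by (intro mult_mono power_le_one) (auto simp: \<delta>_def)
        finally have 1: "\<bar>g a b i k x - tay m (F i) a k x\<bar> < \<epsilon> / 2" using s by simp
        have "\<bar>tay m (F i) a k x - F i k a\<bar> \<le> real m * N * (x - a)"
          by (rule tay_near[where F = "F i" and a = a]) (use x ba k N abK(1) in \<open>auto simp: \<delta>_def\<close>)
        also have "\<dots> \<le> (real m * N + 1) * (b - a)" using x N0 by (intro mult_mono) auto
        also have "\<dots> < (real m * N + 1) * (\<epsilon> / (2 * (real m * N + 1)))"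
          using ba mN by (intro mult_strict_left_mono) (auto simp: \<delta>_def)
        also have "\<dots> = \<epsilon> / 2" using mN by (simp add: field_simps)
        finally show "\<bar>g a b i k x - F i k a\<bar> < \<epsilon>" using 1 by linarith
      qed
    next
      fix f assume f: "Cm_fam m f" "\<And>k t. t \<in> K \<Longrightarrow> f k t = F i k t"
        "\<And>a b k x. gap K a b \<Longrightarrow> a \<le> x \<Longrightarrow> x \<le> b \<Longrightarrow> k \<le> m \<Longrightarrow> f k x = g a b i k x"
      then show ?thesis by blast
    qed
  qed
  then have "\<forall>i\<in>?I. \<exists>f. Cm_fam m f \<and> (\<forall>k. \<forall>t\<in>K. f k t = F i k t) \<and> (\<forall>a b k x. gap K a b \<longrightarrow> a \<le> x \<longrightarrow> x \<le> b \<longrightarrow> k \<le> m \<longrightarrow> f k x = g a b i k x)"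
    by blast
  from bchoice[OF this] obtain f where f: "\<forall>i\<in>?I. Cm_fam m (f i) \<and> (\<forall>k. \<forall>t\<in>K. f i k t = F i k t) \<and> (\<forall>a b k x. gap K a b \<longrightarrow> a \<le> x \<longrightarrow> x \<le> b \<longrightarrow> k \<le> m \<longrightarrow> f i k x = g a b i k x)"
    by blast
  show ?thesis
  proof (intro exI[of _ f] conjI ballI allI impI)
    fix i assume i: "i \<in> ?I"
    show "Cm_fam m (f i)" using f i by blast
    show "f i k t = F i k t" if "t \<in> K" for k t using f i that by blast
    fix j a b assume j: "j \<in> ?I" "j < i" and gp: "gap K a b"
    have fg: "f p k x = g a b p k x" if "p \<in> ?I" "k \<le> m" "x \<in> {a..b}" for p k x using f gp that by simp
    have "integral {a..b} (\<lambda>x. f i 0 x * f j 1 x - f i 1 x * f j 0 x) = integral {a..b} (\<lambda>x. g a b i 0 x * g a b j 1 x - g a b i 1 x * g a b j 0 x)"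
      by (rule integral_cong) (use fg[OF i] fg[OF j(1)] m in simp)
    then show "1/2 * integral {a..b} (\<lambda>x. f i 0 x * f j 1 x - f i 1 x * f j 0 x) = G i j 0 b - G i j 0 a"
      using g[OF gp] i j unfolding Sol_def by simp
  qed
qed

section \<open>The polynomials P^k as derivatives of the area density\<close>

definition conv :: "nat \<Rightarrow> (nat \<Rightarrow> real) \<Rightarrow> (nat \<Rightarrow> real) \<Rightarrow> real" where
  "conv n x y = (\<Sum>l\<le>n. real (n choose l) * (x l * y (n - l)))"

text \<open>\<open>conv n\<close> is the Leibniz sum for the n-th derivative of a product, so
  P^(n+1) is half the n-th derivative of f g' - g f'.\<close>

lemma vert_poly_Suc: "vert_poly (Suc n) x y = 1/2 * (conv n x (\<lambda>l. y (Suc l)) - conv n y (\<lambda>l. x (Suc l)))"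
  unfolding vert_poly_def conv_def sum_subtractf[symmetric] atLeast0AtMost
  by (simp add: Suc_diff_le algebra_simps)

text \<open>Pascal's rule; for sequences of derivatives it is the step from the n-th derivative of a
  product to the next.\<close>

lemma conv_Suc: "conv (Suc n) x y = conv n (\<lambda>l. x (Suc l)) y + conv n x (\<lambda>l. y (Suc l))"
proof -
  have 1: "conv n x (\<lambda>l. y (Suc l)) = x 0 * y (Suc n) + (\<Sum>l\<le>n. real (n choose Suc l) * (x (Suc l) * y (n - l)))"
  proof -
    have "conv n x (\<lambda>l. y (Suc l)) = (\<Sum>l\<le>Suc n. real (n choose l) * (x l * y (Suc n - l)))"
      unfolding conv_def by (simp add: Suc_diff_le)
    also have "\<dots> = x 0 * y (Suc n) + (\<Sum>l\<le>n. real (n choose Suc l) * (x (Suc l) * y (n - l)))"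
      unfolding sum.atMost_Suc_shift by simp
    finally show ?thesis .
  qed
  have "conv (Suc n) x y = x 0 * y (Suc n) + (\<Sum>l\<le>n. real (Suc n choose Suc l) * (x (Suc l) * y (n - l)))"
    unfolding conv_def sum.atMost_Suc_shift by simp
  also have "(\<Sum>l\<le>n. real (Suc n choose Suc l) * (x (Suc l) * y (n - l)))
      = conv n (\<lambda>l. x (Suc l)) y + (\<Sum>l\<le>n. real (n choose Suc l) * (x (Suc l) * y (n - l)))"
    unfolding conv_def sum.distrib[symmetric] by (simp add: distrib_right)
  finally show ?thesis unfolding 1 by simp
qed

lemma DERIV_conv:
  assumes "\<And>l. l \<le> n \<Longrightarrow> (x l has_real_derivative x (Suc l) t) (at t)"
    and "\<And>l. l \<le> n \<Longrightarrow> (y l has_real_derivative y (Suc l) t) (at t)"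
  shows "((\<lambda>t. conv n (\<lambda>l. x l t) (\<lambda>l. y l t)) has_real_derivative conv (Suc n) (\<lambda>l. x l t) (\<lambda>l. y l t)) (at t)"
proof -
  have "((\<lambda>t. \<Sum>l\<le>n. real (n choose l) * (x l t * y (n - l) t)) has_real_derivative
      (\<Sum>l\<le>n. real (n choose l) * (x (Suc l) t * y (n - l) t + y (Suc (n - l)) t * x l t))) (at t)"
  proof (rule DERIV_sum)
    fix l assume "l \<in> {..n}"
    then show "((\<lambda>t. real (n choose l) * (x l t * y (n - l) t)) has_real_derivative
       real (n choose l) * (x (Suc l) t * y (n - l) t + y (Suc (n - l)) t * x l t)) (at t)"
      by (intro DERIV_cmult DERIV_mult assms) auto
  qed
  also have "(\<Sum>l\<le>n. real (n choose l) * (x (Suc l) t * y (n - l) t + y (Suc (n - l)) t * x l t)) = conv (Suc n) (\<lambda>l. x l t) (\<lambda>l. y l t)"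
    unfolding conv_Suc unfolding conv_def sum.distrib[symmetric] by (simp add: algebra_simps)
  finally show ?thesis unfolding conv_def .
qed

lemma vert_poly_1: "vert_poly 1 x y = (x 0 * y 1 - x 1 * y 0) / 2"
  by (simp add: vert_poly_def algebra_simps)

lemma DERIV_vert_poly:
  assumes f: "Cm_fam m f" and g: "Cm_fam m g" and n: "Suc n < m"
  shows "((\<lambda>t. vert_poly (Suc n) (\<lambda>l. f l t) (\<lambda>l. g l t)) has_real_derivative vert_poly (Suc (Suc n)) (\<lambda>l. f l t) (\<lambda>l. g l t)) (at t)"
proof -
  have "((\<lambda>t. conv n (\<lambda>l. f l t) (\<lambda>l. g (Suc l) t)) has_real_derivative conv (Suc n) (\<lambda>l. f l t) (\<lambda>l. g (Suc l) t)) (at t)"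
    using DERIV_conv[of n f t "\<lambda>l. g (Suc l)"] Cm_famD[OF f] Cm_famD[OF g] n by simp
  moreover have "((\<lambda>t. conv n (\<lambda>l. g l t) (\<lambda>l. f (Suc l) t)) has_real_derivative conv (Suc n) (\<lambda>l. g l t) (\<lambda>l. f (Suc l) t)) (at t)"
    using DERIV_conv[of n g t "\<lambda>l. f (Suc l)"] Cm_famD[OF f] Cm_famD[OF g] n by simp
  ultimately show ?thesis unfolding vert_poly_Suc by (intro DERIV_cmult DERIV_diff)
qed

text \<open>P^k involves derivatives of f and g up to order k only, since the top ones enter
  linearly through f g' - f' g. So v is of class C^m with derivatives given by condition (2). Both
  directions of the theorem rest on this.\<close>

lemma Cm_fam_vertical:
  assumes m: "1 \<le> m" and f: "Cm_fam m f" and g: "Cm_fam m g"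
    and v: "\<And>t. (v has_real_derivative (f 0 t * g 1 t - f 1 t * g 0 t) / 2) (at t)"
  shows "Cm_fam m (\<lambda>k t. if k = 0 then v t else vert_poly k (\<lambda>l. f l t) (\<lambda>l. g l t))"
  unfolding Cm_fam_def
proof (intro conjI allI impI)
  fix k t assume k: "k < m"
  show "((\<lambda>t. if k = 0 then v t else vert_poly k (\<lambda>l. f l t) (\<lambda>l. g l t)) has_real_derivative
      (if Suc k = 0 then v t else vert_poly (Suc k) (\<lambda>l. f l t) (\<lambda>l. g l t))) (at t)"
  proof (cases k)
    case 0
    have e: "vert_poly (Suc 0) (\<lambda>l. f l t) (\<lambda>l. g l t) = (f 0 t * g 1 t - f 1 t * g 0 t) / 2"
      using vert_poly_1 unfolding One_nat_def by simp
    show ?thesis using v[of t] 0 by (simp only: e if_True refl nat.distinct if_False)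
  next
    case (Suc n)
    then show ?thesis using DERIV_vert_poly[OF f g, of n t] k by simp
  qed
next
  have "continuous_on UNIV (\<lambda>t. vert_poly m (\<lambda>l. f l t) (\<lambda>l. g l t))"
    unfolding vert_poly_def
    by (intro continuous_intros Cm_fam_cont[OF f] Cm_fam_cont[OF g]) auto
  then show "continuous_on UNIV (\<lambda>t. if m = 0 then v t else vert_poly m (\<lambda>l. f l t) (\<lambda>l. g l t))" using m by simp
qed

section \<open>Vertical components and assembly of the curve\<close>

lemma abs_continuous_on_C1:
  assumes d: "\<And>t. (f has_real_derivative f' t) (at t)" and c: "continuous_on UNIV f'"
  shows "abs_continuous_on a b f"
proof -
  have "compact (f' ` {a..b})" by (intro compact_continuous_image continuous_on_subset[OF c]) auto
  then obtain M0 where M0: "\<And>x. x \<in> {a..b} \<Longrightarrow> \<bar>f' x\<bar> \<le> M0"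
    using compact_imp_bounded bounded_iff by (metis image_eqI real_norm_def)
  define M where "M = \<bar>M0\<bar>"
  have M: "\<bar>f' x\<bar> \<le> M" if "x \<in> {a..b}" for x using M0[OF that] by (simp add: M_def)
  have M1: "0 \<le> M" by (simp add: M_def)
  show ?thesis
    unfolding abs_continuous_on_def
  proof (intro allI impI)
    fix \<epsilon> :: real assume e: "\<epsilon> > 0"
    show "\<exists>\<delta>>0. \<forall>d S. d division_of S \<and> S \<subseteq> {a..b} \<and> (\<Sum>I\<in>d. Sup I - Inf I) < \<delta> \<longrightarrow> (\<Sum>I\<in>d. \<bar>f (Sup I) - f (Inf I)\<bar>) < \<epsilon>"
    proof (intro exI[of _ "\<epsilon> / (M + 1)"] conjI allI impI)
      show "0 < \<epsilon> / (M + 1)" using e M1 by simp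
      fix d :: "real set set" and S assume h: "d division_of S \<and> S \<subseteq> {a..b} \<and> (\<Sum>I\<in>d. Sup I - Inf I) < \<epsilon> / (M + 1)"
      have I: "Inf I \<le> Sup I \<and> \<bar>f (Sup I) - f (Inf I)\<bar> \<le> M * (Sup I - Inf I)" if Id: "I \<in> d" for I
      proof -
        have dS: "d division_of S" using h by blast
        have sub: "I \<subseteq> S" "I \<noteq> {}" by (rule division_ofD(2)[OF dS Id], rule division_ofD(3)[OF dS Id])
        obtain x y where "I = cbox x y" using division_ofD(4)[OF dS Id] by blast
        note xy = this sub(2,1)
        then have le: "x \<le> y" by auto
        then have SI: "Sup I = y" "Inf I = x" using xy by auto
        have "I \<subseteq> {a..b}" using sub(1) h by blast
        then have sub: "{x..y} \<subseteq> {a..b}" using xy(1) by simp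
        have "\<bar>f y - f x\<bar> \<le> M * (y - x)"
        proof (cases "x = y")
          case False
          then have "x < y" using le by simp
          from MVT2[OF this, of f f'] d obtain z where z: "x < z" "z < y" "f y - f x = (y - x) * f' z" by blast
          have "z \<in> {a..b}" using sub z by auto
          then have "\<bar>f' z\<bar> \<le> M" by (rule M)
          then show ?thesis using z le by (simp add: abs_mult mult.commute mult_left_mono)
        qed simp
        then show ?thesis using SI le by simp
      qed
      have "(\<Sum>I\<in>d. \<bar>f (Sup I) - f (Inf I)\<bar>) \<le> (\<Sum>I\<in>d. M * (Sup I - Inf I))" using I by (intro sum_mono) auto
      also have "\<dots> = M * (\<Sum>I\<in>d. Sup I - Inf I)" by (simp add: sum_distrib_left)
      also have "\<dots> \<le> M * (\<epsilon> / (M + 1))" using h M1 by (intro mult_left_mono) auto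
      also have "\<dots> < \<epsilon>" using e M1 by (simp add: field_simps)
      finally show "(\<Sum>I\<in>d. \<bar>f (Sup I) - f (Inf I)\<bar>) < \<epsilon>" .
    qed
  qed
qed

lemma horizontal_sum_Hor:
  assumes "l \<in> {1..r}" shows "(\<Sum>k=1..r. u k * horizontal_field k x (Hor l)) = u l"
  using assms by (simp add: if_distrib[where f = "\<lambda>y. _ * y"] cong: if_cong)

lemma horizontal_sum_Ver:
  assumes "1 \<le> j" "j < i" "i \<le> r"
  shows "(\<Sum>k=1..r. u k * horizontal_field k x (Ver i j)) = (x (Hor i) * u j - u i * x (Hor j)) / 2"
proof -
  have "(\<Sum>k=1..r. u k * horizontal_field k x (Ver i j))
      = (\<Sum>k=1..r. (if k = j then u j * x (Hor i) / 2 else 0) + (if k = i then - (u i * x (Hor j) / 2) else 0))"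
    using assms by (intro sum.cong) auto
  also have "\<dots> = u j * x (Hor i) / 2 - u i * x (Hor j) / 2"
    using assms by (simp add: sum.distrib)
  finally show ?thesis by (simp add: field_simps)
qed

lemma build_curve:
  assumes m: "1 \<le> m" and f: "\<And>i. i \<in> {1..r} \<Longrightarrow> Cm_fam m (f i)"
    and V: "\<And>i j. 1 \<le> j \<Longrightarrow> j < i \<Longrightarrow> i \<le> r \<Longrightarrow> Cm_fam m (V i j)"
    and V1: "\<And>i j t. 1 \<le> j \<Longrightarrow> j < i \<Longrightarrow> i \<le> r \<Longrightarrow> V i j 1 t = (f i 0 t * f j 1 t - f i 1 t * f j 0 t) / 2"
  shows "\<exists>\<gamma>. C_horizontal_curve m r \<gamma> \<and> (\<forall>i. 1 \<le> i \<and> i \<le> r \<longrightarrow> (\<lambda>s. \<gamma> s (Hor i)) = f i 0) \<and>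
     (\<forall>i j. 1 \<le> j \<and> j < i \<and> i \<le> r \<longrightarrow> (\<lambda>s. \<gamma> s (Ver i j)) = V i j 0)"
proof -
  define D where "D c = (case c of Hor i \<Rightarrow> f i | Ver i j \<Rightarrow> V i j)" for c
  define \<gamma> where "\<gamma> t = restrict (\<lambda>c. D c 0 t) (coords r)" for t
  have D: "Cm_fam m (D c)" if "c \<in> coords r" for c using that f V by (auto simp: coords_def D_def)
  have \<gamma>D: "(\<lambda>t. \<gamma> t c) = D c 0" if "c \<in> coords r" for c using that by (simp add: \<gamma>_def)
  have D1: "(D c 0 has_real_derivative D c 1 t) (at t)" if "c \<in> coords r" for c t
    using Cm_famD[OF D[OF that], of 0 t] m by simp
  have "horizontal_curve r \<gamma>"
    unfolding horizontal_curve_def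
  proof (intro conjI ballI allI)
    show "\<gamma> \<in> UNIV \<rightarrow> carrier (free_carnot r)" by (auto simp: free_carnot_def \<gamma>_def)
    fix c a b assume c: "c \<in> coords r"
    show "abs_continuous_on a b (\<lambda>t. \<gamma> t c)"
      unfolding \<gamma>D[OF c] by (rule abs_continuous_on_C1[OF D1[OF c] Cm_fam_cont[OF D[OF c] m]])
  next
    show "AE t in lebesgue. \<exists>v\<in>horizontal_space r (\<gamma> t). \<forall>c\<in>coords r. ((\<lambda>s. \<gamma> s c) has_real_derivative v c) (at t)"
    proof (rule AE_I2, rule bexI)
      fix t
      \<comment> \<open>The coordinate x_k forces the coefficient of X_k to be the derivative of
        f_k; the vertical entries then agree by \<open>V1\<close>.\<close>
      define v where "v = restrict (\<lambda>c. \<Sum>k=1..r. f k 1 t * horizontal_field k (\<gamma> t) c) (coords r)"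
      show "v \<in> horizontal_space r (\<gamma> t)"
        unfolding horizontal_space_def v_def by (rule CollectI, rule exI[of _ "\<lambda>k. f k 1 t"]) simp
      show "\<forall>c\<in>coords r. ((\<lambda>s. \<gamma> s c) has_real_derivative v c) (at t)"
      proof
        fix c assume c: "c \<in> coords r"
        have "v c = D c 1 t"
        proof (cases c)
          case (Hor i)
          then have i: "i \<in> {1..r}" using c by (auto simp: coords_def)
          have "v c = (\<Sum>k=1..r. f k 1 t * horizontal_field k (\<gamma> t) (Hor i))" using c Hor by (simp add: v_def)
          then show ?thesis unfolding horizontal_sum_Hor[OF i] by (simp add: D_def Hor)
        next
          case (Ver i j)
          then have ij: "1 \<le> j" "j < i" "i \<le> r" using c by (auto simp: coords_def)
          then have h: "Hor i \<in> coords r" "Hor j \<in> coords r" by (auto simp: coords_def)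
          have "v c = (\<Sum>k=1..r. f k 1 t * horizontal_field k (\<gamma> t) (Ver i j))" using c Ver by (simp add: v_def)
          then show ?thesis unfolding horizontal_sum_Ver[OF ij] using h V1[OF ij, of t]
            by (simp add: D_def Ver \<gamma>_def)
        qed
        then show "((\<lambda>s. \<gamma> s c) has_real_derivative v c) (at t)" unfolding \<gamma>D[OF c] using D1[OF c] by simp
      qed
    qed
  qed
  moreover have "\<forall>c\<in>coords r. C_class m (\<lambda>t. \<gamma> t c)" using \<gamma>D Cm_fam_C_class[OF D] by simp
  ultimately have "C_horizontal_curve m r \<gamma>" by (simp add: C_horizontal_curve_def)
  moreover have "(\<lambda>s. \<gamma> s (Hor i)) = f i 0" if "1 \<le> i \<and> i \<le> r" for i
    using \<gamma>D[of "Hor i"] that by (simp add: coords_def D_def)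
  moreover have "(\<lambda>s. \<gamma> s (Ver i j)) = V i j 0" if "1 \<le> j \<and> j < i \<and> i \<le> r" for i j
    using \<gamma>D[of "Ver i j"] that by (simp add: coords_def D_def)
  ultimately show ?thesis by blast
qed

lemma antiderivative_UNIV:
  fixes w :: "real \<Rightarrow> real"
  assumes "continuous_on UNIV w"
  shows "\<exists>W. \<forall>t. (W has_real_derivative w t) (at t)"
proof -
  have "isCont w t" for t using assms by (simp add: continuous_on_eq_continuous_at)
  then have "\<exists>W. \<forall>x::real. - \<infinity> < ereal x \<longrightarrow> ereal x < \<infinity> \<longrightarrow> (W has_vector_derivative w x) (at x)"
    by (intro einterval_antiderivative) auto
  then show ?thesis by (simp add: has_real_derivative_iff_has_vector_derivative)
qed

text \<open>Let U be an antiderivative of the area density. Along \<open>K\<close> the difference H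
  - U has derivative zero, by the Whitney condition and \<open>H1\<close>, and \<open>gaps\<close>
  makes it equal at the two ends of each gap. By \<open>constant_across_gaps\<close> it is constant
  on \<open>K\<close>, so U shifted by that constant is the component sought.\<close>

lemma vertical_extension:
  assumes m: "1 \<le> m" and K: "compact K" "K \<noteq> {}" and f: "Cm_fam m f" and g: "Cm_fam m g"
    and W: "whitney_field m K H"
    and H1: "\<And>t. t \<in> K \<Longrightarrow> H 1 t = (f 0 t * g 1 t - f 1 t * g 0 t) / 2"
    and gaps: "\<And>a b. gap K a b \<Longrightarrow> 1/2 * integral {a..b} (\<lambda>x. f 0 x * g 1 x - f 1 x * g 0 x) = H 0 b - H 0 a"
  shows "\<exists>v. (\<forall>t. (v has_real_derivative (f 0 t * g 1 t - f 1 t * g 0 t) / 2) (at t)) \<and> (\<forall>t\<in>K. v t = H 0 t)"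
proof -
  define w where "w t = (f 0 t * g 1 t - f 1 t * g 0 t) / 2" for t
  have cw: "continuous_on UNIV w"
    unfolding w_def by (intro continuous_intros Cm_fam_cont[OF f] Cm_fam_cont[OF g]) (use m in auto)
  obtain U where U: "\<And>t. (U has_real_derivative w t) (at t)" using antiderivative_UNIV[OF cw] by blast
  have const: "H 0 s - U s = H 0 t - U t" if "s \<in> K" "t \<in> K" for s t
  proof (rule constant_across_gaps[OF K(1) _ _ that, where N = "\<lambda>t. H 0 t - U t"])
    fix t \<epsilon> :: real assume t: "t \<in> K" and e: "\<epsilon> > 0"
    have e2: "\<epsilon> / 2 > 0" using e by simp
    obtain d1 where d1: "d1 > 0" "\<And>a. a \<in> K \<Longrightarrow> \<bar>a - t\<bar> < d1 \<Longrightarrow> \<bar>H 0 a - H 0 t - H (Suc 0) t * (a - t)\<bar> \<le> \<epsilon> / 2 * \<bar>a - t\<bar>"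
      using whitney_first_order[OF W _ t e2, of 0] m by auto
    have "\<forall>e>0. \<exists>d>0. \<forall>y. norm (y - t) < d \<longrightarrow> norm (U y - U t - w t * (y - t)) \<le> e * norm (y - t)"
      using U[of t] unfolding has_field_derivative_def has_derivative_at_alt by (rule conjunct2)
    then obtain d2 where d2: "d2 > 0" "\<And>y. \<bar>y - t\<bar> < d2 \<Longrightarrow> \<bar>U y - U t - w t * (y - t)\<bar> \<le> \<epsilon> / 2 * \<bar>y - t\<bar>"
      using e2 unfolding real_norm_def by meson
    show "\<exists>\<delta>>0. \<forall>a\<in>K. \<bar>a - t\<bar> < \<delta> \<longrightarrow> \<bar>(H 0 a - U a) - (H 0 t - U t)\<bar> \<le> \<epsilon> * \<bar>a - t\<bar>"
    proof (intro exI[of _ "min d1 d2"] conjI ballI impI)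
      fix a assume a: "a \<in> K" "\<bar>a - t\<bar> < min d1 d2"
      have "H (Suc 0) t = w t" using H1[OF t] by (simp add: w_def)
      then have "\<bar>H 0 a - H 0 t - w t * (a - t)\<bar> \<le> \<epsilon> / 2 * \<bar>a - t\<bar>" using d1(2)[OF a(1)] a(2) by simp
      moreover have "\<bar>U a - U t - w t * (a - t)\<bar> \<le> \<epsilon> / 2 * \<bar>a - t\<bar>" using d2(2)[of a] a(2) by simp
      moreover have "\<epsilon> * \<bar>a - t\<bar> = \<epsilon> / 2 * \<bar>a - t\<bar> + \<epsilon> / 2 * \<bar>a - t\<bar>" by (simp add: field_simps)
      ultimately show "\<bar>(H 0 a - U a) - (H 0 t - U t)\<bar> \<le> \<epsilon> * \<bar>a - t\<bar>" by linarith
    qed (use d1 d2 in auto)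
  next
    fix a b assume gp: "gap K a b"
    then have ab: "a \<le> b" by (simp add: gap_def)
    have "(w has_integral U b - U a) {a..b}"
      by (rule fundamental_theorem_of_calculus[OF ab])
        (auto simp: has_real_derivative_iff_has_vector_derivative[symmetric] intro: has_field_derivative_at_within U)
    then have "integral {a..b} w = U b - U a" by (rule integral_unique)
    moreover have "integral {a..b} w = 1/2 * integral {a..b} (\<lambda>x. f 0 x * g 1 x - f 1 x * g 0 x)"
      unfolding w_def by (simp add: integral_divide)
    ultimately show "H 0 b - U b = H 0 a - U a" using gaps[OF gp] by simp
  qed
  obtain t0 where t0: "t0 \<in> K" using K by blast
  show ?thesis
  proof (intro exI[of _ "\<lambda>t. U t + (H 0 t0 - U t0)"] conjI allI ballI)
    show "((\<lambda>t. U t + (H 0 t0 - U t0)) has_real_derivative (f 0 t * g 1 t - f 1 t * g 0 t) / 2) (at t)" for t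
      using DERIV_add[OF U[of t] DERIV_const[of "H 0 t0 - U t0"]] by (simp add: w_def)
    show "U t + (H 0 t0 - U t0) = H 0 t" if "t \<in> K" for t using const[OF that t0] by simp
  qed
qed

lemma sufficiency:
  assumes m: "1 \<le> m" and K: "compact K"
    and WF: "\<And>i. 1 \<le> i \<Longrightarrow> i \<le> r \<Longrightarrow> whitney_field m K (F i)"
    and WG: "\<And>i j. 1 \<le> j \<Longrightarrow> j < i \<Longrightarrow> i \<le> r \<Longrightarrow> whitney_field m K (G i j)"
    and P: "\<And>k t i j. 1 \<le> k \<Longrightarrow> k \<le> m \<Longrightarrow> t \<in> K \<Longrightarrow> 1 \<le> j \<Longrightarrow> j < i \<Longrightarrow> i \<le> r \<Longrightarrow>
       G i j k t = vert_poly k (\<lambda>l. F i l t) (\<lambda>l. F j l t)"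
    and AV: "gen_AV_condition m r K F G"
  shows "\<exists>\<gamma>. C_horizontal_curve m r \<gamma> \<and>
            (\<forall>k\<le>m. \<forall>i. 1 \<le> i \<and> i \<le> r \<longrightarrow>
               (\<forall>t\<in>K. (deriv ^^ k) (\<lambda>s. \<gamma> s (Hor i)) t = F i k t)) \<and>
            (\<forall>k\<le>m. \<forall>i j. 1 \<le> j \<and> j < i \<and> i \<le> r \<longrightarrow>
               (\<forall>t\<in>K. (deriv ^^ k) (\<lambda>s. \<gamma> s (Ver i j)) t = G i j k t))"
proof (cases "K = {}")
  \<comment> \<open>The gluing starts from the extreme points of \<open>K\<close>, so the empty set
    is treated apart, by the zero curve.\<close>
  case True
  obtain \<gamma> where "C_horizontal_curve m r \<gamma>"
    using build_curve[OF m, of r "\<lambda>i k t. 0" "\<lambda>i j k t. 0"] Cm_fam_zero by auto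
  then show ?thesis using True by blast
next
  case ne: False
  have "\<exists>f. (\<forall>i\<in>{1..r}. Cm_fam m (f i) \<and> (\<forall>k. \<forall>t\<in>K. f i k t = F i k t)) \<and>
     (\<forall>i\<in>{1..r}. \<forall>j\<in>{1..r}. j < i \<longrightarrow> (\<forall>a b. gap K a b \<longrightarrow>
        1/2 * integral {a..b} (\<lambda>x. f i 0 x * f j 1 x - f i 1 x * f j 0 x) = G i j 0 b - G i j 0 a))"
    by (rule horizontal_extension[OF m K ne _ AV]) (use WF in simp)
  then obtain f where
    ext: "(\<forall>i\<in>{1..r}. Cm_fam m (f i) \<and> (\<forall>k. \<forall>t\<in>K. f i k t = F i k t)) \<and>
     (\<forall>i\<in>{1..r}. \<forall>j\<in>{1..r}. j < i \<longrightarrow> (\<forall>a b. gap K a b \<longrightarrow>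
        1/2 * integral {a..b} (\<lambda>x. f i 0 x * f j 1 x - f i 1 x * f j 0 x) = G i j 0 b - G i j 0 a))"
    by (elim exE) (rule that)
  have f: "\<And>i. i \<in> {1..r} \<Longrightarrow> Cm_fam m (f i)" "\<And>i k t. i \<in> {1..r} \<Longrightarrow> t \<in> K \<Longrightarrow> f i k t = F i k t"
    using ext by blast+
  have fgap: "\<And>i j a b. i \<in> {1..r} \<Longrightarrow> j \<in> {1..r} \<Longrightarrow> j < i \<Longrightarrow> gap K a b \<Longrightarrow>
        1/2 * integral {a..b} (\<lambda>x. f i 0 x * f j 1 x - f i 1 x * f j 0 x) = G i j 0 b - G i j 0 a"
    using ext by blast
  define Q where "Q i j v \<longleftrightarrow> (\<forall>t. (v has_real_derivative (f i 0 t * f j 1 t - f i 1 t * f j 0 t) / 2) (at t)) \<and> (\<forall>t\<in>K. v t = G i j 0 t)" for i j v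
  have ex: "\<exists>v. Q i j v" if ij: "1 \<le> j" "j < i" "i \<le> r" for i j
    unfolding Q_def
  proof (rule vertical_extension[where f = "f i" and g = "f j" and H = "G i j", OF m K ne])
    have I: "i \<in> {1..r}" "j \<in> {1..r}" using ij by auto
    show "Cm_fam m (f i)" "Cm_fam m (f j)" using f I by auto
    show "whitney_field m K (G i j)" using WG ij by simp
    show "G i j 1 t = (f i 0 t * f j 1 t - f i 1 t * f j 0 t) / 2" if tK: "t \<in> K" for t
      using P[of 1, OF order_refl m tK ij] unfolding vert_poly_1 f(2)[OF I(1) tK] f(2)[OF I(2) tK] .
    show "1/2 * integral {a..b} (\<lambda>x. f i 0 x * f j 1 x - f i 1 x * f j 0 x) = G i j 0 b - G i j 0 a" if gp: "gap K a b" for a b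
      by (rule fgap[OF I ij(2) gp])
  qed
  define v where "v i j = (SOME v. Q i j v)" for i j
  have Q: "Q i j (v i j)" if "1 \<le> j" "j < i" "i \<le> r" for i j unfolding v_def by (rule someI_ex[OF ex[OF that]])
  have v: "(v i j has_real_derivative (f i 0 t * f j 1 t - f i 1 t * f j 0 t) / 2) (at t)" "t \<in> K \<Longrightarrow> v i j t = G i j 0 t"
    if "1 \<le> j" "j < i" "i \<le> r" for i j t using Q[OF that] unfolding Q_def by blast+
  define V where "V i j k t = (if k = 0 then v i j t else vert_poly k (\<lambda>l. f i l t) (\<lambda>l. f j l t))" for i j k t
  have CV: "Cm_fam m (V i j)" if ij: "1 \<le> j" "j < i" "i \<le> r" for i j
    unfolding V_def by (rule Cm_fam_vertical[where f = "f i" and g = "f j", OF m f(1) f(1) v(1)[OF ij]]) (use ij in auto)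
  have V1: "V i j 1 t = (f i 0 t * f j 1 t - f i 1 t * f j 0 t) / 2" for i j t
    by (simp add: V_def vert_poly_1[unfolded One_nat_def])
  obtain \<gamma> where \<gamma>: "C_horizontal_curve m r \<gamma>" "\<And>i. 1 \<le> i \<Longrightarrow> i \<le> r \<Longrightarrow> (\<lambda>s. \<gamma> s (Hor i)) = f i 0"
    "\<And>i j. 1 \<le> j \<Longrightarrow> j < i \<Longrightarrow> i \<le> r \<Longrightarrow> (\<lambda>s. \<gamma> s (Ver i j)) = V i j 0"
  proof -
    have "\<exists>\<gamma>. C_horizontal_curve m r \<gamma> \<and> (\<forall>i. 1 \<le> i \<and> i \<le> r \<longrightarrow> (\<lambda>s. \<gamma> s (Hor i)) = f i 0) \<and>
     (\<forall>i j. 1 \<le> j \<and> j < i \<and> i \<le> r \<longrightarrow> (\<lambda>s. \<gamma> s (Ver i j)) = V i j 0)"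
      by (rule build_curve[OF m]) (rule f(1) CV V1; assumption)+
    then show ?thesis using that by blast
  qed
  show ?thesis
  proof (intro exI[of _ \<gamma>] conjI allI impI ballI)
    show "C_horizontal_curve m r \<gamma>" by fact
    fix k i t assume k: "k \<le> m" and i: "1 \<le> i \<and> i \<le> r" and t: "t \<in> K"
    show "(deriv ^^ k) (\<lambda>s. \<gamma> s (Hor i)) t = F i k t"
      using \<gamma>(2)[of i] Cm_fam_funpow_deriv[OF f(1) k, of i] f(2)[of i t k] i t by simp
  next
    fix k i j t assume k: "k \<le> m" and ij: "1 \<le> j \<and> j < i \<and> i \<le> r" and t: "t \<in> K"
    then have ij': "1 \<le> j" "j < i" "i \<le> r" "i \<in> {1..r}" "j \<in> {1..r}" by auto
    have "(deriv ^^ k) (\<lambda>s. \<gamma> s (Ver i j)) t = V i j k t"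
      unfolding \<gamma>(3)[OF ij'(1-3)] Cm_fam_funpow_deriv[OF CV[OF ij'(1-3)] k] ..
    also have "\<dots> = G i j k t"
      using v(2)[OF ij'(1-3) t] P[OF _ k t ij'(1-3)] f(2)[OF ij'(4) t] f(2)[OF ij'(5) t] by (cases "k = 0") (simp_all add: V_def)
    finally show "(deriv ^^ k) (\<lambda>s. \<gamma> s (Ver i j)) t = G i j k t" .
  qed
qed

section \<open>Necessity\<close>

text \<open>Subtracting the top Taylor term from the Lagrange remainder leaves an increment of
  \<open>f m\<close>, divided by a factorial that is at least 1. The point \<xi> may be an end point
  so as to cover k = m and a = b.\<close>

lemma taylor_remainder:
  assumes f: "Cm_fam m f" and k: "k \<le> m"
  shows "\<exists>\<xi>. min a b \<le> \<xi> \<and> \<xi> \<le> max a b \<and> \<bar>f k b - tay m f a k b\<bar> \<le> \<bar>f m \<xi> - f m a\<bar> * \<bar>b - a\<bar> ^ (m - k)"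
proof (cases "k = m \<or> a = b")
  case True
  then show ?thesis
  proof
    assume "k = m"
    then show ?thesis by (intro exI[of _ b]) (auto simp: tay_def)
  qed (auto intro!: exI[of _ a])
next
  case False
  define n where "n = m - k"
  have n: "0 < n" "k + n = m" using False k by (auto simp: n_def)
  have "\<exists>t. (if b < a then b < t \<and> t < a else a < t \<and> t < b) \<and>
      f k b = (\<Sum>l<n. f (k + l) a / fact l * (b - a) ^ l) + f (k + n) t / fact n * (b - a) ^ n"
  proof (rule Taylor[where a = "min a b" and b = "max a b" and diff = "\<lambda>l. f (k + l)"])
    show "\<forall>l t. l < n \<and> min a b \<le> t \<and> t \<le> max a b \<longrightarrow> (f (k + l) has_real_derivative f (k + Suc l) t) (at t)"
      using Cm_famD[OF f] n by auto
  qed (use n False in auto)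
  then obtain t where t: "if b < a then b < t \<and> t < a else a < t \<and> t < b"
    and eq: "f k b = (\<Sum>l<n. f (k + l) a / fact l * (b - a) ^ l) + f m t / fact n * (b - a) ^ n" unfolding n(2) by blast
  have "tay m f a k b = (\<Sum>l<n. f (k + l) a / fact l * (b - a) ^ l) + f m a / fact n * (b - a) ^ n"
    unfolding tay_def n_def[symmetric] lessThan_Suc_atMost[symmetric] sum.lessThan_Suc n(2) ..
  then have "f k b - tay m f a k b = (f m t - f m a) / fact n * (b - a) ^ n" unfolding eq by (simp add: field_simps)
  then have "\<bar>f k b - tay m f a k b\<bar> = \<bar>f m t - f m a\<bar> / fact n * \<bar>b - a\<bar> ^ n" by (simp add: abs_mult power_abs)
  also have "\<dots> \<le> \<bar>f m t - f m a\<bar> / 1 * \<bar>b - a\<bar> ^ n"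
    by (intro mult_right_mono divide_left_mono) (auto simp: fact_ge_1)
  finally show ?thesis using t unfolding n_def by (intro exI[of _ t]) (auto split: if_splits)
qed

text \<open>Uniform continuity of \<open>f m\<close> is taken on an interval and not just on
  \<open>K\<close>, since the intermediate point of Taylor's formula may lie in a gap.\<close>

lemma taylor_uniform:
  fixes A B :: real
  assumes f: "Cm_fam m f" and e: "\<epsilon> > 0"
  shows "\<exists>\<delta>>0. \<forall>a\<in>{A..B}. \<forall>b\<in>{A..B}. \<bar>b - a\<bar> < \<delta> \<longrightarrow> (\<forall>k\<le>m. \<bar>f k b - tay m f a k b\<bar> \<le> \<epsilon> * \<bar>b - a\<bar> ^ (m - k))"
proof -
  have "uniformly_continuous_on {A..B} (f m)"
    by (intro compact_uniformly_continuous Cm_fam_cont[OF f] compact_Icc) simp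
  then obtain d where d: "d > 0" "\<And>x y. x \<in> {A..B} \<Longrightarrow> y \<in> {A..B} \<Longrightarrow> \<bar>y - x\<bar> < d \<Longrightarrow> \<bar>f m y - f m x\<bar> < \<epsilon>"
    using e unfolding uniformly_continuous_on_def dist_real_def by metis
  show ?thesis
  proof (intro exI[of _ d] conjI ballI impI allI)
    fix a b k assume ab: "a \<in> {A..B}" "b \<in> {A..B}" "\<bar>b - a\<bar> < d" and k: "k \<le> m"
    obtain \<xi> where x: "min a b \<le> \<xi>" "\<xi> \<le> max a b" "\<bar>f k b - tay m f a k b\<bar> \<le> \<bar>f m \<xi> - f m a\<bar> * \<bar>b - a\<bar> ^ (m - k)"
      using taylor_remainder[OF f k] by blast
    have "\<bar>f m \<xi> - f m a\<bar> < \<epsilon>" by (rule d(2)) (use x ab in auto)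
    then have "\<bar>f m \<xi> - f m a\<bar> * \<bar>b - a\<bar> ^ (m - k) \<le> \<epsilon> * \<bar>b - a\<bar> ^ (m - k)" by (intro mult_right_mono) auto
    then show "\<bar>f k b - tay m f a k b\<bar> \<le> \<epsilon> * \<bar>b - a\<bar> ^ (m - k)" using x(3) by linarith
  qed (use d in auto)
qed

lemma tay_cong: "(\<And>k. k \<le> m \<Longrightarrow> F k a = f k a) \<Longrightarrow> k \<le> m \<Longrightarrow> tay m F a k x = tay m f a k x"
  unfolding tay_def by (intro sum.cong) auto

lemma compact_real_subset_Icc:
  fixes K :: "real set"
  assumes "compact K" shows "\<exists>A B. K \<subseteq> {A..B}"
proof -
  obtain N where "\<And>x. x \<in> K \<Longrightarrow> \<bar>x\<bar> \<le> N" using compact_imp_bounded[OF assms] bounded_iff by (metis real_norm_def)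
  then have "K \<subseteq> {- N..N}" by (auto simp: abs_le_iff minus_le_iff)
  then show ?thesis by blast
qed

lemma Cm_fam_whitney:
  assumes f: "Cm_fam m f" and K: "compact K" and F: "\<And>k t. k \<le> m \<Longrightarrow> t \<in> K \<Longrightarrow> F k t = f k t"
  shows "whitney_field m K F"
  unfolding whitney_field_def
proof (intro conjI allI impI)
  have "continuous_on K (F k)" if "k \<le> m" for k
    using Cm_fam_cont[OF f that, of K] F[OF that] by (simp cong: continuous_on_cong)
  then show "jet m K F" by (simp add: jet_def)
  fix k and \<epsilon> :: real assume k: "k \<le> m" and e: "\<epsilon> > 0"
  obtain A B where AB: "K \<subseteq> {A..B}" using compact_real_subset_Icc[OF K] by blast
  have "\<epsilon> / 2 > 0" using e by simp
  from taylor_uniform[OF f this, of A B] obtain d where d: "d > 0"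
    "\<And>a b. a \<in> {A..B} \<Longrightarrow> b \<in> {A..B} \<Longrightarrow> \<bar>b - a\<bar> < d \<Longrightarrow> \<bar>f k b - tay m f a k b\<bar> \<le> \<epsilon> / 2 * \<bar>b - a\<bar> ^ (m - k)" using k by blast
  show "\<exists>\<delta>>0. \<forall>a\<in>K. \<forall>b\<in>K. a \<noteq> b \<and> \<bar>a - b\<bar> < \<delta> \<longrightarrow>
        \<bar>F k b - (\<Sum>l\<le>m - k. F (k + l) a / fact l * (b - a) ^ l)\<bar> / \<bar>b - a\<bar> ^ (m - k) < \<epsilon>"
  proof (intro exI[of _ d] conjI ballI impI)
    fix a b assume ab: "a \<in> K" "b \<in> K" "a \<noteq> b \<and> \<bar>a - b\<bar> < d"
    have p: "\<bar>b - a\<bar> ^ (m - k) > 0" using ab by simp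
    have "tay m F a k b = tay m f a k b" by (rule tay_cong) (use F ab(1) k in auto)
    then have "\<bar>F k b - tay m F a k b\<bar> \<le> \<epsilon> / 2 * \<bar>b - a\<bar> ^ (m - k)"
    proof -
      have "a \<in> {A..B}" "b \<in> {A..B}" "\<bar>b - a\<bar> < d" using AB ab by (auto simp: abs_minus_commute)
      from d(2)[OF this] show ?thesis using \<open>tay m F a k b = tay m f a k b\<close> F[OF k ab(2)] by simp
    qed
    also have "\<dots> < \<epsilon> * \<bar>b - a\<bar> ^ (m - k)" using p e by simp
    finally show "\<bar>F k b - (\<Sum>l\<le>m - k. F (k + l) a / fact l * (b - a) ^ l)\<bar> / \<bar>b - a\<bar> ^ (m - k) < \<epsilon>"
      using p by (simp add: tay_def pos_divide_less_eq)
  qed (use d in auto)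
qed

text \<open>The set where p and q differ is open, and a nonempty open set contains an interval,
  which is not negligible.\<close>

lemma AE_lebesgue_continuous_eq:
  fixes p q :: "real \<Rightarrow> real"
  assumes "continuous_on UNIV p" "continuous_on UNIV q" "AE t in lebesgue. p t = q t"
  shows "p t = q t"
proof (rule ccontr)
  assume "p t \<noteq> q t"
  have "open {t. p t \<noteq> q t}" using assms(1,2) by (intro open_Collect_neq)
  then obtain e where e: "e > 0" "\<And>x. dist x t < e \<Longrightarrow> p x \<noteq> q x"
    using \<open>p t \<noteq> q t\<close> unfolding open_dist by blast
  obtain N where N: "N \<in> null_sets lebesgue" "{x \<in> space lebesgue. \<not> p x = q x} \<subseteq> N"
    using assms(3) unfolding eventually_ae_filter by blast
  have "{t - e/2..t + e/2} \<subseteq> N" using e N(2) by (force simp: dist_real_def)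
  moreover have "negligible N" using N(1) by (simp add: negligible_iff_null_sets)
  ultimately have "negligible (cbox (t - e/2) (t + e/2))" by (auto intro: negligible_subset)
  then show False unfolding negligible_interval using e by simp
qed

text \<open>Horizontality is given almost everywhere, but \<open>K\<close> may be a null set. As m
  \<ge> 1, both sides are continuous, so the identity extends to every t.\<close>

lemma horizontal_velocity:
  assumes m: "1 \<le> m" and \<gamma>: "C_horizontal_curve m r \<gamma>" and ij: "1 \<le> j" "j < i" "i \<le> r"
  shows "deriv (\<lambda>s. \<gamma> s (Ver i j)) t =
     (\<gamma> t (Hor i) * deriv (\<lambda>s. \<gamma> s (Hor j)) t - deriv (\<lambda>s. \<gamma> s (Hor i)) t * \<gamma> t (Hor j)) / 2"
proof -
  have c: "Hor i \<in> coords r" "Hor j \<in> coords r" "Ver i j \<in> coords r" using ij by (auto simp: coords_def)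
  have ijr: "i \<in> {1..r}" "j \<in> {1..r}" using ij by auto
  have C: "Cm_fam m (\<lambda>k. (deriv ^^ k) (\<lambda>s. \<gamma> s x))" if "x \<in> coords r" for x
    using \<gamma> that C_class_Cm_fam by (auto simp: C_horizontal_curve_def)
  have cont: "continuous_on UNIV (\<lambda>s. \<gamma> s x)" "continuous_on UNIV (deriv (\<lambda>s. \<gamma> s x))" if "x \<in> coords r" for x
    using Cm_fam_cont[OF C[OF that], of 0 UNIV] Cm_fam_cont[OF C[OF that], of 1 UNIV] m by simp_all
  show ?thesis
  proof (rule AE_lebesgue_continuous_eq[where q = "\<lambda>t. (\<gamma> t (Hor i) * deriv (\<lambda>s. \<gamma> s (Hor j)) t - deriv (\<lambda>s. \<gamma> s (Hor i)) t * \<gamma> t (Hor j)) / 2"])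
    show "continuous_on UNIV (deriv (\<lambda>s. \<gamma> s (Ver i j)))" by (rule cont(2)[OF c(3)])
    show "continuous_on UNIV (\<lambda>t. (\<gamma> t (Hor i) * deriv (\<lambda>s. \<gamma> s (Hor j)) t - deriv (\<lambda>s. \<gamma> s (Hor i)) t * \<gamma> t (Hor j)) / 2)"
      by (intro continuous_intros cont c) auto
    have "AE t in lebesgue. \<exists>v\<in>horizontal_space r (\<gamma> t). \<forall>c\<in>coords r. ((\<lambda>s. \<gamma> s c) has_real_derivative v c) (at t)"
      using \<gamma> by (simp add: C_horizontal_curve_def horizontal_curve_def)
    then show "AE t in lebesgue. deriv (\<lambda>s. \<gamma> s (Ver i j)) t =
       (\<gamma> t (Hor i) * deriv (\<lambda>s. \<gamma> s (Hor j)) t - deriv (\<lambda>s. \<gamma> s (Hor i)) t * \<gamma> t (Hor j)) / 2"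
    proof eventually_elim
      case (elim t)
      then obtain v where v: "v \<in> horizontal_space r (\<gamma> t)" "\<And>c. c\<in>coords r \<Longrightarrow> ((\<lambda>s. \<gamma> s c) has_real_derivative v c) (at t)" by blast
      then obtain u where u: "v = restrict (\<lambda>c. \<Sum>k=1..r. u k * horizontal_field k (\<gamma> t) c) (coords r)"
        by (auto simp: horizontal_space_def)
      have d: "deriv (\<lambda>s. \<gamma> s c) t = v c" if "c \<in> coords r" for c using v(2)[OF that] by (rule DERIV_imp_deriv)
      have "v (Hor i) = u i" "v (Hor j) = u j" "v (Ver i j) = (\<gamma> t (Hor i) * u j - u i * \<gamma> t (Hor j)) / 2"
        unfolding u using c horizontal_sum_Hor[OF ijr(1)] horizontal_sum_Hor[OF ijr(2)] horizontal_sum_Ver[OF ij]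
        by (simp_all only: restrict_apply if_True)
      then show ?case using d[OF c(1)] d[OF c(2)] d[OF c(3)] by simp
    qed
  qed
qed

text \<open>Of the three terms in \<open>area_difference\<close>, the first contains increments and
  the second velocities of T and S, so both are at most w (b - a)^m times the L^1 norms of the
  velocities. The third contains remainders only and is quadratic in w.\<close>

lemma area_bound:
  fixes f g T S :: "nat \<Rightarrow> real \<Rightarrow> real"
  assumes C: "Cm_fam m f" "Cm_fam m g" "Cm_fam m T" "Cm_fam m S" and m: "1 \<le> m" and ab: "a \<le> b"
    and fa: "f 0 a = T 0 a" and ga: "g 0 a = S 0 a" and w: "0 \<le> w"
    and fT: "\<And>k x. k \<le> 1 \<Longrightarrow> x \<in> {a..b} \<Longrightarrow> \<bar>f k x - T k x\<bar> \<le> w * (b - a) ^ (m - k)"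
    and gS: "\<And>k x. k \<le> 1 \<Longrightarrow> x \<in> {a..b} \<Longrightarrow> \<bar>g k x - S k x\<bar> \<le> w * (b - a) ^ (m - k)"
  shows "\<bar>1/2 * integral {a..b} (\<lambda>x. f 0 x * g 1 x - f 1 x * g 0 x) - 1/2 * integral {a..b} (\<lambda>x. T 0 x * S 1 x - T 1 x * S 0 x)
      + 1/2 * S 0 a * (f 0 b - T 0 b) - 1/2 * T 0 a * (g 0 b - S 0 b)\<bar>
    \<le> 2 * w * (b - a) ^ m * (integral {a..b} (\<lambda>x. \<bar>T 1 x\<bar>) + integral {a..b} (\<lambda>x. \<bar>S 1 x\<bar>)) + w\<^sup>2 * (b - a) ^ (2 * m)"
proof -
  let ?L = "b - a" and ?DT = "integral {a..b} (\<lambda>x. \<bar>T 1 x\<bar>)" and ?DS = "integral {a..b} (\<lambda>x. \<bar>S 1 x\<bar>)"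
  have L: "0 \<le> ?L" using ab by simp
  have cont: "continuous_on X (D k)" if "Cm_fam m D" "k \<le> 1" for D k X using Cm_fam_cont[OF that(1), of k X] that m by simp
  note cs = cont[OF C(1)] cont[OF C(2)] cont[OF C(3)] cont[OF C(4)]
  have inc: "\<bar>D 0 b - D 0 a\<bar> \<le> integral {a..b} (\<lambda>x. \<bar>D 1 x\<bar>)" if D: "Cm_fam m D" for D
  proof -
    have "(D 1 has_integral D 0 b - D 0 a) {a..b}"
    proof (rule fundamental_theorem_of_calculus[OF ab])
      fix x
      show "(D 0 has_vector_derivative D 1 x) (at x within {a..b})"
        using Cm_famD[OF D, of 0 x] m unfolding has_real_derivative_iff_has_vector_derivative[symmetric]
        by (auto intro: has_field_derivative_at_within)
    qed
    then have "\<bar>D 0 b - D 0 a\<bar> = norm (integral {a..b} (D 1))" by (simp add: integral_unique)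
    also have "\<dots> \<le> integral {a..b} (\<lambda>x. \<bar>D 1 x\<bar>)"
      by (rule integral_norm_bound_integral) (auto intro!: integrable_continuous_interval continuous_intros cont[OF D])
    finally show ?thesis .
  qed
  have D0: "0 \<le> ?DT" "0 \<le> ?DS"
    by (rule integral_nonneg; auto intro!: integrable_continuous_interval continuous_intros cs)+
  have b: "b \<in> {a..b}" using ab by simp
  have h: "\<bar>f 0 x - T 0 x\<bar> \<le> w * ?L ^ m" "\<bar>g 0 x - S 0 x\<bar> \<le> w * ?L ^ m" if "x \<in> {a..b}" for x
    using fT[of 0 x] gS[of 0 x] that by auto
  have h1: "\<bar>f 1 x - T 1 x\<bar> \<le> w * ?L ^ (m - 1)" "\<bar>g 1 x - S 1 x\<bar> \<le> w * ?L ^ (m - 1)" if "x \<in> {a..b}" for x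
    using fT[of 1 x] gS[of 1 x] that by auto
  have half_diff: "\<bar>1/2 * (p - q)\<bar> \<le> 1/2 * (X + Y)" if "\<bar>p\<bar> \<le> X" "\<bar>q\<bar> \<le> Y" for p q X Y :: real
  proof -
    have "\<bar>p - q\<bar> \<le> X + Y" using that by linarith
    then show ?thesis by (simp add: abs_mult)
  qed
  have t1: "\<bar>1/2 * ((T 0 b - T 0 a) * (g 0 b - S 0 b) - (S 0 b - S 0 a) * (f 0 b - T 0 b))\<bar> \<le> 1/2 * (?DT * (w * ?L ^ m) + ?DS * (w * ?L ^ m))"
  proof -
    have "\<bar>(T 0 b - T 0 a) * (g 0 b - S 0 b)\<bar> \<le> ?DT * (w * ?L ^ m)" "\<bar>(S 0 b - S 0 a) * (f 0 b - T 0 b)\<bar> \<le> ?DS * (w * ?L ^ m)"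
      unfolding abs_mult using inc[OF C(3)] inc[OF C(4)] h[OF b] D0 by (intro mult_mono; simp)+
    then show ?thesis by (rule half_diff)
  qed
  have t2: "\<bar>integral {a..b} (\<lambda>x. (f 0 x - T 0 x) * S 1 x - T 1 x * (g 0 x - S 0 x))\<bar> \<le> w * ?L ^ m * (?DT + ?DS)"
  proof -
    have "norm (integral {a..b} (\<lambda>x. (f 0 x - T 0 x) * S 1 x - T 1 x * (g 0 x - S 0 x))) \<le> integral {a..b} (\<lambda>x. w * ?L ^ m * (\<bar>T 1 x\<bar> + \<bar>S 1 x\<bar>))"
    proof (rule integral_norm_bound_integral)
      fix x assume x: "x \<in> {a..b}"
      have "\<bar>(f 0 x - T 0 x) * S 1 x\<bar> \<le> w * ?L ^ m * \<bar>S 1 x\<bar>" "\<bar>T 1 x * (g 0 x - S 0 x)\<bar> \<le> \<bar>T 1 x\<bar> * (w * ?L ^ m)"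
        unfolding abs_mult using h[OF x] by (intro mult_right_mono mult_left_mono; simp)+
      then have "\<bar>(f 0 x - T 0 x) * S 1 x - T 1 x * (g 0 x - S 0 x)\<bar> \<le> w * ?L ^ m * \<bar>S 1 x\<bar> + \<bar>T 1 x\<bar> * (w * ?L ^ m)" by linarith
      then show "norm ((f 0 x - T 0 x) * S 1 x - T 1 x * (g 0 x - S 0 x)) \<le> w * ?L ^ m * (\<bar>T 1 x\<bar> + \<bar>S 1 x\<bar>)"
        by (simp add: distrib_left mult.commute)
    qed (auto intro!: integrable_continuous_interval continuous_intros cs)
    also have "\<dots> = w * ?L ^ m * (?DT + ?DS)"
      by (subst integral_mult_right, subst integral_add) (auto intro!: integrable_continuous_interval continuous_intros cs)
    finally show ?thesis by simp
  qed
  have t3: "\<bar>integral {a..b} (\<lambda>x. (f 0 x - T 0 x) * (g 1 x - S 1 x) - (f 1 x - T 1 x) * (g 0 x - S 0 x))\<bar> \<le> 2 * (w\<^sup>2 * ?L ^ (2 * m))"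
  proof -
    have "norm (integral {a..b} (\<lambda>x. (f 0 x - T 0 x) * (g 1 x - S 1 x) - (f 1 x - T 1 x) * (g 0 x - S 0 x))) \<le> (2 * (w * ?L ^ m * (w * ?L ^ (m - 1)))) * (b - a)"
    proof (rule integral_bound[OF ab])
      show "continuous_on {a..b} (\<lambda>x. (f 0 x - T 0 x) * (g 1 x - S 1 x) - (f 1 x - T 1 x) * (g 0 x - S 0 x))"
        by (intro continuous_intros cs) auto
      fix x assume x: "x \<in> {a..b}"
      have "\<bar>(f 0 x - T 0 x) * (g 1 x - S 1 x)\<bar> \<le> w * ?L ^ m * (w * ?L ^ (m - 1))"
        unfolding abs_mult by (rule mult_mono'[OF h(1)[OF x] h1(2)[OF x]]) auto
      moreover have "\<bar>(f 1 x - T 1 x) * (g 0 x - S 0 x)\<bar> \<le> w * ?L ^ (m - 1) * (w * ?L ^ m)"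
        unfolding abs_mult by (rule mult_mono'[OF h1(1)[OF x] h(2)[OF x]]) auto
      ultimately show "norm ((f 0 x - T 0 x) * (g 1 x - S 1 x) - (f 1 x - T 1 x) * (g 0 x - S 0 x)) \<le> 2 * (w * ?L ^ m * (w * ?L ^ (m - 1)))"
        unfolding real_norm_def by (simp add: mult.commute)
    qed
    also have "\<dots> = 2 * (w\<^sup>2 * (?L ^ m * (?L ^ (m - 1) * ?L)))" by (simp add: power2_eq_square mult_ac)
    also have "?L ^ (m - 1) * ?L = ?L ^ m" using m by (simp add: power_Suc2[symmetric])
    also have "?L ^ m * ?L ^ m = ?L ^ (2 * m)" by (simp only: mult_2 power_add)
    finally show ?thesis by simp
  qed
  have sum3: "\<bar>x + y + 1/2 * z\<bar> \<le> X + Y + 1/2 * Z" if "\<bar>x\<bar> \<le> X" "\<bar>y\<bar> \<le> Y" "\<bar>z\<bar> \<le> Z" for x y z X Y Z :: real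
  proof -
    have "\<bar>1/2 * z\<bar> \<le> 1/2 * Z" using that(3) by (simp add: abs_mult)
    then show ?thesis using that(1,2) by linarith
  qed
  have p: "0 \<le> w * ?L ^ m * (?DT + ?DS)" using D0 w L by simp
  have "\<bar>1/2 * ((T 0 b - T 0 a) * (g 0 b - S 0 b) - (S 0 b - S 0 a) * (f 0 b - T 0 b))
      + integral {a..b} (\<lambda>x. (f 0 x - T 0 x) * S 1 x - T 1 x * (g 0 x - S 0 x))
      + 1/2 * integral {a..b} (\<lambda>x. (f 0 x - T 0 x) * (g 1 x - S 1 x) - (f 1 x - T 1 x) * (g 0 x - S 0 x))\<bar>
     \<le> 1/2 * (?DT * (w * ?L ^ m) + ?DS * (w * ?L ^ m)) + w * ?L ^ m * (?DT + ?DS) + 1/2 * (2 * (w\<^sup>2 * ?L ^ (2 * m)))"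
    by (rule sum3[OF t1 t2 t3])
  \<comment> \<open>The first two terms carry the factors 1/2 and 1, which are rounded up to
    2.\<close>
  also have "1/2 * (?DT * (w * ?L ^ m) + ?DS * (w * ?L ^ m)) = 1/2 * (w * ?L ^ m * (?DT + ?DS))" by (simp add: algebra_simps)
  also have "1/2 * (w * ?L ^ m * (?DT + ?DS)) + w * ?L ^ m * (?DT + ?DS) + 1/2 * (2 * (w\<^sup>2 * ?L ^ (2 * m)))
      \<le> 2 * (w * ?L ^ m * (?DT + ?DS)) + w\<^sup>2 * ?L ^ (2 * m)" using p by linarith
  finally show ?thesis unfolding area_difference[OF C m ab fa ga] by (simp add: mult.assoc)
qed

lemma integral_bilinear:
  fixes D :: "nat \<Rightarrow> nat \<Rightarrow> real \<Rightarrow> real"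
  assumes m: "1 \<le> m" and D: "\<And>p. p \<in> I \<Longrightarrow> Cm_fam m (D p)" and I: "finite I"
  shows "(\<Sum>p\<in>I. \<Sum>q\<in>I. u p * v q * integral {a..b} (\<lambda>x. D p 0 x * D q 1 x - D p 1 x * D q 0 x))
     = integral {a..b} (\<lambda>x. (\<Sum>p\<in>I. u p * D p 0 x) * (\<Sum>q\<in>I. v q * D q 1 x) - (\<Sum>p\<in>I. u p * D p 1 x) * (\<Sum>q\<in>I. v q * D q 0 x))"
proof -
  have int: "(\<lambda>x. u p * v q * (D p 0 x * D q 1 x - D p 1 x * D q 0 x)) integrable_on {a..b}" if "p \<in> I" "q \<in> I" for p q
    by (intro integrable_continuous_interval continuous_intros Cm_fam_cont[OF D] that m) auto
  have "(\<Sum>p\<in>I. \<Sum>q\<in>I. u p * v q * integral {a..b} (\<lambda>x. D p 0 x * D q 1 x - D p 1 x * D q 0 x))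
      = (\<Sum>p\<in>I. \<Sum>q\<in>I. integral {a..b} (\<lambda>x. u p * v q * (D p 0 x * D q 1 x - D p 1 x * D q 0 x)))" by simp
  also have "\<dots> = (\<Sum>p\<in>I. integral {a..b} (\<lambda>x. \<Sum>q\<in>I. u p * v q * (D p 0 x * D q 1 x - D p 1 x * D q 0 x)))"
    by (intro sum.cong refl integral_sum[symmetric] I int)
  also have "\<dots> = integral {a..b} (\<lambda>x. \<Sum>p\<in>I. \<Sum>q\<in>I. u p * v q * (D p 0 x * D q 1 x - D p 1 x * D q 0 x))"
    by (intro integral_sum[symmetric] I integrable_sum int)
  also have "(\<lambda>x. \<Sum>p\<in>I. \<Sum>q\<in>I. u p * v q * (D p 0 x * D q 1 x - D p 1 x * D q 0 x)) =
     (\<lambda>x. (\<Sum>p\<in>I. u p * D p 0 x) * (\<Sum>q\<in>I. v q * D q 1 x) - (\<Sum>p\<in>I. u p * D p 1 x) * (\<Sum>q\<in>I. v q * D q 0 x))"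
    unfolding sum_product sum_subtractf[symmetric] by (intro ext sum.cong refl) (simp add: algebra_simps)
  finally show ?thesis .
qed

text \<open>A combination of the f_p is again of class C^m, with the same combination of Taylor
  polynomials and remainder constant r B w. The double sum is thus a single area difference.
  Estimating its terms one by one would yield the individual velocities and lose the cancellation in
  \<Delta>_i and \<Delta>_j.\<close>

lemma area_combination_bound:
  assumes m: "1 \<le> m" and ab: "a \<le> b" and f: "\<And>p. p \<in> {1..r} \<Longrightarrow> Cm_fam m (f p)"
    and Fa: "\<And>p k. p \<in> {1..r} \<Longrightarrow> k \<le> m \<Longrightarrow> F p k a = f p k a" and Fb: "\<And>p. p \<in> {1..r} \<Longrightarrow> F p 0 b = f p 0 b"
    and G: "\<And>i j. 1 \<le> j \<Longrightarrow> j < i \<Longrightarrow> i \<le> r \<Longrightarrow>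
       G i j 0 b - G i j 0 a = 1/2 * integral {a..b} (\<lambda>x. f i 0 x * f j 1 x - f i 1 x * f j 0 x)"
    and u: "\<And>p. p \<in> {1..r} \<Longrightarrow> \<bar>u p\<bar> \<le> B" and v: "\<And>p. p \<in> {1..r} \<Longrightarrow> \<bar>v p\<bar> \<le> B"
    and w: "\<And>p k x. p \<in> {1..r} \<Longrightarrow> k \<le> 1 \<Longrightarrow> x \<in> {a..b} \<Longrightarrow> \<bar>f p k x - tay m (f p) a k x\<bar> \<le> w * (b - a) ^ (m - k)"
    and w0: "0 \<le> w" and B: "0 \<le> B"
  shows "\<bar>\<Sum>p\<in>{1..r}. \<Sum>q\<in>{1..r}. u p * v q * area_term m F (alt_ext G) p q a b\<bar>
    \<le> 2 * (real r * B * w) * (b - a) ^ m * (integral {a..b} (\<lambda>x. \<bar>\<Sum>p\<in>{1..r}. u p * tay m (F p) a 1 x\<bar>)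
         + integral {a..b} (\<lambda>x. \<bar>\<Sum>p\<in>{1..r}. v p * tay m (F p) a 1 x\<bar>)) + (real r * B * w)\<^sup>2 * (b - a) ^ (2 * m)"
proof -
  let ?I = "{1..r}"
  have tay: "tay m (F p) a k x = tay m (f p) a k x" if "p \<in> ?I" "k \<le> m" for p k x
    by (rule tay_cong) (use Fa that in auto)
  define T where "T p = tay m (f p) a" for p
  have T: "Cm_fam m (T p)" for p unfolding T_def by (rule Cm_fam_tay)
  define Wd where "Wd D p q = integral {a..b} (\<lambda>x. D p 0 x * D q 1 x - D p 1 x * D q 0 x)" for D :: "nat \<Rightarrow> nat \<Rightarrow> real \<Rightarrow> real" and p q
  have anti: "Wd D p q = - Wd D q p" for D p q
  proof -
    have "(\<lambda>x. D p 0 x * D q 1 x - D p 1 x * D q 0 x) = (\<lambda>x. - (D q 0 x * D p 1 x - D q 1 x * D p 0 x))" by (simp add: algebra_simps)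
    then show ?thesis unfolding Wd_def by (simp only: integral_neg)
  qed
  have aG: "alt_ext G p q 0 b - alt_ext G p q 0 a = 1/2 * Wd f p q" if "p \<in> ?I" "q \<in> ?I" for p q
  proof -
    consider "q < p" | "p < q" | "p = q" by linarith
    then show ?thesis
    proof cases
      case 1 then show ?thesis using G[of q p] that by (simp add: alt_ext_def Wd_def)
    next
      case 2
      then have "G q p 0 b - G q p 0 a = 1/2 * Wd f q p" using G[of p q] that by (simp add: Wd_def)
      then show ?thesis using 2 anti[of f p q] by (simp add: alt_ext_def)
    next
      case 3 then show ?thesis using anti[of f p p] by (simp add: alt_ext_def)
    qed
  qed
  have A: "area_term m F (alt_ext G) p q a b = 1/2 * Wd f p q - 1/2 * Wd T p q
      + 1/2 * f q 0 a * (f p 0 b - T p 0 b) - 1/2 * f p 0 a * (f q 0 b - T q 0 b)" if pq: "p \<in> ?I" "q \<in> ?I" for p q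
    unfolding area_term_eq[OF m ab] aG[OF pq] tay[OF pq(1) m] tay[OF pq(2) m] tay[OF pq(1) le0] tay[OF pq(2) le0]
      Fb[OF pq(1)] Fb[OF pq(2)] Fa[OF pq(1) le0] Fa[OF pq(2) le0] unfolding Wd_def T_def ..
  define fu where "fu k x = (\<Sum>p\<in>?I. u p * f p k x)" for k x
  define fv where "fv k x = (\<Sum>p\<in>?I. v p * f p k x)" for k x
  define Tu where "Tu k x = (\<Sum>p\<in>?I. u p * T p k x)" for k x
  define Tv where "Tv k x = (\<Sum>p\<in>?I. v p * T p k x)" for k x
  have Cu: "Cm_fam m (\<lambda>k x. \<Sum>p\<in>?I. c p * D p k x)" if "\<And>p. p \<in> ?I \<Longrightarrow> Cm_fam m (D p)" for D c
    by (rule Cm_fam_sum, rule Cm_fam_cmult, rule that)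
  have C: "Cm_fam m fu" "Cm_fam m fv" "Cm_fam m Tu" "Cm_fam m Tv"
    unfolding fu_def[abs_def] fv_def[abs_def] Tu_def[abs_def] Tv_def[abs_def] by (rule Cu f T; assumption?)+
  have bil: "(\<Sum>p\<in>?I. \<Sum>q\<in>?I. u p * v q * Wd f p q) = integral {a..b} (\<lambda>x. fu 0 x * fv 1 x - fu 1 x * fv 0 x)"
     "(\<Sum>p\<in>?I. \<Sum>q\<in>?I. u p * v q * Wd T p q) = integral {a..b} (\<lambda>x. Tu 0 x * Tv 1 x - Tu 1 x * Tv 0 x)"
    unfolding Wd_def fu_def fv_def Tu_def Tv_def by (rule integral_bilinear[OF m f], assumption, simp, rule integral_bilinear[OF m T], simp)
  have start: "T p 0 a = f p 0 a" for p by (simp add: T_def)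
  have E: "(\<Sum>p\<in>?I. \<Sum>q\<in>?I. u p * v q * area_term m F (alt_ext G) p q a b) =
     1/2 * integral {a..b} (\<lambda>x. fu 0 x * fv 1 x - fu 1 x * fv 0 x) - 1/2 * integral {a..b} (\<lambda>x. Tu 0 x * Tv 1 x - Tu 1 x * Tv 0 x)
      + 1/2 * Tv 0 a * (fu 0 b - Tu 0 b) - 1/2 * Tu 0 a * (fv 0 b - Tv 0 b)"
  proof -
    have "(\<Sum>p\<in>?I. \<Sum>q\<in>?I. u p * v q * area_term m F (alt_ext G) p q a b) =
       (\<Sum>p\<in>?I. \<Sum>q\<in>?I. 1/2 * (u p * v q * Wd f p q) - 1/2 * (u p * v q * Wd T p q)
         + 1/2 * ((u p * (f p 0 b - T p 0 b)) * (v q * f q 0 a)) - 1/2 * ((u p * f p 0 a) * (v q * (f q 0 b - T q 0 b))))"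
      by (intro sum.cong refl) (simp add: A algebra_simps)
    also have "\<dots> = 1/2 * (\<Sum>p\<in>?I. \<Sum>q\<in>?I. u p * v q * Wd f p q) - 1/2 * (\<Sum>p\<in>?I. \<Sum>q\<in>?I. u p * v q * Wd T p q)
       + 1/2 * ((\<Sum>p\<in>?I. u p * (f p 0 b - T p 0 b)) * (\<Sum>q\<in>?I. v q * f q 0 a)) - 1/2 * ((\<Sum>p\<in>?I. u p * f p 0 a) * (\<Sum>q\<in>?I. v q * (f q 0 b - T q 0 b)))"
      unfolding sum_product sum.distrib sum_subtractf unfolding sum_distrib_left ..
    also have "(\<Sum>p\<in>?I. u p * (f p 0 b - T p 0 b)) = fu 0 b - Tu 0 b" by (simp add: fu_def Tu_def right_diff_distrib sum_subtractf)
    also have "(\<Sum>q\<in>?I. v q * (f q 0 b - T q 0 b)) = fv 0 b - Tv 0 b" by (simp add: fv_def Tv_def right_diff_distrib sum_subtractf)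
    also have "(\<Sum>q\<in>?I. v q * f q 0 a) = Tv 0 a" by (simp add: Tv_def start)
    also have "(\<Sum>p\<in>?I. u p * f p 0 a) = Tu 0 a" by (simp add: Tu_def start)
    finally show ?thesis unfolding bil by (simp add: mult_ac)
  qed
  have cb: "\<bar>(\<Sum>p\<in>?I. c p * f p k x) - (\<Sum>p\<in>?I. c p * T p k x)\<bar> \<le> real r * B * w * (b - a) ^ (m - k)"
    if c: "\<And>p. p \<in> ?I \<Longrightarrow> \<bar>c p\<bar> \<le> B" and k: "k \<le> 1" and x: "x \<in> {a..b}" for c k x
  proof -
    have "(\<Sum>p\<in>?I. c p * f p k x) - (\<Sum>p\<in>?I. c p * T p k x) = (\<Sum>p\<in>?I. c p * (f p k x - T p k x))"
      by (simp add: right_diff_distrib sum_subtractf)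
    also have "\<bar>\<dots>\<bar> \<le> (\<Sum>p\<in>?I. \<bar>c p * (f p k x - T p k x)\<bar>)" by (rule sum_abs)
    also have "\<dots> \<le> (\<Sum>p\<in>?I. B * (w * (b - a) ^ (m - k)))"
    proof (rule sum_mono)
      fix p assume p: "p \<in> ?I"
      show "\<bar>c p * (f p k x - T p k x)\<bar> \<le> B * (w * (b - a) ^ (m - k))"
        unfolding abs_mult T_def by (rule mult_mono[OF c[OF p] w[OF p k x] B abs_ge_zero])
    qed
    finally show ?thesis by (simp add: mult.assoc)
  qed
  have "\<bar>\<Sum>p\<in>?I. \<Sum>q\<in>?I. u p * v q * area_term m F (alt_ext G) p q a b\<bar>
    \<le> 2 * (real r * B * w) * (b - a) ^ m * (integral {a..b} (\<lambda>x. \<bar>Tu 1 x\<bar>) + integral {a..b} (\<lambda>x. \<bar>Tv 1 x\<bar>)) + (real r * B * w)\<^sup>2 * (b - a) ^ (2 * m)"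
    unfolding E
  proof (rule area_bound[OF C m ab])
    show "fu 0 a = Tu 0 a" "fv 0 a = Tv 0 a" by (simp_all add: fu_def Tu_def fv_def Tv_def start)
    show "0 \<le> real r * B * w" using B w0 by simp
    show "\<bar>fu k x - Tu k x\<bar> \<le> real r * B * w * (b - a) ^ (m - k)" if "k \<le> 1" "x \<in> {a..b}" for k x
      unfolding fu_def Tu_def by (rule cb[OF u that])
    show "\<bar>fv k x - Tv k x\<bar> \<le> real r * B * w * (b - a) ^ (m - k)" if "k \<le> 1" "x \<in> {a..b}" for k x
      unfolding fv_def Tv_def by (rule cb[OF v that])
  qed
  moreover have "(\<Sum>p\<in>?I. u p * tay m (F p) a 1 x) = Tu 1 x" "(\<Sum>p\<in>?I. v p * tay m (F p) a 1 x) = Tv 1 x" for x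
    unfolding Tu_def Tv_def T_def by (rule sum.cong; simp add: tay m[unfolded One_nat_def])+
  ultimately show ?thesis by simp
qed

lemma gen_AV_necessary:
  assumes m: "1 \<le> m" and K: "compact K" and f: "\<And>p. p \<in> {1..r} \<Longrightarrow> Cm_fam m (f p)"
    and F: "\<And>p k t. p \<in> {1..r} \<Longrightarrow> k \<le> m \<Longrightarrow> t \<in> K \<Longrightarrow> F p k t = f p k t"
    and G: "\<And>i j a b. 1 \<le> j \<Longrightarrow> j < i \<Longrightarrow> i \<le> r \<Longrightarrow> a \<in> K \<Longrightarrow> b \<in> K \<Longrightarrow> a \<le> b \<Longrightarrow>
       G i j 0 b - G i j 0 a = 1/2 * integral {a..b} (\<lambda>x. f i 0 x * f j 1 x - f i 1 x * f j 0 x)"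
  shows "gen_AV_condition m r K F G"
  unfolding gen_AV_condition_def
proof (intro allI impI)
  fix A :: "real set" and i j and \<epsilon> :: real
  assume A: "compact A" and ij: "1 \<le> j \<and> j < i \<and> i \<le> r" and e: "\<epsilon> > 0"
  have ij': "1 \<le> j" "j < i" "i \<le> r" using ij by auto
  let ?S = "rest_idx r i j"
  obtain N where N: "\<And>x. x \<in> A \<Longrightarrow> \<bar>x\<bar> \<le> N" using compact_imp_bounded[OF A] bounded_iff by (metis real_norm_def)
  \<comment> \<open>The maximum with 1 accounts for the entry 1 of \<open>first_vec\<close>.\<close>
  define B where "B = max 1 N"
  have B: "0 \<le> B" by (simp add: B_def)
  \<comment> \<open>With r B w \<le> w', the bound \<epsilon> / 2 takes care of the term linear in
    w, and w' \<le> 1 of the quadratic one, as then w'^2 \<le> w'.\<close>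
  define w' where "w' = min 1 (\<epsilon> / 2)"
  have w': "0 < w'" "w' \<le> 1" "w' \<le> \<epsilon> / 2" using e by (auto simp: w'_def)
  define w where "w = w' / (real r * B + 1)"
  have rB: "0 < real r * B + 1" using B by (simp add: add_nonneg_pos)
  have w: "0 < w" "real r * B * w \<le> w'"
  proof -
    show "0 < w" using w' rB by (simp add: w_def)
    have "real r * B * w \<le> (real r * B + 1) * w" using \<open>0 < w\<close> by simp
    then show "real r * B * w \<le> w'" using rB by (simp add: w_def)
  qed
  obtain a0 b0 where AB: "K \<subseteq> {a0..b0}" using compact_real_subset_Icc[OF K] by blast
  have "\<exists>\<delta>>0. \<forall>p\<in>{1..r}. \<forall>a\<in>{a0..b0}. \<forall>b\<in>{a0..b0}. \<bar>b - a\<bar> < \<delta> \<longrightarrow> (\<forall>k\<le>m. \<bar>f p k b - tay m (f p) a k b\<bar> \<le> w * \<bar>b - a\<bar> ^ (m - k))"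
    by (rule finite_delta) (use taylor_uniform[OF f w(1)] in auto)
  then obtain d where d: "d > 0" "\<And>p a b k. p \<in> {1..r} \<Longrightarrow> a \<in> {a0..b0} \<Longrightarrow> b \<in> {a0..b0} \<Longrightarrow> \<bar>b - a\<bar> < d \<Longrightarrow> k \<le> m \<Longrightarrow>
     \<bar>f p k b - tay m (f p) a k b\<bar> \<le> w * \<bar>b - a\<bar> ^ (m - k)" by blast
  show "\<exists>\<delta>>0. \<forall>a\<in>K. \<forall>b\<in>K. 0 < b - a \<and> b - a < \<delta> \<longrightarrow>
         (SUP (c, c') \<in> (?S \<rightarrow>\<^sub>E A) \<times> (?S \<rightarrow>\<^sub>E A).
            ereal (\<bar>gen_area m r F G i j a b c c'\<bar> /
              ((b - a) ^ (2 * m) + (b - a) ^ m *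
                (velocity_term m F ?S i a b c' + velocity_term m F ?S j a b c)))) \<le> ereal \<epsilon>"
  proof (intro exI[of _ d] conjI ballI impI)
    fix a b assume ab: "a \<in> K" "b \<in> K" "0 < b - a \<and> b - a < d"
    then have le: "a \<le> b" and L: "0 < b - a" and Ld: "b - a < d" by auto
    show "(SUP (c, c') \<in> (?S \<rightarrow>\<^sub>E A) \<times> (?S \<rightarrow>\<^sub>E A).
            ereal (\<bar>gen_area m r F G i j a b c c'\<bar> /
              ((b - a) ^ (2 * m) + (b - a) ^ m *
                (velocity_term m F ?S i a b c' + velocity_term m F ?S j a b c)))) \<le> ereal \<epsilon>"
    proof (rule SUP_least, clarify)
      fix c c' assume c: "c \<in> ?S \<rightarrow>\<^sub>E A" and c': "c' \<in> ?S \<rightarrow>\<^sub>E A"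
      define V where "V = velocity_term m F ?S i a b c' + velocity_term m F ?S j a b c"
      have V: "0 \<le> V" unfolding V_def using velocity_term_nonneg[OF m le ij'] by (intro add_nonneg_nonneg) auto
      have cS: "\<bar>c p\<bar> \<le> B" "\<bar>c' p\<bar> \<le> B" if "p \<in> ?S" for p
        using N[OF PiE_mem[OF c that]] N[OF PiE_mem[OF c' that]] by (auto simp: B_def)
      have pS: "p \<in> ?S \<or> p = i \<or> p = j" if "p \<in> {1..r}" for p using that by (auto simp: rest_idx_def)
      have "\<bar>gen_area m r F G i j a b c c'\<bar> \<le> 2 * (real r * B * w) * (b - a) ^ m * V + (real r * B * w)\<^sup>2 * (b - a) ^ (2 * m)"
        unfolding gen_area_bilinear[OF m le ij'] V_def velocity_term_eq[OF m le ij']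
      proof (rule area_combination_bound[OF m le f])
        show "F p k a = f p k a" if "p \<in> {1..r}" "k \<le> m" for p k by (rule F[OF that ab(1)])
        show "F p 0 b = f p 0 b" if "p \<in> {1..r}" for p by (rule F[OF that le0 ab(2)])
        show "G i j 0 b - G i j 0 a = 1/2 * integral {a..b} (\<lambda>x. f i 0 x * f j 1 x - f i 1 x * f j 0 x)"
          if "1 \<le> j" "j < i" "i \<le> r" for i j by (rule G[OF that ab(1,2) le])
        show "\<bar>first_vec i j c' p\<bar> \<le> B" "\<bar>first_vec j i c p\<bar> \<le> B" if "p \<in> {1..r}" for p
          using pS[OF that] cS[of p] ij' by (auto simp: first_vec_def B_def)
        show "\<bar>f p k x - tay m (f p) a k x\<bar> \<le> w * (b - a) ^ (m - k)" if p: "p \<in> {1..r}" and k: "k \<le> 1" and x: "x \<in> {a..b}" for p k x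
        proof -
          have "\<bar>f p k x - tay m (f p) a k x\<bar> \<le> w * \<bar>x - a\<bar> ^ (m - k)"
            by (rule d(2)[OF p]) (use AB ab x k m Ld in auto)
          also have "\<dots> \<le> w * (b - a) ^ (m - k)" using x w(1) by (intro mult_left_mono power_mono) auto
          finally show ?thesis .
        qed
        show "0 \<le> w" using w by simp
        show "0 \<le> B" by (rule B)
      qed
      also have "\<dots> \<le> \<epsilon> * (b - a) ^ m * V + \<epsilon> * (b - a) ^ (2 * m)"
      proof (intro add_mono mult_right_mono)
        show "2 * (real r * B * w) \<le> \<epsilon>" using w w' by simp
        have "(real r * B * w)\<^sup>2 \<le> w'\<^sup>2" using w w' B by (intro power_mono) auto
        also have "\<dots> \<le> w'" using w' by (simp add: power2_eq_square mult_left_le)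
        finally show "(real r * B * w)\<^sup>2 \<le> \<epsilon>" using w' e by linarith
      qed (use V L in auto)
      also have "\<dots> = \<epsilon> * ((b - a) ^ (2 * m) + (b - a) ^ m * V)" by (simp add: algebra_simps)
      finally have "\<bar>gen_area m r F G i j a b c c'\<bar> \<le> \<epsilon> * ((b - a) ^ (2 * m) + (b - a) ^ m * V)" .
      moreover have "0 < (b - a) ^ (2 * m) + (b - a) ^ m * V" using V L by (intro add_pos_nonneg) auto
      ultimately show "ereal (\<bar>gen_area m r F G i j a b c c'\<bar> /
              ((b - a) ^ (2 * m) + (b - a) ^ m *
                (velocity_term m F ?S i a b c' + velocity_term m F ?S j a b c))) \<le> ereal \<epsilon>"
        unfolding V_def[symmetric] by (simp add: pos_divide_le_eq)
    qed
  qed (use d in auto)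
qed

lemma necessity:
  assumes m: "1 \<le> m" and K: "compact K" and \<gamma>: "C_horizontal_curve m r \<gamma>"
    and F: "\<And>k i t. k \<le> m \<Longrightarrow> 1 \<le> i \<Longrightarrow> i \<le> r \<Longrightarrow> t \<in> K \<Longrightarrow> (deriv ^^ k) (\<lambda>s. \<gamma> s (Hor i)) t = F i k t"
    and G: "\<And>k i j t. k \<le> m \<Longrightarrow> 1 \<le> j \<Longrightarrow> j < i \<Longrightarrow> i \<le> r \<Longrightarrow> t \<in> K \<Longrightarrow>
      (deriv ^^ k) (\<lambda>s. \<gamma> s (Ver i j)) t = G i j k t"
  shows "((\<forall>i. 1 \<le> i \<and> i \<le> r \<longrightarrow> whitney_field m K (F i)) \<and>
          (\<forall>i j. 1 \<le> j \<and> j < i \<and> i \<le> r \<longrightarrow> whitney_field m K (G i j))) \<and>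
         (\<forall>k. 1 \<le> k \<and> k \<le> m \<longrightarrow> (\<forall>t\<in>K. \<forall>i j. 1 \<le> j \<and> j < i \<and> i \<le> r \<longrightarrow>
            G i j k t = vert_poly k (\<lambda>l. F i l t) (\<lambda>l. F j l t))) \<and>
         gen_AV_condition m r K F G"
proof -
  define D where "D c k = (deriv ^^ k) (\<lambda>s. \<gamma> s c)" for c k
  have D: "Cm_fam m (D c)" if "c \<in> coords r" for c
    unfolding D_def using \<gamma> that C_class_Cm_fam by (auto simp: C_horizontal_curve_def)
  have cH: "Hor i \<in> coords r" if "1 \<le> i" "i \<le> r" for i using that by (auto simp: coords_def)
  have cV: "Ver i j \<in> coords r" if "1 \<le> j" "j < i" "i \<le> r" for i j using that by (auto simp: coords_def)
  have DF: "F i k t = D (Hor i) k t" if "k \<le> m" "1 \<le> i" "i \<le> r" "t \<in> K" for i k t using F[OF that] by (simp add: D_def)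
  have DG: "G i j k t = D (Ver i j) k t" if "k \<le> m" "1 \<le> j" "j < i" "i \<le> r" "t \<in> K" for i j k t using G[OF that] by (simp add: D_def)
  have vel: "D (Ver i j) 1 t = (D (Hor i) 0 t * D (Hor j) 1 t - D (Hor i) 1 t * D (Hor j) 0 t) / 2"
    if "1 \<le> j" "j < i" "i \<le> r" for i j t
    using horizontal_velocity[OF m \<gamma> that, of t] by (simp add: D_def)
  have D0: "(D c 0 has_real_derivative D c 1 t) (at t)" if "c \<in> coords r" for c t
    using Cm_famD[OF D[OF that], of 0 t] m by simp
  have W1: "whitney_field m K (F i)" if "1 \<le> i" "i \<le> r" for i
    by (rule Cm_fam_whitney[OF D[OF cH[OF that]] K]) (rule DF[OF _ that])
  have W2: "whitney_field m K (G i j)" if "1 \<le> j" "j < i" "i \<le> r" for i j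
    by (rule Cm_fam_whitney[OF D[OF cV[OF that]] K]) (rule DG[OF _ that])
  have P: "G i j k t = vert_poly k (\<lambda>l. F i l t) (\<lambda>l. F j l t)" if k: "1 \<le> k" "k \<le> m" and t: "t \<in> K" and ij: "1 \<le> j" "j < i" "i \<le> r" for i j k t
  proof -
    have ij': "1 \<le> i" "j \<le> r" using ij by auto
    have dv: "(D (Ver i j) 0 has_real_derivative (D (Hor i) 0 t * D (Hor j) 1 t - D (Hor i) 1 t * D (Hor j) 0 t) / 2) (at t)" for t
      using D0[OF cV[OF ij], of t] unfolding vel[OF ij] .
    \<comment> \<open>The derivatives of the vertical coordinate and the family built from P^k have
      the same member of order zero, hence coincide.\<close>
    define E where "E k t = (if k = 0 then D (Ver i j) 0 t else vert_poly k (\<lambda>l. D (Hor i) l t) (\<lambda>l. D (Hor j) l t))" for k t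
    have CE: "Cm_fam m E" unfolding E_def[abs_def]
      by (rule Cm_fam_vertical[where f = "D (Hor i)" and g = "D (Hor j)", OF m D[OF cH[OF ij'(1) ij(3)]] D[OF cH[OF ij(1) ij'(2)]] dv])
    have E0: "E 0 = D (Ver i j) 0" by (rule ext) (simp add: E_def)
    have "D (Ver i j) k = E k"
      using Cm_fam_funpow_deriv[OF CE k(2)] Cm_fam_funpow_deriv[OF D[OF cV[OF ij]] k(2)] E0 by simp
    then have "G i j k t = vert_poly k (\<lambda>l. D (Hor i) l t) (\<lambda>l. D (Hor j) l t)" using DG[OF k(2) ij t] k by (simp add: E_def)
    also have "\<dots> = vert_poly k (\<lambda>l. F i l t) (\<lambda>l. F j l t)"
      unfolding vert_poly_def
      by (intro arg_cong2[where f = "(*)"] sum.cong refl) (use DF[OF _ ij'(1) ij(3) t] DF[OF _ ij(1) ij'(2) t] k in auto)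
    finally show ?thesis .
  qed
  have "gen_AV_condition m r K F G"
  proof (rule gen_AV_necessary[where f = "\<lambda>p. D (Hor p)", OF m K])
    show "Cm_fam m (D (Hor p))" if "p \<in> {1..r}" for p using D cH that by simp
    show "F p k t = D (Hor p) k t" if "p \<in> {1..r}" "k \<le> m" "t \<in> K" for p k t using DF that by simp
    fix i j a b assume ij: "1 \<le> j" "j < i" "i \<le> r" and ab: "a \<in> K" "b \<in> K" "a \<le> b"
    have "(D (Ver i j) 1 has_integral D (Ver i j) 0 b - D (Ver i j) 0 a) {a..b}"
      by (rule fundamental_theorem_of_calculus[OF ab(3)])
        (use D0[OF cV[OF ij]] in \<open>auto simp: has_real_derivative_iff_has_vector_derivative[symmetric] intro: has_field_derivative_at_within\<close>)
    then have "G i j 0 b - G i j 0 a = integral {a..b} (D (Ver i j) 1)" using DG[OF _ ij] ab by (simp add: integral_unique)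
    also have "D (Ver i j) 1 = (\<lambda>t. (D (Hor i) 0 t * D (Hor j) 1 t - D (Hor i) 1 t * D (Hor j) 0 t) / 2)"
      by (rule ext) (rule vel[OF ij])
    finally show "G i j 0 b - G i j 0 a = 1/2 * integral {a..b} (\<lambda>x. D (Hor i) 0 x * D (Hor j) 1 x - D (Hor i) 1 x * D (Hor j) 0 x)"
      by (simp add: integral_divide)
  qed
  then show ?thesis using W1 W2 P by blast
qed

theorem theorem6p3:
  fixes r m :: nat
    and K :: "real set"
    and F :: "nat \<Rightarrow> nat \<Rightarrow> real \<Rightarrow> real"
    and G :: "nat \<Rightarrow> nat \<Rightarrow> nat \<Rightarrow> real \<Rightarrow> real"
  assumes "r \<ge> 3" and "m \<ge> 1" and "compact K"
    and "\<And>i. 1 \<le> i \<Longrightarrow> i \<le> r \<Longrightarrow> jet m K (F i)"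
    and "\<And>i j. 1 \<le> j \<Longrightarrow> j < i \<Longrightarrow> i \<le> r \<Longrightarrow> jet m K (G i j)"
  shows "(\<exists>\<gamma>. C_horizontal_curve m r \<gamma> \<and>
            (\<forall>k\<le>m. \<forall>i. 1 \<le> i \<and> i \<le> r \<longrightarrow>
               (\<forall>t\<in>K. (deriv ^^ k) (\<lambda>s. \<gamma> s (Hor i)) t = F i k t)) \<and>
            (\<forall>k\<le>m. \<forall>i j. 1 \<le> j \<and> j < i \<and> i \<le> r \<longrightarrow>
               (\<forall>t\<in>K. (deriv ^^ k) (\<lambda>s. \<gamma> s (Ver i j)) t = G i j k t)))
     \<longleftrightarrow>
         ((\<forall>i. 1 \<le> i \<and> i \<le> r \<longrightarrow> whitney_field m K (F i)) \<and>
          (\<forall>i j. 1 \<le> j \<and> j < i \<and> i \<le> r \<longrightarrow> whitney_field m K (G i j))) \<and>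
         (\<forall>k. 1 \<le> k \<and> k \<le> m \<longrightarrow> (\<forall>t\<in>K. \<forall>i j. 1 \<le> j \<and> j < i \<and> i \<le> r \<longrightarrow>
            G i j k t = vert_poly k (\<lambda>l. F i l t) (\<lambda>l. F j l t))) \<and>
         gen_AV_condition m r K F G"
    (is "?L \<longleftrightarrow> ?R")
proof
  assume ?L
  then obtain \<gamma> where \<gamma>: "C_horizontal_curve m r \<gamma>"
    "\<forall>k\<le>m. \<forall>i. 1 \<le> i \<and> i \<le> r \<longrightarrow> (\<forall>t\<in>K. (deriv ^^ k) (\<lambda>s. \<gamma> s (Hor i)) t = F i k t)"
    "\<forall>k\<le>m. \<forall>i j. 1 \<le> j \<and> j < i \<and> i \<le> r \<longrightarrow> (\<forall>t\<in>K. (deriv ^^ k) (\<lambda>s. \<gamma> s (Ver i j)) t = G i j k t)"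
    by (elim exE conjE) (rule that; assumption)
  show ?R
  proof (rule necessity[OF assms(2,3) \<gamma>(1)])
    show "(deriv ^^ k) (\<lambda>s. \<gamma> s (Hor i)) t = F i k t" if "k \<le> m" "1 \<le> i" "i \<le> r" "t \<in> K" for k i t
      using \<gamma>(2) that by simp
    show "(deriv ^^ k) (\<lambda>s. \<gamma> s (Ver i j)) t = G i j k t" if "k \<le> m" "1 \<le> j" "j < i" "i \<le> r" "t \<in> K" for k i j t
      using \<gamma>(3) that by simp
  qed
next
  assume R: ?R
  note W = R[THEN conjunct1] and P = R[THEN conjunct2, THEN conjunct1] and AV = R[THEN conjunct2, THEN conjunct2]
  show ?L
  proof (rule sufficiency[OF assms(2,3)])
    show "whitney_field m K (F i)" if "1 \<le> i" "i \<le> r" for i using W that by simp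
    show "whitney_field m K (G i j)" if "1 \<le> j" "j < i" "i \<le> r" for i j using W that by simp
    show "G i j k t = vert_poly k (\<lambda>l. F i l t) (\<lambda>l. F j l t)"
      if "1 \<le> k" "k \<le> m" "t \<in> K" "1 \<le> j" "j < i" "i \<le> r" for k t i j using P that by simp
    show "gen_AV_condition m r K F G" by (rule AV)
  qed
qed

end
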